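(* Let $\kappa>0$, $s\ge 2$, let $X=\{x_1,\dots,x_s\}\subset\mathbb R^3$ be a set of $s$ distinct points with minimum separation $\delta_X$, and let $\rho>0$ satisfy $\bigcup_{j}\overline{B_\rho(x_j)}\subset B_1(0)$ and $\rho\le\delta_X/2$. Put $\gamma:=\rho\kappa$ and assume $\mu_X:=\frac92\frac{s^{2/3}}{\kappa\delta_X}<1$. Let $\widetilde{\mathcal U}$ be an $s$-dimensional subspace of $\mathcal H$ with $\varepsilon_{\rm sub}:=\|P_{\widetilde{\mathcal U}}-P_{\mathcal U_X}\|_2$. With the constants in the context, assume $$A_\gamma>0,\qquad C_2<\frac23,\qquad \varepsilon_{\rm sub}<\min\left\{\frac{\frac{\sqrt3}{2}\gamma\left(\frac23-C_2\right)}{1+\frac{\sqrt3}{2}\gamma\left(\frac2{\sqrt5}+\frac23\right)},\ \sin\left(\tfrac12\arcsin\sqrt{A_\gamma}\right)\right\}.$$ Let $C_0^\pm:=\frac23\pm\left[C_2+\left(\frac2{\sqrt5}+\frac23\right)\varepsilon_{\rm sub}\right]$, $m:=C_0^-\kappa^2$, $M:=C_0^+\kappa^2$. For a fixed step size $h$ with $$0<h\le\frac{2}{(C_0^-+C_0^+)\kappa^2}=\frac2{m+M},$$ let $T_h(z):=z-h\nabla\widetilde q(z)$. Then, for every $j=1,\dots,s$, $T_h\bigl(\overline{B_\rho(x_j)}\bigr)\subset B_\rho(x_j)$. Moreover, $T_h$ is a contraction on $\overline{B_\rho(x_j)}$ with contraction factor $r_h:=1-hm=1-hC_0^-\kappa^2\in[0,1)$.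 Consequently, every initialization $z^{(0)}\in\overline{B_\rho(x_j)}$ generates iterates $z^{(n+1)}=T_h(z^{(n)})$ that remain in $B_\rho(x_j)$ (for $n\ge1$) and converge to the unique local minimizer $\widetilde x_j$ of $\widetilde q$ in $B_\rho(x_j)$. More precisely, for all $n\ge0$, $$|z^{(n)}-\widetilde x_j|\le r_h^n|z^{(0)}-\widetilde x_j|,\qquad 0\le\widetilde q(z^{(n)})-\widetilde q(\widetilde x_j)\le\frac M2r_h^{2n}|z^{(0)}-\widetilde x_j|^2 .$$
   Context: $B_r(x)$ is the open Euclidean ball in $\mathbb R^3$. $\mathcal H=L^2(\mathbb S^2,\frac{d\omega}{4\pi})$ (complex), with norm and operator norm $\|\cdot\|_2$; $\varphi_z(\omega)=e^{i\kappa\omega\cdot z}$; $\mathcal U_X=\operatorname{span}\{\varphi_{x_1},\dots,\varphi_{x_s}\}$; $P_{\mathcal V}$ is the orthogonal projector onto $\mathcal V$; $\widetilde q(z)=\|(I-P_{\widetilde{\mathcal U}})\varphi_z\|_2^2$. Constants: $c_\nu=\sup_{t>0}|t\cos t-\sin t|/t$, $\nu_X=\frac{64c_\nu^2}{27}\frac{\mu_X^2}{s}$, $$C_1=\frac{\gamma^2}{9}+\nu_X+\sqrt{1+\nu_X}\sqrt{\left(\tfrac13+\tfrac{\gamma^2}{10}\right)^2+4\nu_X},\qquad C_2=\frac{8}{15}\gamma^2+6\nu_X+\frac{2\mu_X}{1-\mu_X}C_1,$$ $b_\gamma=1-\sup_{t\ge\gamma}(\sin t/t)^2$, $A_\gamma=\frac{b_\gamma-\mu_X-\nu_X}{1-\mu_X}$.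 *)

theory Defs
  imports "HOL-Analysis.Analysis"
begin

(* Normalised surface measure: a Borel set E of the sphere gets the fraction of the volume of
   the unit ball that is occupied by the cone {t *R w | w : E, 0 < t < 1} over E.  (The centre
   of the ball, where the radial projection is not defined, is a null set.) *)
definition sphere_measure :: "(real^3) measure" where
  "sphere_measure =
     restrict_space
       (distr (uniform_measure lborel (ball 0 1)) borel (\<lambda>x. x /\<^sub>R norm x))
       (sphere 0 1)"

lemma space_sphere_measure [simp]: "space sphere_measure = sphere 0 1"
  by (simp add: sphere_measure_def space_restrict_space)

lemma radial_measurable:
  "(\<lambda>x::real^3. x /\<^sub>R norm x) \<in> measurable (uniform_measure lborel (ball 0 1)) borel"
  by measurable

lemma emeasure_sphere_measure:
  assumes "E \<in> sets borel" "E \<subseteq> sphere 0 1"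
  shows "emeasure sphere_measure E =
    emeasure lborel {x::real^3. norm x < 1 \<and> x /\<^sub>R norm x \<in> E} / emeasure lborel (ball (0::real^3) 1)"
proof -
  have "emeasure sphere_measure E =
      emeasure (distr (uniform_measure lborel (ball 0 1)) borel (\<lambda>x::real^3. x /\<^sub>R norm x)) E"
    unfolding sphere_measure_def by (rule emeasure_restrict_space) (use assms in auto)
  also have "\<dots> = emeasure (uniform_measure lborel (ball 0 1)) ((\<lambda>x::real^3. x /\<^sub>R norm x) -` E)"
    using emeasure_distr[OF radial_measurable assms(1)] by simp
  also have "\<dots> = emeasure lborel (ball 0 1 \<inter> (\<lambda>x::real^3. x /\<^sub>R norm x) -` E)
      / emeasure lborel (ball (0::real^3) 1)"
  proof (rule emeasure_uniform_measure)
    have "(\<lambda>x::real^3. x /\<^sub>R norm x) \<in> borel_measurable lborel" by measurable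
    from measurable_sets[OF this assms(1)]
    show "(\<lambda>x::real^3. x /\<^sub>R norm x) -` E \<in> sets lborel" by simp
  qed simp
  also have "ball 0 1 \<inter> (\<lambda>x::real^3. x /\<^sub>R norm x) -` E = {x. norm x < 1 \<and> x /\<^sub>R norm x \<in> E}"
    by auto
  finally show ?thesis .
qed

lemma emeasure_sphere_measure_space: "emeasure sphere_measure (sphere 0 1) = 1"
proof -
  have B: "emeasure lborel (ball (0::real^3) 1) \<noteq> 0" "emeasure lborel (ball (0::real^3) 1) \<noteq> \<infinity>"
    using content_ball_pos[of 1 "0::real^3"] by (auto simp: measure_def emeasure_lborel_ball_finite)
  have "{x::real^3. norm x < 1 \<and> x /\<^sub>R norm x \<in> sphere 0 1} = ball 0 1 - {0}"
    by auto
  moreover have "emeasure lborel (ball (0::real^3) 1 - {0}) = emeasure lborel (ball (0::real^3) 1)"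
    by (rule emeasure_Diff_null_set) (auto simp: null_sets_def)
  ultimately show ?thesis
    using B by (subst emeasure_sphere_measure) (auto simp: ennreal_divide_self top.not_eq_extremum)
qed

interpretation sphere_measure: finite_measure sphere_measure
  by standard (simp add: emeasure_sphere_measure_space)

definition square_integrable :: "(real^3 \<Rightarrow> complex) \<Rightarrow> bool" where
  "square_integrable f \<longleftrightarrow>
     f \<in> borel_measurable sphere_measure \<and> integrable sphere_measure (\<lambda>\<omega>. (norm (f \<omega>))\<^sup>2)"

lemma square_integrableD:
  "square_integrable f \<Longrightarrow> f \<in> borel_measurable sphere_measure"
  "square_integrable f \<Longrightarrow> integrable sphere_measure (\<lambda>\<omega>. (norm (f \<omega>))\<^sup>2)"
  by (simp_all add: square_integrable_def)

lemma square_integrable_zero: "square_integrable (\<lambda>_. 0)"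
  by (simp add: square_integrable_def)

lemma square_integrable_mult:
  assumes "square_integrable f" shows "square_integrable (\<lambda>\<omega>. c * f \<omega>)"
  using assms by (auto simp: square_integrable_def norm_mult power_mult_distrib intro!: borel_measurable_times)

lemma square_integrable_add:
  assumes f: "square_integrable f" and g: "square_integrable g"
  shows "square_integrable (\<lambda>\<omega>. f \<omega> + g \<omega>)"
proof -
  note [measurable] = square_integrableD(1)[OF f] square_integrableD(1)[OF g]
  have "integrable sphere_measure (\<lambda>\<omega>. (norm (f \<omega> + g \<omega>))\<^sup>2)"
  proof (rule Bochner_Integration.integrable_bound)
    show "integrable sphere_measure (\<lambda>\<omega>. 2 * (norm (f \<omega>))\<^sup>2 + 2 * (norm (g \<omega>))\<^sup>2)"
      using f g by (simp add: square_integrable_def)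
    have "(norm (a + b))\<^sup>2 \<le> 2 * (norm a)\<^sup>2 + 2 * (norm b)\<^sup>2" for a b :: complex
    proof -
      have "(norm (a + b))\<^sup>2 \<le> (norm a + norm b)\<^sup>2"
        by (intro power_mono norm_triangle_ineq) simp
      also have "\<dots> \<le> 2 * (norm a)\<^sup>2 + 2 * (norm b)\<^sup>2"
        using zero_le_power2[of "norm a - norm b"] by (simp add: power2_eq_square algebra_simps)
      finally show ?thesis .
    qed
    then show "AE \<omega> in sphere_measure. norm ((norm (f \<omega> + g \<omega>))\<^sup>2)
        \<le> norm (2 * (norm (f \<omega>))\<^sup>2 + 2 * (norm (g \<omega>))\<^sup>2)"
      by simp
  qed measurable
  then show ?thesis by (simp add: square_integrable_def)
qed

lemma borel_measurable_cnj [measurable]: "cnj \<in> borel_measurable borel"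
  by (intro borel_measurable_continuous_onI continuous_intros)

lemma square_integrable_integrable_cnj:
  assumes f: "square_integrable f" and g: "square_integrable g"
  shows "integrable sphere_measure (\<lambda>\<omega>. f \<omega> * cnj (g \<omega>))"
proof (rule Bochner_Integration.integrable_bound)
  note [measurable] = square_integrableD(1)[OF f] square_integrableD(1)[OF g]
  show "integrable sphere_measure (\<lambda>\<omega>. (norm (f \<omega>))\<^sup>2 + (norm (g \<omega>))\<^sup>2)"
    using f g by (simp add: square_integrable_def)
  have "norm a * norm b \<le> (norm a)\<^sup>2 + (norm b)\<^sup>2" for a b :: complex
  proof -
    have "2 * (norm a * norm b) \<le> (norm a)\<^sup>2 + (norm b)\<^sup>2"
      using zero_le_power2[of "norm a - norm b"] by (simp add: power2_eq_square algebra_simps)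
    moreover have "0 \<le> norm a * norm b" by simp
    ultimately show ?thesis by linarith
  qed
  then show "AE \<omega> in sphere_measure. norm (f \<omega> * cnj (g \<omega>))
      \<le> norm ((norm (f \<omega>))\<^sup>2 + (norm (g \<omega>))\<^sup>2)"
    by (simp add: norm_mult)
  show "(\<lambda>\<omega>. f \<omega> * cnj (g \<omega>)) \<in> borel_measurable sphere_measure"
    by measurable
qed

quotient_type l2_sphere = "real^3 \<Rightarrow> complex" / partial:
  "\<lambda>f g. square_integrable f \<and> square_integrable g \<and> (AE \<omega> in sphere_measure. f \<omega> = g \<omega>)"
proof (rule part_equivpI)
  show "\<exists>f. square_integrable f \<and> square_integrable f \<and> (AE \<omega> in sphere_measure. f \<omega> = f \<omega>)"
    using square_integrable_zero by auto
qed (auto intro!: sympI transpI elim: eventually_elim2)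

lift_definition l2_scale :: "complex \<Rightarrow> l2_sphere \<Rightarrow> l2_sphere" is "\<lambda>c f \<omega>. c * f \<omega>"
  by (auto intro: square_integrable_mult)

lift_definition cinner :: "l2_sphere \<Rightarrow> l2_sphere \<Rightarrow> complex" is
  "\<lambda>f g. \<integral>\<omega>. f \<omega> * cnj (g \<omega>) \<partial>sphere_measure"
proof -
  fix f f' g g' :: "real^3 \<Rightarrow> complex"
  assume f: "square_integrable f \<and> square_integrable f' \<and> (AE \<omega> in sphere_measure. f \<omega> = f' \<omega>)"
    and g: "square_integrable g \<and> square_integrable g' \<and> (AE \<omega> in sphere_measure. g \<omega> = g' \<omega>)"
  then have [measurable]: "f \<in> borel_measurable sphere_measure" "f' \<in> borel_measurable sphere_measure"
    "g \<in> borel_measurable sphere_measure" "g' \<in> borel_measurable sphere_measure"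
    by (auto dest: square_integrableD)
  show "(\<integral>\<omega>. f \<omega> * cnj (g \<omega>) \<partial>sphere_measure) = (\<integral>\<omega>. f' \<omega> * cnj (g' \<omega>) \<partial>sphere_measure)"
  proof (rule integral_cong_AE)
    show "AE \<omega> in sphere_measure. f \<omega> * cnj (g \<omega>) = f' \<omega> * cnj (g' \<omega>)"
      using f g by (auto elim: eventually_elim2)
  qed measurable
qed

instantiation l2_sphere :: ab_group_add
begin

lift_definition zero_l2_sphere :: l2_sphere is "\<lambda>_. 0"
  by (simp add: square_integrable_zero)

lift_definition plus_l2_sphere :: "l2_sphere \<Rightarrow> l2_sphere \<Rightarrow> l2_sphere" is "\<lambda>f g \<omega>. f \<omega> + g \<omega>"
  by (auto intro: square_integrable_add elim: eventually_elim2)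

definition "- f = l2_scale (- 1) f" for f :: l2_sphere

definition "f - g = f + (- g)" for f g :: l2_sphere

instance
proof
  fix a b c :: l2_sphere
  show "a + b + c = a + (b + c)"
    by transfer (auto intro!: square_integrable_add simp: algebra_simps)
  show "a + b = b + a"
    by transfer (auto intro!: square_integrable_add simp: algebra_simps)
  show "0 + a = a"
    by transfer auto
  show "- a + a = 0"
    unfolding uminus_l2_sphere_def
    by transfer (auto intro!: square_integrable_add square_integrable_mult square_integrable_zero
      simp: square_integrable_zero)
  show "a - b = a + - b"
    by (simp add: minus_l2_sphere_def)
qed

end

global_interpretation l2: vector_space l2_scale
proof
  fix a b :: complex and x y :: l2_sphere
  show "l2_scale a (x + y) = l2_scale a x + l2_scale a y"
    by transfer (auto intro!: square_integrable_add square_integrable_mult simp: algebra_simps)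
  show "l2_scale (a + b) x = l2_scale a x + l2_scale b x"
    by transfer (auto intro!: square_integrable_add square_integrable_mult simp: algebra_simps)
  show "l2_scale a (l2_scale b x) = l2_scale (a * b) x"
    by transfer (auto intro!: square_integrable_mult simp: algebra_simps)
  show "l2_scale 1 x = x"
    by transfer auto
qed

lemma cinner_commute: "cinner f g = cnj (cinner g f)"
proof (transfer, elim conjE)
  fix f g :: "real^3 \<Rightarrow> complex"
  have "cnj (\<integral>\<omega>. g \<omega> * cnj (f \<omega>) \<partial>sphere_measure) = (\<integral>\<omega>. cnj (g \<omega> * cnj (f \<omega>)) \<partial>sphere_measure)"
    by (rule Bochner_Integration.integral_cnj[symmetric])
  then show "(\<integral>\<omega>. f \<omega> * cnj (g \<omega>) \<partial>sphere_measure) = cnj (\<integral>\<omega>. g \<omega> * cnj (f \<omega>) \<partial>sphere_measure)"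
    by (simp add: mult.commute)
qed

lemma cinner_add_left: "cinner (f + g) k = cinner f k + cinner g k"
  by transfer (simp add: algebra_simps square_integrable_integrable_cnj)

lemma cinner_scale_left: "cinner (l2_scale c f) g = c * cinner f g"
  by transfer (simp add: mult.assoc)

lemma cinner_self_nonneg: "0 \<le> Re (cinner f f)"
  by transfer (simp add: complex_norm_square[symmetric] integral_complex_of_real del: of_real_power)

lemma cinner_self_eq_0: "Re (cinner f f) = 0 \<longleftrightarrow> f = 0"
proof (transfer, elim conjE, intro iffI)
  fix f assume f: "square_integrable f"
  have *: "Re (\<integral>\<omega>. f \<omega> * cnj (f \<omega>) \<partial>sphere_measure) = (\<integral>\<omega>. (norm (f \<omega>))\<^sup>2 \<partial>sphere_measure)"
    by (simp add: complex_norm_square[symmetric] integral_complex_of_real del: of_real_power)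
  { assume "Re (\<integral>\<omega>. f \<omega> * cnj (f \<omega>) \<partial>sphere_measure) = 0"
    then have "(\<integral>\<omega>. (norm (f \<omega>))\<^sup>2 \<partial>sphere_measure) = 0" by (simp only: *)
    then have "AE \<omega> in sphere_measure. (norm (f \<omega>))\<^sup>2 = 0"
      using integral_nonneg_eq_0_iff_AE[OF square_integrableD(2)[OF f]] by simp
    then show "square_integrable f \<and> square_integrable (\<lambda>_. 0) \<and> (AE \<omega> in sphere_measure. f \<omega> = 0)"
      using f square_integrable_zero by simp }
  { assume "square_integrable f \<and> square_integrable (\<lambda>_. 0) \<and> (AE \<omega> in sphere_measure. f \<omega> = 0)"
    then have "(\<integral>\<omega>. (norm (f \<omega>))\<^sup>2 \<partial>sphere_measure) = 0"
      by (intro integral_eq_zero_AE) auto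
    then show "Re (\<integral>\<omega>. f \<omega> * cnj (f \<omega>) \<partial>sphere_measure) = 0" by (simp only: *) }
qed

instantiation l2_sphere :: real_vector
begin

definition "scaleR r f = l2_scale (of_real r) f" for f :: l2_sphere

instance
  by standard
    (simp_all add: scaleR_l2_sphere_def l2.scale_right_distrib l2.scale_left_distrib)

end

(* The underlying real Hilbert space.  Its norm is the L2 norm, since cinner f f is real, and
   the library's operator norm onorm of a complex-linear map is its usual operator norm. *)
instantiation l2_sphere :: real_inner
begin

definition "inner f g = Re (cinner f g)" for f g :: l2_sphere
definition "norm f = sqrt (inner f f)" for f :: l2_sphere
definition "dist f g = norm (f - g)" for f g :: l2_sphere
definition "sgn f = f /\<^sub>R norm f" for f :: l2_sphere
definition
  "(uniformity :: (l2_sphere \<times> l2_sphere) filter) = (INF e\<in>{0 <..}. principal {(x, y). dist x y < e})"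
definition
  "open S \<longleftrightarrow> (\<forall>x\<in>S. \<forall>\<^sub>F (x', y) in uniformity. x' = x \<longrightarrow> y \<in> S)" for S :: "l2_sphere set"

instance
proof
  fix a :: real and x y z :: l2_sphere
  show "dist x y = norm (x - y)" "sgn x = x /\<^sub>R norm x" "norm x = sqrt (inner x x)"
    by (rule dist_l2_sphere_def sgn_l2_sphere_def norm_l2_sphere_def)+
  show "(uniformity :: (l2_sphere \<times> l2_sphere) filter)
      = (INF e\<in>{0 <..}. principal {(x, y). dist x y < e})"
    by (rule uniformity_l2_sphere_def)
  show "open U \<longleftrightarrow> (\<forall>x\<in>U. \<forall>\<^sub>F (x', y) in uniformity. x' = x \<longrightarrow> y \<in> U)" for U :: "l2_sphere set"
    by (rule open_l2_sphere_def)
  show "inner x y = inner y x"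
    unfolding inner_l2_sphere_def by (subst cinner_commute) simp
  show "inner (x + y) z = inner x z + inner y z"
    by (simp add: inner_l2_sphere_def cinner_add_left)
  show "inner (a *\<^sub>R x) y = a * inner x y"
    by (simp add: inner_l2_sphere_def scaleR_l2_sphere_def cinner_scale_left)
  show "0 \<le> inner x x" "inner x x = 0 \<longleftrightarrow> x = 0"
    by (simp_all add: inner_l2_sphere_def cinner_self_nonneg cinner_self_eq_0)
qed

end

lift_definition plane_wave :: "real \<Rightarrow> real^3 \<Rightarrow> l2_sphere" is
  "\<lambda>\<kappa> z \<omega>. exp (\<i> * of_real (\<kappa> * (\<omega> \<bullet> z)))"
proof -
  fix \<kappa> :: real and z :: "real^3"
  have "(\<lambda>\<omega>. exp (\<i> * of_real (\<kappa> * (\<omega> \<bullet> z)))) \<in> borel_measurable borel"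
    by (intro borel_measurable_continuous_onI continuous_intros)
  then have "(\<lambda>\<omega>. exp (\<i> * of_real (\<kappa> * (\<omega> \<bullet> z)))) \<in> borel_measurable sphere_measure"
    unfolding sphere_measure_def by (intro measurable_restrict_space1) simp
  then show "square_integrable (\<lambda>\<omega>. exp (\<i> * of_real (\<kappa> * (\<omega> \<bullet> z)))) \<and>
      square_integrable (\<lambda>\<omega>. exp (\<i> * of_real (\<kappa> * (\<omega> \<bullet> z)))) \<and>
      (AE \<omega> in sphere_measure. exp (\<i> * of_real (\<kappa> * (\<omega> \<bullet> z))) = exp (\<i> * of_real (\<kappa> * (\<omega> \<bullet> z))))"
    by (simp add: square_integrable_def)
qed

(* THE is well defined for every finite-dimensional complex subspace V, the only case used. *)
definition orth_proj :: "l2_sphere set \<Rightarrow> l2_sphere \<Rightarrow> l2_sphere" where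
  "orth_proj V f = (THE p. p \<in> V \<and> (\<forall>v\<in>V. cinner (f - p) v = 0))"

definition wave_span :: "real \<Rightarrow> (real^3) set \<Rightarrow> l2_sphere set" where
  "wave_span \<kappa> X = l2.span (plane_wave \<kappa> ` X)"

definition q_tilde :: "real \<Rightarrow> l2_sphere set \<Rightarrow> real^3 \<Rightarrow> real" where
  "q_tilde \<kappa> U z = (norm (plane_wave \<kappa> z - orth_proj U (plane_wave \<kappa> z)))\<^sup>2"

definition gradient :: "('a::real_inner \<Rightarrow> real) \<Rightarrow> 'a \<Rightarrow> 'a" where
  "gradient f z = (THE D. GDERIV f z :> D)"

definition local_minimizer :: "('a::topological_space \<Rightarrow> real) \<Rightarrow> 'a \<Rightarrow> bool" where
  "local_minimizer f z \<longleftrightarrow> (\<forall>\<^sub>F y in nhds z. f z \<le> f y)"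

definition min_separation :: "'a::metric_space set \<Rightarrow> real" where
  "min_separation X = Min {dist a b |a b. a \<in> X \<and> b \<in> X \<and> a \<noteq> b}"

definition mu_X :: "nat \<Rightarrow> real \<Rightarrow> real \<Rightarrow> real" where
  "mu_X s \<kappa> \<delta> = 9 / 2 * (real s powr (2 / 3) / (\<kappa> * \<delta>))"

definition c_nu :: real where
  "c_nu = (SUP t\<in>{0<..}. \<bar>t * cos t - sin t\<bar> / t)"

definition nu_X :: "nat \<Rightarrow> real \<Rightarrow> real" where
  "nu_X s \<mu> = 64 * c_nu\<^sup>2 / 27 * (\<mu>\<^sup>2 / real s)"

definition C1 :: "real \<Rightarrow> real \<Rightarrow> real" where
  "C1 \<gamma> \<nu> = \<gamma>\<^sup>2 / 9 + \<nu> + sqrt (1 + \<nu>) * sqrt ((1 / 3 + \<gamma>\<^sup>2 / 10)\<^sup>2 + 4 * \<nu>)"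

definition C2 :: "real \<Rightarrow> real \<Rightarrow> real \<Rightarrow> real" where
  "C2 \<gamma> \<mu> \<nu> = 8 / 15 * \<gamma>\<^sup>2 + 6 * \<nu> + 2 * \<mu> / (1 - \<mu>) * C1 \<gamma> \<nu>"

definition b_gamma :: "real \<Rightarrow> real" where
  "b_gamma \<gamma> = 1 - (SUP t\<in>{\<gamma>..}. (sin t / t)\<^sup>2)"

definition A_gamma :: "real \<Rightarrow> real \<Rightarrow> real \<Rightarrow> real" where
  "A_gamma \<gamma> \<mu> \<nu> = (b_gamma \<gamma> - \<mu> - \<nu>) / (1 - \<mu>)"

end

(* The gradient and the Hessian of q are expressed through the projected plane waves and their
   first and second derivatives.  Pairings of these with the waves at the points x_k are sphere
   integrals; by rotation invariance they reduce to sinc and its derivatives, which decay like 1/t.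
   A packing argument (the k-th nearest point is at distance at least a multiple of k^(1/3)) sums
   this decay and shows that the Gram matrix is within mu of the identity and that all points other
   than x_j contribute at most nu.  Hence for U = U_X the Hessian on the closed ball around x_j
   differs from (2/3) kappa^2 I by at most C2 kappa^2; passing to U changes Hessian and gradient by
   multiples of epsilon.  So m <= Hessian <= M on the ball and |grad q(x_j)| < m rho, which makes
   the gradient step a contraction of the ball into its interior. *)

theory Submission
  imports Defs
begin

text \<open>The sphere measure is given through volumes of cones, so invariance under orthogonal
  maps has to replace surface calculus: the antipodal map kills odd integrands, moving the axes
  yields the moments 1/3 and 1/5, and differentiating the invariance yields the differential
  equation solved by sinc. The 2/3 is twice the second moment: near x_j the derivative of the wave
  is almost orthogonal to the span of the waves, so the Hessian comes almost entirely from the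
  second derivative. The factors 2/3 and 2 / sqrt 5 of \<epsilon> are twice the squared norm of the
  first and twice the norm of the second derivative of the wave, for \<kappa> = 1. Sources are
  \<delta> apart, but a point of a ball is only known to be \<delta>/2 away from foreign sources.
  Hence two packing estimates: 9/2 = 3 * 3/2 enters \<mu>, and 48 = 16 * 3 enters \<nu>. The first
  bound on \<epsilon> says precisely that the estimate 2 \<epsilon> \<kappa> / sqrt 3 of the
  gradient at x_j is below m \<rho>: the centre then moves by less than h m \<rho>, the room left by
  a contraction with factor 1 - h m.\<close>

section \<open>Packing sums\<close>

text \<open>The integral bound, obtained by telescoping: for consecutive cube roots a and b the
  identity a^3 - b^3 = 1 reduces \<open>1 / a \<le> 3 / 2 * (a\<^sup>2 - b\<^sup>2)\<close> to a
  comparison of polynomials.\<close>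

lemma sum_inverse_cbrt_le:
  "(\<Sum>k=1..n. 1 / root 3 (real k)) \<le> 3 / 2 * (root 3 (real n))\<^sup>2"
proof (induction n)
  case (Suc n)
  define a b where "a = root 3 (real (Suc n))" and "b = root 3 (real n)"
  have a: "a > 0" "b \<ge> 0" "b \<le> a" "a ^ 3 - b ^ 3 = 1"
    by (auto simp: a_def b_def)
  have "b\<^sup>2 \<le> a * b" "b\<^sup>2 \<le> a\<^sup>2"
    using a by (auto simp: power2_eq_square mult_right_mono mult_mono)
  \<comment> \<open>After cancelling a - b this is
    \<open>2 * b\<^sup>2 \<le> a\<^sup>2 + a * b\<close>.\<close>
  then have "(a - b) * (2 * (a\<^sup>2 + a * b + b\<^sup>2)) \<le> (a - b) * (3 * a * (a + b))"
    using a by (intro mult_left_mono) (auto simp: power2_eq_square algebra_simps)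
  then have "2 * (a ^ 3 - b ^ 3) \<le> 3 * a * (a\<^sup>2 - b\<^sup>2)"
    by (simp add: power2_eq_square power3_eq_cube algebra_simps)
  then have "1 / a \<le> 3 / 2 * (a\<^sup>2 - b\<^sup>2)"
    using a by (simp add: field_simps)
  with Suc.IH show ?case
    by (simp add: a_def[symmetric] b_def[symmetric] algebra_simps flip: of_nat_Suc del: of_nat_Suc)
qed simp

lemma sum_inverse_cbrt_square_le:
  "(\<Sum>k=1..n. 1 / (root 3 (real k))\<^sup>2) \<le> 3 * root 3 (real n)"
proof (induction n)
  case (Suc n)
  define a b where "a = root 3 (real (Suc n))" and "b = root 3 (real n)"
  have a: "a > 0" "b \<ge> 0" "b \<le> a" "a ^ 3 - b ^ 3 = 1"
    by (auto simp: a_def b_def)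
  have "b\<^sup>2 \<le> a\<^sup>2" "a * b \<le> a\<^sup>2"
    using a by (auto simp: power2_eq_square intro!: mult_left_mono mult_mono)
  then have "a\<^sup>2 + a * b + b\<^sup>2 \<le> 3 * a\<^sup>2"
    by linarith
  then have "(a - b) * (a\<^sup>2 + a * b + b\<^sup>2) \<le> (a - b) * (3 * a\<^sup>2)"
    using a by (intro mult_left_mono) auto
  then have "a ^ 3 - b ^ 3 \<le> 3 * a\<^sup>2 * (a - b)"
    by (simp add: power2_eq_square power3_eq_cube algebra_simps)
  then have "1 / a\<^sup>2 \<le> 3 * (a - b)"
    using a by (simp add: field_simps)
  with Suc.IH show ?case
    by (simp add: a_def[symmetric] b_def[symmetric] algebra_simps flip: of_nat_Suc del: of_nat_Suc)
qed simp

text \<open>Remove a point with the largest \<open>d\<close>: its rank is the full cardinality, so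
  it is paid for by the last term. The ranks of the others can only drop, namely at ties with the
  removed point, and their bounds survive because \<open>H\<close> is decreasing.\<close>

lemma sum_le_sum_rank:
  fixes d :: "'a \<Rightarrow> 'b::linorder" and g :: "'a \<Rightarrow> real"
  assumes "finite S" and "\<And>x. x \<in> S \<Longrightarrow> g x \<le> H (card {y\<in>S. d y \<le> d x})"
    and mono: "\<And>i j. 0 < i \<Longrightarrow> i \<le> j \<Longrightarrow> H j \<le> H i"
  shows "(\<Sum>x\<in>S. g x) \<le> (\<Sum>k=1..card S. H k)"
  using assms(1,2)
proof (induction "card S" arbitrary: S)
  case (Suc n)
  then have "S \<noteq> {}" by auto
  obtain x where x: "x \<in> S" "\<And>y. y \<in> S \<Longrightarrow> d y \<le> d x"
    using Max_in[of "d ` S"] Max_ge[of "d ` S"] Suc.prems(1) \<open>S \<noteq> {}\<close> by fastforce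
  have card: "card (S - {x}) = n"
    using Suc x by simp
  have "g y \<le> H (card {z\<in>S - {x}. d z \<le> d y})" if "y \<in> S - {x}" for y
  proof -
    have "card {z\<in>S - {x}. d z \<le> d y} > 0"
      using that Suc.prems(1) by (subst card_gt_0_iff) auto
    moreover have "card {z\<in>S - {x}. d z \<le> d y} \<le> card {z\<in>S. d z \<le> d y}"
      using Suc.prems(1) by (intro card_mono) auto
    ultimately show ?thesis
      using Suc.prems(2)[of y] that mono order_trans by blast
  qed
  then have "(\<Sum>y\<in>S - {x}. g y) \<le> (\<Sum>k=1..n. H k)"
    using Suc.hyps(1)[of "S - {x}"] Suc.prems(1) card by simp
  moreover have "{y\<in>S. d y \<le> d x} = S"
    using x by auto
  then have "g x \<le> H (Suc n)"
    using Suc.prems(2)[OF x(1)] Suc.hyps(2) by simp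
  ultimately show ?case
    using Suc.prems(1) x(1) Suc.hyps(2)[symmetric] by (simp add: sum.remove)
qed simp

text \<open>Volume comparison: the balls of radius \<open>r\<close> around the points are disjoint
  and lie in one ball of radius \<open>R + r\<close>.\<close>

lemma card_balls_packing:
  fixes c :: "real^3"
  assumes "finite S" "r > 0" "R > 0"
    and sep: "\<And>x y. x \<in> S \<Longrightarrow> y \<in> S \<Longrightarrow> x \<noteq> y \<Longrightarrow> 2 * r \<le> dist x y"
    and le: "\<And>x. x \<in> S \<Longrightarrow> dist c x \<le> R"
  shows "r * root 3 (real (card S)) \<le> R + r"
proof -
  have vol: "measure lebesgue (ball a t) = 4 / 3 * pi * t ^ 3" if "t \<ge> 0" for a :: "real^3" and t
    using content_ball[OF that, of a] that by (simp add: unit_ball_vol_3)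
  have "disjnt (ball x r) (ball y r)" if "x \<in> S" "y \<in> S" "x \<noteq> y" for x y
    using sep[OF that] dist_triangle_less_add[of x _ r y r] 
    unfolding disjnt_iff by (metis dist_commute linorder_not_less mem_ball mult_2)
  then have "measure lebesgue (\<Union>x\<in>S. ball x r) = (\<Sum>x\<in>S. measure lebesgue (ball x r))"
    using assms(1) by (intro measure_UNION') (auto simp: pairwise_def)
  also have "\<dots> = real (card S) * (4 / 3 * pi * r ^ 3)"
    using assms(2) by (subst sum.cong[OF refl vol]) auto
  finally have "real (card S) * (4 / 3 * pi * r ^ 3) = measure lebesgue (\<Union>x\<in>S. ball x r)" ..
  also have "\<dots> \<le> measure lebesgue (ball c (R + r))"
  proof (rule measure_mono_fmeasurable)
    show "(\<Union>x\<in>S. ball x r) \<subseteq> ball c (R + r)"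
      using le by (force simp: intro: le_less_trans[OF dist_triangle] add_le_less_mono)
    show "(\<Union>x\<in>S. ball x r) \<in> sets lebesgue"
      using assms(1) by auto
  qed auto
  also have "\<dots> = 4 / 3 * pi * (R + r) ^ 3"
    using assms by (subst vol) auto
  finally have "real (card S) * r ^ 3 \<le> (R + r) ^ 3"
    by (simp add: field_simps)
  then have "(r * root 3 (real (card S))) ^ 3 \<le> (R + r) ^ 3"
    by (simp add: power_mult_distrib mult.commute)
  then show ?thesis
    using assms by (subst (asm) power_mono_iff) auto
qed

text \<open>The packing bound controls the rank of a point by its distance from \<open>z\<close>, up
  to an extra \<delta>/2. If all distances are at least \<delta>, then dist + \<delta>/2 is at most
  3/2 dist; if they are only at least \<delta>/2, it is at most 2 dist. This gives the factors 3 and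
  4, the latter squared to 16.\<close>

lemma
  fixes z :: "real^3"
  assumes fin: "finite S" and \<delta>: "\<delta> > 0"
    and sep: "\<And>x y. x \<in> S \<Longrightarrow> y \<in> S \<Longrightarrow> x \<noteq> y \<Longrightarrow> \<delta> \<le> dist x y"
  shows sum_inverse_dist_le:
      "(\<And>x. x \<in> S \<Longrightarrow> \<delta> \<le> dist z x) \<Longrightarrow>
        (\<Sum>x\<in>S. 1 / dist z x) \<le> 9 / 2 * (root 3 (real (card S)))\<^sup>2 / \<delta>"
    and sum_inverse_dist_square_le:
      "(\<And>x. x \<in> S \<Longrightarrow> \<delta> / 2 \<le> dist z x) \<Longrightarrow>
        (\<Sum>x\<in>S. 1 / (dist z x)\<^sup>2) \<le> 48 * root 3 (real (card S)) / \<delta>\<^sup>2"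
proof -
  let ?n = "\<lambda>x. card {y\<in>S. dist z y \<le> dist z x}"
  have rank: "\<delta> / 2 * root 3 (real (?n x)) \<le> dist z x + \<delta> / 2" and pos: "?n x > 0"
    if "x \<in> S" "dist z x > 0" for x
  proof -
    show "\<delta> / 2 * root 3 (real (?n x)) \<le> dist z x + \<delta> / 2"
      using that \<delta> fin sep by (intro card_balls_packing) auto
    show "?n x > 0"
      using that fin by (subst card_gt_0_iff) auto
  qed
  {
    assume far: "\<And>x. x \<in> S \<Longrightarrow> \<delta> \<le> dist z x"
    have "1 / dist z x \<le> 3 / \<delta> * (1 / root 3 (real (?n x)))" if "x \<in> S" for x
    proof -
      have "0 < dist z x" using far[OF that] \<delta> by linarith
      moreover have "\<delta> * root 3 (real (?n x)) \<le> 3 * dist z x"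
        using rank[of x] far[OF that] that \<open>0 < dist z x\<close> by linarith
      ultimately show ?thesis
        using \<delta> pos[of x] that by (simp add: field_simps)
    qed
    then have "(\<Sum>x\<in>S. 1 / dist z x) \<le> (\<Sum>k=1..card S. 3 / \<delta> * (1 / root 3 (real k)))"
      using \<delta> fin by (intro sum_le_sum_rank[where d = "dist z"] mult_left_mono divide_left_mono) auto
    also have "\<dots> \<le> 3 / \<delta> * (3 / 2 * (root 3 (real (card S)))\<^sup>2)"
      unfolding sum_distrib_left[symmetric]
      using \<delta> by (intro mult_left_mono sum_inverse_cbrt_le) auto
    finally show "(\<Sum>x\<in>S. 1 / dist z x) \<le> 9 / 2 * (root 3 (real (card S)))\<^sup>2 / \<delta>"
      by simp
  }
  {
    assume far: "\<And>x. x \<in> S \<Longrightarrow> \<delta> / 2 \<le> dist z x"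
    have "1 / (dist z x)\<^sup>2 \<le> 16 / \<delta>\<^sup>2 * (1 / (root 3 (real (?n x)))\<^sup>2)" if "x \<in> S" for x
    proof -
      have "0 < dist z x" using far[OF that] \<delta> by linarith
      moreover have "\<delta> * root 3 (real (?n x)) \<le> 4 * dist z x"
        using rank[of x] far[OF that] that \<open>0 < dist z x\<close> by linarith
      then have "(\<delta> * root 3 (real (?n x)))\<^sup>2 \<le> (4 * dist z x)\<^sup>2"
        using \<delta> by (intro power_mono) auto
      ultimately show ?thesis
        using \<delta> pos[of x] that by (simp add: field_simps power_mult_distrib)
    qed
    then have "(\<Sum>x\<in>S. 1 / (dist z x)\<^sup>2) \<le> (\<Sum>k=1..card S. 16 / \<delta>\<^sup>2 * (1 / (root 3 (real k))\<^sup>2))"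
      using \<delta> fin by (intro sum_le_sum_rank[where d = "dist z"] mult_left_mono divide_left_mono power_mono) auto
    also have "\<dots> \<le> 16 / \<delta>\<^sup>2 * (3 * root 3 (real (card S)))"
      unfolding sum_distrib_left[symmetric]
      using \<delta> by (intro mult_left_mono sum_inverse_cbrt_square_le) auto
    finally show "(\<Sum>x\<in>S. 1 / (dist z x)\<^sup>2) \<le> 48 * root 3 (real (card S)) / \<delta>\<^sup>2"
      by simp
  }
qed

section \<open>Integrals over the sphere\<close>

lemma sets_sphere_measure:
  "A \<in> sets sphere_measure \<longleftrightarrow> A \<in> sets borel \<and> A \<subseteq> sphere 0 1"
  unfolding sphere_measure_def by (subst sets_restrict_space_iff) auto

lemma measurable_sphere_continuous:
  fixes F :: "real^3 \<Rightarrow> 'a::topological_space"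
  assumes "continuous_on UNIV F"
  shows "F \<in> borel_measurable sphere_measure"
proof -
  have "F \<in> borel_measurable borel"
    using assms by (rule borel_measurable_continuous_onI)
  then show ?thesis
    unfolding sphere_measure_def by (intro measurable_restrict_space1) simp
qed

lemma integrable_sphere_continuous:
  fixes F :: "real^3 \<Rightarrow> 'a::{banach, second_countable_topology}"
  assumes "continuous_on UNIV F"
  shows "integrable sphere_measure F"
proof -
  have "bounded (F ` sphere 0 1)"
    using assms by (intro compact_imp_bounded compact_continuous_image) (auto intro: continuous_on_subset)
  then obtain B where "\<And>\<omega>. \<omega> \<in> sphere 0 1 \<Longrightarrow> norm (F \<omega>) \<le> B"
    unfolding bounded_iff by blast
  then show ?thesis
    using measurable_sphere_continuous[OF assms]
    by (intro sphere_measure.integrable_const_bound[where B = B]) (auto intro!: AE_I2)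
qed

lemma measure_sphere_measure [simp]: "measure sphere_measure (sphere 0 1) = 1"
  by (simp add: measure_def emeasure_sphere_measure_space)

section \<open>Invariance under orthogonal maps and its symmetry consequences\<close>

lemma distr_sphere_measure_orthogonal:
  assumes f: "orthogonal_transformation f"
  shows "distr sphere_measure sphere_measure f = sphere_measure"
proof (rule measure_eqI)
  have lin: "linear f"
    using f by (rule orthogonal_transformation_linear)
  have bor [measurable]: "f \<in> borel_measurable borel"
    using lin by (intro borel_measurable_continuous_onI linear_continuous_on linear_conv_bounded_linear[THEN iffD1])
  have norm_f: "norm (f x) = norm x" for x
    using f by (rule orthogonal_transformation_norm)
  have meas: "f \<in> measurable sphere_measure sphere_measure"
  proof (rule measurableI)
    fix A assume A: "A \<in> sets sphere_measure"
    then have "f -` A \<in> sets borel"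
      using measurable_sets[OF bor, of A] by (simp add: sets_sphere_measure)
    moreover have "f -` A \<inter> space sphere_measure = f -` A"
      using A norm_f by (auto simp: sets_sphere_measure)
    moreover have "f -` A \<subseteq> sphere 0 1"
      using A norm_f by (auto simp: sets_sphere_measure)
    ultimately show "f -` A \<inter> space sphere_measure \<in> sets sphere_measure"
      by (simp add: sets_sphere_measure)
  qed (simp add: norm_f)
  fix A assume "A \<in> sets (distr sphere_measure sphere_measure f)"
  then have A: "A \<in> sets borel" "A \<subseteq> sphere 0 1" and A': "A \<in> sets sphere_measure"
    by (auto simp: sets_sphere_measure)
  define C where "C = {x::real^3. norm x < 1 \<and> x /\<^sub>R norm x \<in> A}"
  have fA: "f -` A \<in> sets borel" "f -` A \<subseteq> sphere 0 1"
    using measurable_sets[OF bor A(1)] A(2) norm_f by auto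
  have C: "C \<in> sets borel"
    using A(1) unfolding C_def by measurable
  have inv: "orthogonal_transformation (inv f)" "f (inv f y) = y" "inv f (f y) = y" for y
    using f by (auto simp: orthogonal_transformation_inv orthogonal_transformation_surj surj_f_inv_f
        orthogonal_transformation_inj)
  have Clm: "C \<in> lmeasurable"
    by (rule bounded_set_imp_lmeasurable) (use C in \<open>auto simp: C_def bounded_iff intro: less_imp_le\<close>)
  \<comment> \<open>Radial projection commutes with \<open>f\<close>, so the cone over the preimage
    is the cone over \<open>A\<close> moved by the inverse map, and the invariance of Lebesgue
    measure applies.\<close>
  have eq: "{x. norm x < 1 \<and> x /\<^sub>R norm x \<in> f -` A} = inv f ` C"
  proof -
    have "f (x /\<^sub>R norm x) = f x /\<^sub>R norm (f x)" for x
      using lin norm_f by (simp add: linear_scale)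
    then have "{x. norm x < 1 \<and> x /\<^sub>R norm x \<in> f -` A} = f -` C"
      using norm_f by (simp add: C_def vimage_def)
    also have "\<dots> = inv f ` C"
      using inv by (auto simp: image_iff) metis
    finally show ?thesis .
  qed
  have "emeasure (distr sphere_measure sphere_measure f) A = emeasure sphere_measure (f -` A)"
    using emeasure_distr[OF meas A'] fA(2) by (simp add: Int_absorb2)
  also have "\<dots> = emeasure lborel (inv f ` C) / emeasure lborel (ball (0::real^3) 1)"
    using fA by (simp only: emeasure_sphere_measure eq)
  also have "emeasure lborel (inv f ` C) = emeasure lebesgue (inv f ` C)"
  proof -
    have "f -` C \<in> sets borel"
      using measurable_sets[OF bor C] by simp
    moreover have "f -` C = inv f ` C"
      using inv by (auto simp: image_iff) metis
    ultimately show ?thesis by simp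
  qed
  also have "\<dots> = emeasure lebesgue C"
    using measure_orthogonal_image[OF inv(1) Clm] measurable_orthogonal_image[OF inv(1) Clm] Clm
    by (simp add: emeasure_eq_measure2)
  also have "\<dots> = emeasure lborel C"
    using C by simp
  also have "emeasure lborel C / emeasure lborel (ball (0::real^3) 1) = emeasure sphere_measure A"
    using A by (simp only: emeasure_sphere_measure C_def)
  finally show "emeasure (distr sphere_measure sphere_measure f) A = emeasure sphere_measure A" .
qed simp

lemma integral_sphere_orthogonal:
  fixes F :: "real^3 \<Rightarrow> 'a::{banach, second_countable_topology}"
  assumes f: "orthogonal_transformation f" and F: "continuous_on UNIV F"
  shows "(\<integral>\<omega>. F (f \<omega>) \<partial>sphere_measure) = (\<integral>\<omega>. F \<omega> \<partial>sphere_measure)"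
proof -
  have "f \<in> borel_measurable sphere_measure"
    using f by (intro measurable_sphere_continuous linear_continuous_on
        linear_conv_bounded_linear[THEN iffD1] orthogonal_transformation_linear)
  moreover have "f \<in> space sphere_measure \<rightarrow> sphere 0 1"
    using f by (auto simp: orthogonal_transformation_norm)
  ultimately have "f \<in> measurable sphere_measure sphere_measure"
    unfolding sphere_measure_def by (subst measurable_restrict_space2_iff) (auto simp: sphere_measure_def)
  then have "(\<integral>\<omega>. F \<omega> \<partial>distr sphere_measure sphere_measure f) = (\<integral>\<omega>. F (f \<omega>) \<partial>sphere_measure)"
    using measurable_sphere_continuous[OF F] by (rule integral_distr)
  then show ?thesis
    using distr_sphere_measure_orthogonal[OF f] by simp
qed

lemma integral_sphere_odd:
  fixes F :: "real^3 \<Rightarrow> real"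
  assumes "continuous_on UNIV F" and "\<And>\<omega>. F (- \<omega>) = - F \<omega>"
  shows "(\<integral>\<omega>. F \<omega> \<partial>sphere_measure) = 0"
proof -
  have "orthogonal_transformation (\<lambda>x::real^3. - x)"
    by (simp add: orthogonal_transformation_neg orthogonal_transformation_id)
  from integral_sphere_orthogonal[OF this assms(1)] show ?thesis
    by (simp add: assms(2))
qed

lemma integral_sphere_axis:
  fixes F :: "real \<Rightarrow> real"
  assumes "norm a = 1" and F: "continuous_on UNIV F"
  shows "(\<integral>\<omega>. F (\<omega> \<bullet> a) \<partial>sphere_measure) = (\<integral>\<omega>. F (\<omega> $ i) \<partial>sphere_measure)"
proof -
  obtain f :: "real^3 \<Rightarrow> real^3" where f: "orthogonal_transformation f" "f (axis i 1) = a"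
    by (rule orthogonal_transformation_exists_1[of "axis i 1" a, OF norm_axis_1 assms(1)]) blast
  have "continuous_on UNIV (\<lambda>\<omega>. F (\<omega> \<bullet> a))"
    by (intro continuous_on_compose2[OF F] continuous_intros) auto
  from integral_sphere_orthogonal[OF f(1) this]
  have "(\<integral>\<omega>. F (f \<omega> \<bullet> a) \<partial>sphere_measure) = (\<integral>\<omega>. F (\<omega> \<bullet> a) \<partial>sphere_measure)" .
  moreover have "f \<omega> \<bullet> a = \<omega> $ i" for \<omega>
  proof -
    have "f \<omega> \<bullet> f (axis i 1) = \<omega> \<bullet> axis i 1"
      using f(1) by (simp add: orthogonal_transformation_def)
    then show ?thesis
      by (simp add: f(2) cart_eq_inner_axis)
  qed
  ultimately show ?thesis by simp
qed

lemma integral_sphere_reflect: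
  fixes F :: "real \<Rightarrow> real \<Rightarrow> real" and a w :: "real^3"
  assumes "a \<bullet> w = 0" and F: "continuous_on UNIV (\<lambda>\<omega>::real^3. F (\<omega> \<bullet> a) (\<omega> \<bullet> w))"
    and odd: "\<And>u v. F u (- v) = - F u v"
  shows "(\<integral>\<omega>. F (\<omega> \<bullet> a) (\<omega> \<bullet> w) \<partial>sphere_measure) = 0"
proof -
  \<comment> \<open>Reflection in the plane orthogonal to \<open>w\<close>. For \<open>w = 0\<close>
    the quotient is 0 and \<open>f\<close> is the identity, which is consistent because
    \<open>F u 0\<close> is then its own negative.\<close>
  define f where "f x = x - (2 * (x \<bullet> w) / (w \<bullet> w)) *\<^sub>R w" for x
  have "orthogonal_transformation f"
    unfolding orthogonal_transformation_def
  proof (intro conjI allI)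
    show "linear f"
      by (rule linearI) (simp_all add: f_def algebra_simps add_divide_distrib)
    show "f x \<bullet> f y = x \<bullet> y" for x y
      by (simp add: f_def inner_diff_left inner_diff_right inner_commute)
  qed
  from integral_sphere_orthogonal[OF this F]
  have "(\<integral>\<omega>. F (f \<omega> \<bullet> a) (f \<omega> \<bullet> w) \<partial>sphere_measure)
      = (\<integral>\<omega>. F (\<omega> \<bullet> a) (\<omega> \<bullet> w) \<partial>sphere_measure)" .
  moreover have "f \<omega> \<bullet> a = \<omega> \<bullet> a" "f \<omega> \<bullet> w = - (\<omega> \<bullet> w)" for \<omega>
    using assms(1) inner_commute[of w a] by (simp_all add: f_def inner_diff_left)
  ultimately show ?thesis by (simp add: odd)
qed

lemma integral_sphere_rotate:
  fixes F :: "real \<Rightarrow> real \<Rightarrow> real" and a b :: "real^3"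
  assumes ab: "norm a = 1" "norm b = 1" "a \<bullet> b = 0"
    and F: "continuous_on UNIV (\<lambda>\<omega>::real^3. F (\<omega> \<bullet> a) (\<omega> \<bullet> b))"
  shows "(\<integral>\<omega>. F (cos \<theta> * (\<omega> \<bullet> a) - sin \<theta> * (\<omega> \<bullet> b)) (sin \<theta> * (\<omega> \<bullet> a) + cos \<theta> * (\<omega> \<bullet> b)) \<partial>sphere_measure)
      = (\<integral>\<omega>. F (\<omega> \<bullet> a) (\<omega> \<bullet> b) \<partial>sphere_measure)"
proof -
  \<comment> \<open>Rotation by \<theta> in the plane of \<open>a\<close> and \<open>b\<close>,
    written as the identity plus a correction in that plane, so that the pair need not be completed
    to a basis.\<close>
  define f where "f x = x + ((cos \<theta> - 1) * (x \<bullet> a) - sin \<theta> * (x \<bullet> b)) *\<^sub>R a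
      + (sin \<theta> * (x \<bullet> a) + (cos \<theta> - 1) * (x \<bullet> b)) *\<^sub>R b" for x
  have ab': "a \<bullet> a = 1" "b \<bullet> b = 1" "b \<bullet> a = 0"
    using ab by (auto simp: norm_eq_1 inner_commute)
  have fa: "f x \<bullet> a = cos \<theta> * (x \<bullet> a) - sin \<theta> * (x \<bullet> b)"
    and fb: "f x \<bullet> b = sin \<theta> * (x \<bullet> a) + cos \<theta> * (x \<bullet> b)" for x
    using ab' ab by (simp_all add: f_def inner_add_left algebra_simps)
  have "orthogonal_transformation f"
    unfolding orthogonal_transformation
  proof (intro conjI allI)
    show "linear f"
      by (rule linearI) (simp_all add: f_def algebra_simps)
    fix x
    have "f x \<bullet> f x = x \<bullet> x"
    proof -
      have "f x \<bullet> f x = f x \<bullet> x + ((cos \<theta> - 1) * (x \<bullet> a) - sin \<theta> * (x \<bullet> b)) * (f x \<bullet> a)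
          + (sin \<theta> * (x \<bullet> a) + (cos \<theta> - 1) * (x \<bullet> b)) * (f x \<bullet> b)"
        by (subst (2) f_def) (simp add: inner_add_right)
      also have "f x \<bullet> x = x \<bullet> x + ((cos \<theta> - 1) * (x \<bullet> a) - sin \<theta> * (x \<bullet> b)) * (x \<bullet> a)
          + (sin \<theta> * (x \<bullet> a) + (cos \<theta> - 1) * (x \<bullet> b)) * (x \<bullet> b)"
        by (simp add: f_def inner_add_left inner_commute[of a x] inner_commute[of b x])
      finally show ?thesis
        using sin_cos_squared_add[of \<theta>] unfolding fa fb by algebra
    qed
    then show "norm (f x) = norm x" by (simp add: norm_eq_sqrt_inner)
  qed
  from integral_sphere_orthogonal[OF this F] show ?thesis
    by (simp only: fa fb)
qed

section \<open>Differentiation under the integral and integration by parts\<close>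

lemma has_real_derivative_integral_sphere:
  fixes f f' :: "real \<Rightarrow> real^3 \<Rightarrow> real"
  assumes deriv: "\<And>t \<omega>. ((\<lambda>t. f t \<omega>) has_real_derivative f' t \<omega>) (at t)"
    and bound: "\<And>t \<omega>. norm \<omega> = 1 \<Longrightarrow> \<bar>f' t \<omega>\<bar> \<le> C"
    and cont: "\<And>t. continuous_on UNIV (f t)" "\<And>t. continuous_on UNIV (f' t)"
  shows "((\<lambda>t. \<integral>\<omega>. f t \<omega> \<partial>sphere_measure) has_real_derivative (\<integral>\<omega>. f' t \<omega> \<partial>sphere_measure)) (at t)"
  unfolding has_field_derivative_iff tendsto_at_iff_sequentially
proof (intro allI impI, simp only: o_def)
  fix X :: "nat \<Rightarrow> real"
  assume X: "\<forall>i. X i \<in> UNIV - {t}" "X \<longlonglongrightarrow> t"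
  \<comment> \<open>The mean value inequality bounds all difference quotients by \<open>C\<close>;
    as the measure is finite, this constant is the dominating function.\<close>
  have lip: "\<bar>f s \<omega> - f t \<omega>\<bar> \<le> C * \<bar>s - t\<bar>" if "norm \<omega> = 1" for s \<omega>
    using field_differentiable_bound[of UNIV "\<lambda>t. f t \<omega>" "\<lambda>t. f' t \<omega>" C s t] deriv bound that
    by auto
  have "(\<lambda>i. \<integral>\<omega>. (f (X i) \<omega> - f t \<omega>) / (X i - t) \<partial>sphere_measure) \<longlonglongrightarrow> (\<integral>\<omega>. f' t \<omega> \<partial>sphere_measure)"
  proof (rule integral_dominated_convergence[where w = "\<lambda>_. C"])
    show "AE \<omega> in sphere_measure. (\<lambda>i. (f (X i) \<omega> - f t \<omega>) / (X i - t)) \<longlonglongrightarrow> f' t \<omega>"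
      using deriv[of _ t] X unfolding has_field_derivative_iff tendsto_at_iff_sequentially
      by (intro AE_I2) (auto simp: o_def)
    show "AE \<omega> in sphere_measure. norm ((f (X i) \<omega> - f t \<omega>) / (X i - t)) \<le> C" for i
      using lip X(1) by (intro AE_I2) (auto simp: divide_le_eq)
  qed (use X(1) in \<open>auto intro!: measurable_sphere_continuous continuous_intros cont\<close>)
  also have "(\<lambda>i. \<integral>\<omega>. (f (X i) \<omega> - f t \<omega>) / (X i - t) \<partial>sphere_measure)
      = (\<lambda>i. ((\<integral>\<omega>. f (X i) \<omega> \<partial>sphere_measure) - (\<integral>\<omega>. f t \<omega> \<partial>sphere_measure)) / (X i - t))"
    by (simp add: integrable_sphere_continuous cont)
  finally show "(\<lambda>i. ((\<integral>\<omega>. f (X i) \<omega> \<partial>sphere_measure) - (\<integral>\<omega>. f t \<omega> \<partial>sphere_measure)) / (X i - t))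
      \<longlonglongrightarrow> (\<integral>\<omega>. f' t \<omega> \<partial>sphere_measure)" .
qed

lemma sphere_coords:
  fixes \<omega> :: "real^3"
  assumes "norm \<omega> = 1"
  shows "(\<omega> $ 1)\<^sup>2 + (\<omega> $ 2)\<^sup>2 + (\<omega> $ 3)\<^sup>2 = 1"
proof -
  have "\<omega> \<bullet> \<omega> = 1"
    using assms by (simp add: norm_eq_1)
  then show ?thesis
    by (simp add: inner_vec_def sum_3 power2_eq_square)
qed

text \<open>This and the next two are sinc, minus its first derivative and minus its second
  derivative. As averages they make sense at t = 0 too, with no removable singularity to
  treat.\<close>

definition cos_int :: "real \<Rightarrow> real" where
  "cos_int t = (\<integral>\<omega>. cos (t * (\<omega>::real^3) $ 1) \<partial>sphere_measure)"

definition sin_int :: "real \<Rightarrow> real" where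
  "sin_int t = (\<integral>\<omega>. (\<omega>::real^3) $ 1 * sin (t * \<omega> $ 1) \<partial>sphere_measure)"

definition cos2_int :: "real \<Rightarrow> real" where
  "cos2_int t = (\<integral>\<omega>. ((\<omega>::real^3) $ 1)\<^sup>2 * cos (t * \<omega> $ 1) \<partial>sphere_measure)"

lemma
  fixes a :: "real^3"
  assumes "norm a = 1"
  shows integral_sphere_cos: "(\<integral>\<omega>. cos (t * (\<omega> \<bullet> a)) \<partial>sphere_measure) = cos_int t"
    and integral_sphere_sin: "(\<integral>\<omega>. (\<omega> \<bullet> a) * sin (t * (\<omega> \<bullet> a)) \<partial>sphere_measure) = sin_int t"
    and integral_sphere_cos2: "(\<integral>\<omega>. (\<omega> \<bullet> a)\<^sup>2 * cos (t * (\<omega> \<bullet> a)) \<partial>sphere_measure) = cos2_int t"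
  unfolding cos_int_def sin_int_def cos2_int_def
  by (rule integral_sphere_axis[OF assms, of "\<lambda>u. cos (t * u)"]
      integral_sphere_axis[OF assms, of "\<lambda>u. u * sin (t * u)"]
      integral_sphere_axis[OF assms, of "\<lambda>u. u\<^sup>2 * cos (t * u)"]; intro continuous_intros)+

lemma abs_inner_le_1:
  fixes \<omega> a :: "real^3"
  assumes "norm \<omega> = 1" "norm a = 1"
  shows "\<bar>\<omega> \<bullet> a\<bar> \<le> 1"
  using Cauchy_Schwarz_ineq2[of \<omega> a] assms by simp

text \<open>Differentiating the rotation invariance at angle 0 integrates by parts on the sphere.\<close>

lemma integral_sphere_by_parts:
  fixes F F1 F2 :: "real \<Rightarrow> real \<Rightarrow> real" and a b :: "real^3"
  assumes ab: "norm a = 1" "norm b = 1" "a \<bullet> b = 0"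
    and deriv: "\<And>u v. ((\<lambda>p. F (fst p) (snd p)) has_derivative (\<lambda>h. F1 u v * fst h + F2 u v * snd h)) (at (u, v))"
    and cont: "continuous_on UNIV (\<lambda>p. F1 (fst p) (snd p))" "continuous_on UNIV (\<lambda>p. F2 (fst p) (snd p))"
  shows "(\<integral>\<omega>. F2 (\<omega> \<bullet> a) (\<omega> \<bullet> b) * (\<omega> \<bullet> a) - F1 (\<omega> \<bullet> a) (\<omega> \<bullet> b) * (\<omega> \<bullet> b) \<partial>sphere_measure) = 0"
proof -
  let ?u = "\<lambda>\<theta> \<omega>. cos \<theta> * (\<omega> \<bullet> a) - sin \<theta> * (\<omega> \<bullet> b)"
  let ?v = "\<lambda>\<theta> \<omega>. sin \<theta> * (\<omega> \<bullet> a) + cos \<theta> * (\<omega> \<bullet> b)"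
  let ?G' = "\<lambda>p::real \<times> real. F2 (fst p) (snd p) * fst p - F1 (fst p) (snd p) * snd p"
  have contF: "continuous_on UNIV (\<lambda>p. F (fst p) (snd p))"
  proof (rule has_derivative_continuous_on)
    show "((\<lambda>p. F (fst p) (snd p)) has_derivative (\<lambda>h. F1 (fst p) (snd p) * fst h + F2 (fst p) (snd p) * snd h))
        (at p within UNIV)" for p
      using deriv[of "fst p" "snd p"] by simp
  qed
  have contF': "continuous_on UNIV (\<lambda>\<omega>. F (f \<omega>) (g \<omega>))"
    if "continuous_on UNIV f" "continuous_on UNIV g" for f g :: "real^3 \<Rightarrow> real"
    using continuous_on_compose2[OF contF continuous_on_Pair[OF that]] by simp
  have contG: "continuous_on UNIV ?G'"
    by (intro continuous_intros cont)
  \<comment> \<open>The rotated coordinates of a unit vector never leave this square, so compactness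
    bounds the derivative uniformly in the angle and in \<omega>.\<close>
  have "bounded (?G' ` ({-2..2} \<times> {-2..2}))"
    by (intro compact_imp_bounded compact_continuous_image compact_Times compact_Icc continuous_on_subset[OF contG]) auto
  then obtain C where C': "\<forall>y\<in>?G' ` ({-2..2} \<times> {-2..2}). norm y \<le> C"
    unfolding bounded_iff by (elim exE)
  have C: "\<bar>?G' (u, v)\<bar> \<le> C" if "\<bar>u\<bar> \<le> 2" "\<bar>v\<bar> \<le> 2" for u v
  proof -
    have "(u, v) \<in> {-2..2} \<times> {-2..2}"
      using that by auto
    from bspec[OF C' imageI[OF this]] show ?thesis by simp
  qed
  have "((\<lambda>\<theta>. \<integral>\<omega>. F (?u \<theta> \<omega>) (?v \<theta> \<omega>) \<partial>sphere_measure)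
      has_real_derivative (\<integral>\<omega>. ?G' (?u 0 \<omega>, ?v 0 \<omega>) \<partial>sphere_measure)) (at 0)"
  proof (rule has_real_derivative_integral_sphere[where C = C])
    fix \<theta> :: real and \<omega> :: "real^3"
    have "((\<lambda>\<theta>. (?u \<theta> \<omega>, ?v \<theta> \<omega>)) has_derivative (\<lambda>h. h *\<^sub>R (- ?v \<theta> \<omega>, ?u \<theta> \<omega>))) (at \<theta>)"
      by (auto intro!: derivative_eq_intros simp: algebra_simps)
    from has_derivative_compose[OF this deriv]
    have "((\<lambda>\<theta>. F (?u \<theta> \<omega>) (?v \<theta> \<omega>)) has_derivative (\<lambda>h. F1 (?u \<theta> \<omega>) (?v \<theta> \<omega>) * fst (h *\<^sub>R (- ?v \<theta> \<omega>, ?u \<theta> \<omega>))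
        + F2 (?u \<theta> \<omega>) (?v \<theta> \<omega>) * snd (h *\<^sub>R (- ?v \<theta> \<omega>, ?u \<theta> \<omega>)))) (at \<theta>)"
      by (simp only: fst_conv snd_conv)
    then show "((\<lambda>\<theta>. F (?u \<theta> \<omega>) (?v \<theta> \<omega>)) has_real_derivative ?G' (?u \<theta> \<omega>, ?v \<theta> \<omega>)) (at \<theta>)"
      unfolding has_field_derivative_def
      by (rule has_derivative_eq_rhs) (simp add: fun_eq_iff algebra_simps)
    show "\<bar>?G' (?u \<theta> \<omega>, ?v \<theta> \<omega>)\<bar> \<le> C" if "norm \<omega> = 1"
    proof (rule C)
      have "\<bar>c * (\<omega> \<bullet> a)\<bar> \<le> 1" "\<bar>c * (\<omega> \<bullet> b)\<bar> \<le> 1" if "\<bar>c\<bar> \<le> 1" for c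
        using that abs_inner_le_1[OF \<open>norm \<omega> = 1\<close>] ab by (auto simp: abs_mult intro: mult_le_one)
      from this[of "sin \<theta>"] this[of "cos \<theta>"]
      show "\<bar>?u \<theta> \<omega>\<bar> \<le> 2" "\<bar>?v \<theta> \<omega>\<bar> \<le> 2" by auto
    qed
    show "continuous_on UNIV (\<lambda>\<omega>. F (?u \<theta> \<omega>) (?v \<theta> \<omega>))"
      by (intro contF' continuous_intros)
    show "continuous_on UNIV (\<lambda>\<omega>. ?G' (?u \<theta> \<omega>, ?v \<theta> \<omega>))"
      by (rule continuous_on_compose2[OF contG]) (intro continuous_intros, simp)
  qed
  moreover have "(\<lambda>\<theta>. \<integral>\<omega>. F (?u \<theta> \<omega>) (?v \<theta> \<omega>) \<partial>sphere_measure)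
      = (\<lambda>\<theta>. \<integral>\<omega>. F (\<omega> \<bullet> a) (\<omega> \<bullet> b) \<partial>sphere_measure)"
    by (intro ext integral_sphere_rotate[OF ab] contF' continuous_intros)
  ultimately show ?thesis
    using DERIV_unique[OF _ DERIV_const] by fastforce
qed

text \<open>Integration by parts with F(u, v) = v sin(t u). The factor \<open>t\<close> stays on the
  left so that t = 0 is included.\<close>

lemma integral_sphere_cos2_orthogonal:
  fixes a b :: "real^3"
  assumes ab: "norm a = 1" "norm b = 1" "a \<bullet> b = 0"
  shows "t * (\<integral>\<omega>. (\<omega> \<bullet> b)\<^sup>2 * cos (t * (\<omega> \<bullet> a)) \<partial>sphere_measure) = sin_int t"
proof -
  have "(\<integral>\<omega>. sin (t * (\<omega> \<bullet> a)) * (\<omega> \<bullet> a) - ((\<omega> \<bullet> b) * (cos (t * (\<omega> \<bullet> a)) * t)) * (\<omega> \<bullet> b) \<partial>sphere_measure) = 0"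
  proof (rule integral_sphere_by_parts[OF ab, where F = "\<lambda>u v. v * sin (t * u)"])
    show "((\<lambda>p. snd p * sin (t * fst p)) has_derivative
        (\<lambda>h. (v * (cos (t * u) * t)) * fst h + sin (t * u) * snd h)) (at (u, v))" for u v :: real
      by (auto intro!: derivative_eq_intros)
  qed (intro continuous_intros)+
  moreover have "integrable sphere_measure (\<lambda>\<omega>. sin (t * (\<omega> \<bullet> a)) * (\<omega> \<bullet> a))"
    "integrable sphere_measure (\<lambda>\<omega>. ((\<omega> \<bullet> b) * (cos (t * (\<omega> \<bullet> a)) * t)) * (\<omega> \<bullet> b))"
    by (intro integrable_sphere_continuous continuous_intros)+
  ultimately have "(\<integral>\<omega>. sin (t * (\<omega> \<bullet> a)) * (\<omega> \<bullet> a) \<partial>sphere_measure)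
      = (\<integral>\<omega>. ((\<omega> \<bullet> b) * (cos (t * (\<omega> \<bullet> a)) * t)) * (\<omega> \<bullet> b) \<partial>sphere_measure)"
    by simp
  also have "\<dots> = (\<integral>\<omega>. t * ((\<omega> \<bullet> b)\<^sup>2 * cos (t * (\<omega> \<bullet> a))) \<partial>sphere_measure)"
    by (simp add: power2_eq_square mult_ac)
  finally show ?thesis
    using integral_sphere_sin[OF ab(1), of t] by (simp add: mult.commute)
qed

text \<open>Integration by parts with F(u, v) = u^3 v.\<close>

lemma integral_sphere_fourth_orthogonal:
  fixes a b :: "real^3"
  assumes ab: "norm a = 1" "norm b = 1" "a \<bullet> b = 0"
  shows "(\<integral>\<omega>. (\<omega> \<bullet> a) ^ 4 \<partial>sphere_measure) = 3 * (\<integral>\<omega>. (\<omega> \<bullet> a)\<^sup>2 * (\<omega> \<bullet> b)\<^sup>2 \<partial>sphere_measure)"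
proof -
  have "(\<integral>\<omega>. (\<omega> \<bullet> a) ^ 3 * (\<omega> \<bullet> a) - (3 * (\<omega> \<bullet> a)\<^sup>2 * (\<omega> \<bullet> b)) * (\<omega> \<bullet> b) \<partial>sphere_measure) = 0"
  proof (rule integral_sphere_by_parts[OF ab, where F = "\<lambda>u v. u ^ 3 * v"])
    show "((\<lambda>p. fst p ^ 3 * snd p) has_derivative
        (\<lambda>h. (3 * u\<^sup>2 * v) * fst h + u ^ 3 * snd h)) (at (u, v))" for u v :: real
      by (auto intro!: derivative_eq_intros)
  qed (intro continuous_intros)+
  moreover have "integrable sphere_measure (\<lambda>\<omega>. (\<omega> \<bullet> a) ^ 3 * (\<omega> \<bullet> a))"
    "integrable sphere_measure (\<lambda>\<omega>. (3 * (\<omega> \<bullet> a)\<^sup>2 * (\<omega> \<bullet> b)) * (\<omega> \<bullet> b))"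
    by (intro integrable_sphere_continuous continuous_intros)+
  ultimately have "(\<integral>\<omega>. (\<omega> \<bullet> a) ^ 3 * (\<omega> \<bullet> a) \<partial>sphere_measure)
      = (\<integral>\<omega>. (3 * (\<omega> \<bullet> a)\<^sup>2 * (\<omega> \<bullet> b)) * (\<omega> \<bullet> b) \<partial>sphere_measure)"
    by simp
  moreover have "(\<omega> \<bullet> a) ^ 3 * (\<omega> \<bullet> a) = (\<omega> \<bullet> a) ^ 4"
    "(3 * (\<omega> \<bullet> a)\<^sup>2 * (\<omega> \<bullet> b)) * (\<omega> \<bullet> b) = 3 * ((\<omega> \<bullet> a)\<^sup>2 * (\<omega> \<bullet> b)\<^sup>2)" for \<omega>
    by (simp_all add: power2_eq_square power3_eq_cube power4_eq_xxxx)
  ultimately show ?thesis by simp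
qed

section \<open>Second and fourth moments\<close>

lemma axis_orthonormal:
  "norm (axis i 1 :: real^3) = 1" "i \<noteq> j \<Longrightarrow> axis i 1 \<bullet> (axis j 1 :: real^3) = 0"
  "\<omega> \<bullet> axis i 1 = (\<omega>::real^3) $ i"
  by (simp, simp add: inner_axis, simp add: axis_def, simp add: inner_axis)

text \<open>The three squared coordinates have equal averages and add up to 1.\<close>

lemma integral_sphere_square:
  assumes "norm a = 1"
  shows "(\<integral>\<omega>. (\<omega> \<bullet> a)\<^sup>2 \<partial>sphere_measure) = 1 / 3"
proof -
  let ?I = "\<integral>\<omega>. (\<omega> \<bullet> a)\<^sup>2 \<partial>sphere_measure"
  have eq: "(\<integral>\<omega>. (\<omega> $ i)\<^sup>2 \<partial>sphere_measure) = ?I" for i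
    by (rule integral_sphere_axis[OF assms, of "\<lambda>u. u\<^sup>2", symmetric]) (intro continuous_intros)
  have int: "integrable sphere_measure (\<lambda>\<omega>. (\<omega> $ i)\<^sup>2)" for i
    by (intro integrable_sphere_continuous continuous_intros)
  have "(\<integral>\<omega>. (\<omega> $ 1)\<^sup>2 + (\<omega> $ 2)\<^sup>2 + (\<omega> $ 3)\<^sup>2 \<partial>sphere_measure) = (\<integral>\<omega>. 1 \<partial>sphere_measure)"
    using sphere_coords by (intro Bochner_Integration.integral_cong) auto
  then show ?thesis
    by (simp add: int eq)
qed

lemma integral_sphere_fourth:
  assumes "norm a = 1"
  shows "(\<integral>\<omega>. (\<omega> \<bullet> a) ^ 4 \<partial>sphere_measure) = 1 / 5"
proof -
  let ?I = "\<integral>\<omega>. (\<omega> \<bullet> a) ^ 4 \<partial>sphere_measure"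
  let ?e = "\<lambda>i. axis i 1 :: real^3"
  have eq: "(\<integral>\<omega>. (\<omega> $ 1) ^ 4 \<partial>sphere_measure) = ?I"
    by (rule integral_sphere_axis[OF assms, of "\<lambda>u. u ^ 4", symmetric]) (intro continuous_intros)
  have mixed: "?I = 3 * (\<integral>\<omega>. (\<omega> $ 1)\<^sup>2 * (\<omega> $ i)\<^sup>2 \<partial>sphere_measure)" if "i \<noteq> 1" for i
    using integral_sphere_fourth_orthogonal[of "?e 1" "?e i"] axis_orthonormal(2)[of 1 i] that eq
    by (simp add: axis_orthonormal(1,3))
  have int: "integrable sphere_measure (\<lambda>\<omega>. (\<omega> $ 1) ^ 4)"
    "integrable sphere_measure (\<lambda>\<omega>. (\<omega> $ 1)\<^sup>2 * (\<omega> $ i)\<^sup>2)" for i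
    by (intro integrable_sphere_continuous continuous_intros)+
  \<comment> \<open>The sphere equation times the first squared coordinate. Averaging turns it into
    1/3 = I + 2 I / 3, since each mixed moment is a third of I.\<close>
  have "(\<omega> $ 1)\<^sup>2 = (\<omega> $ 1) ^ 4 + (\<omega> $ 1)\<^sup>2 * (\<omega> $ 2)\<^sup>2 + (\<omega> $ 1)\<^sup>2 * (\<omega> $ 3)\<^sup>2"
    if "norm \<omega> = 1" for \<omega> :: "real^3"
    using sphere_coords[OF that] by algebra
  then have "(\<integral>\<omega>. (\<omega> $ 1)\<^sup>2 \<partial>sphere_measure)
      = (\<integral>\<omega>. (\<omega> $ 1) ^ 4 + (\<omega> $ 1)\<^sup>2 * (\<omega> $ 2)\<^sup>2 + (\<omega> $ 1)\<^sup>2 * (\<omega> $ 3)\<^sup>2 \<partial>sphere_measure)"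
    by (intro Bochner_Integration.integral_cong) auto
  moreover have "(\<integral>\<omega>. (\<omega> $ 1)\<^sup>2 \<partial>sphere_measure) = 1 / 3"
    using integral_sphere_square[of "?e 1"] by (simp add: axis_orthonormal)
  ultimately show ?thesis
    using mixed[of 2] mixed[of 3] eq by (simp add: int)
qed

text \<open>Multiply the sphere equation by the cosine: after a factor \<open>t\<close>, each of the
  two transversal coordinates contributes \<open>sin_int t\<close>. For f = \<open>cos_int\<close>
  it reads t f'' + 2 f' + t f = 0, the spherical Bessel equation of order zero.\<close>

lemma cos_int_sin_int_relation: "t * (cos_int t - cos2_int t) = 2 * sin_int t"
proof -
  let ?e = "\<lambda>i. axis i 1 :: real^3"
  have orth: "t * (\<integral>\<omega>. (\<omega> $ i)\<^sup>2 * cos (t * \<omega> $ 1) \<partial>sphere_measure) = sin_int t" if "i \<noteq> 1" for i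
    using integral_sphere_cos2_orthogonal[of "?e 1" "?e i" t] axis_orthonormal(2)[of 1 i] that
    by (simp add: axis_orthonormal(1,3))
  have int: "integrable sphere_measure (\<lambda>\<omega>. (\<omega> $ i)\<^sup>2 * cos (t * \<omega> $ 1))" for i
    by (intro integrable_sphere_continuous continuous_intros)
  have "cos (t * \<omega> $ 1) = (\<omega> $ 1)\<^sup>2 * cos (t * \<omega> $ 1) + (\<omega> $ 2)\<^sup>2 * cos (t * \<omega> $ 1)
      + (\<omega> $ 3)\<^sup>2 * cos (t * \<omega> $ 1)" if "norm \<omega> = 1" for \<omega> :: "real^3"
    using sphere_coords[OF that] by algebra
  then have "cos_int t = (\<integral>\<omega>. (\<omega> $ 1)\<^sup>2 * cos (t * \<omega> $ 1) + (\<omega> $ 2)\<^sup>2 * cos (t * \<omega> $ 1)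
      + (\<omega> $ 3)\<^sup>2 * cos (t * \<omega> $ 1) \<partial>sphere_measure)"
    unfolding cos_int_def by (intro Bochner_Integration.integral_cong) auto
  then have "cos_int t - cos2_int t = (\<integral>\<omega>. (\<omega> $ 2)\<^sup>2 * cos (t * \<omega> $ 1) \<partial>sphere_measure)
      + (\<integral>\<omega>. (\<omega> $ 3)\<^sup>2 * cos (t * \<omega> $ 1) \<partial>sphere_measure)"
    by (simp add: int cos2_int_def)
  then show ?thesis
    using orth[of 2] orth[of 3] by (simp add: distrib_left)
qed

lemma cos_int_deriv: "(cos_int has_real_derivative - sin_int t) (at t)"
proof -
  have "((\<lambda>t. \<integral>\<omega>. cos (t * (\<omega>::real^3) $ 1) \<partial>sphere_measure) has_real_derivative
      (\<integral>\<omega>. - (\<omega> $ 1 * sin (t * \<omega> $ 1)) \<partial>sphere_measure)) (at t)"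
  proof (rule has_real_derivative_integral_sphere[where C = 1])
    show "\<bar>- (\<omega> $ 1 * sin (t * \<omega> $ 1))\<bar> \<le> 1" if "norm \<omega> = 1" for t and \<omega> :: "real^3"
      using component_le_norm_cart[of \<omega> 1] that by (auto simp: abs_mult intro!: mult_le_one)
  qed (auto intro!: derivative_eq_intros continuous_intros)
  then show ?thesis
    by (simp add: cos_int_def[abs_def] sin_int_def)
qed

lemma sin_int_deriv: "(sin_int has_real_derivative cos2_int t) (at t)"
proof -
  have "((\<lambda>t. \<integral>\<omega>. (\<omega>::real^3) $ 1 * sin (t * \<omega> $ 1) \<partial>sphere_measure) has_real_derivative
      (\<integral>\<omega>. (\<omega> $ 1)\<^sup>2 * cos (t * \<omega> $ 1) \<partial>sphere_measure)) (at t)"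
  proof (rule has_real_derivative_integral_sphere[where C = 1])
    show "\<bar>(\<omega> $ 1)\<^sup>2 * cos (t * \<omega> $ 1)\<bar> \<le> 1" if "norm \<omega> = 1" for t and \<omega> :: "real^3"
      using component_le_norm_cart[of \<omega> 1] that by (auto simp: abs_mult abs_square_le_1 intro!: mult_le_one)
  qed (auto intro!: derivative_eq_intros continuous_intros simp: power2_eq_square)
  then show ?thesis
    by (simp add: sin_int_def[abs_def] cos2_int_def)
qed

text \<open>\<open>t * cos_int t\<close> satisfies the oscillator equation \<open>f'' = - f\<close> with the initial data of \<open>sin\<close>.\<close>

lemma cos_int_eq: "t * cos_int t = sin t"
  and sin_int_eq: "t * sin_int t = cos_int t - cos t"
proof -
  define D where "D t = t * cos_int t - sin t" for t
  define D' where "D' t = cos_int t - t * sin_int t - cos t" for t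
  have D: "(D has_real_derivative D' t) (at t)" for t
    unfolding D_def[abs_def] D'_def by (auto intro!: derivative_eq_intros cos_int_deriv)
  have D': "(D' has_real_derivative - D t) (at t)" for t
    unfolding D_def D'_def[abs_def] using cos_int_sin_int_relation[of t]
    by (auto intro!: derivative_eq_intros cos_int_deriv sin_int_deriv simp: algebra_simps)
  \<comment> \<open>The energy of the oscillator is conserved and vanishes at 0, which gives
    uniqueness. That the derivative \<open>D'\<close> vanishes as well is the second claim.\<close>
  have "((\<lambda>t. (D t)\<^sup>2 + (D' t)\<^sup>2) has_real_derivative 0) (at t)" for t
    by (auto intro!: derivative_eq_intros D D')
  then have "(D t)\<^sup>2 + (D' t)\<^sup>2 = (D 0)\<^sup>2 + (D' 0)\<^sup>2"
    using DERIV_isconst_all[of "\<lambda>t. (D t)\<^sup>2 + (D' t)\<^sup>2" t 0] by blast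
  moreover have "D 0 = 0" "D' 0 = 0"
    by (auto simp: D_def D'_def cos_int_def)
  ultimately have "D t = 0" "D' t = 0"
    by (simp_all add: sum_power2_eq_zero_iff)
  then show "t * cos_int t = sin t" "t * sin_int t = cos_int t - cos t"
    by (auto simp: D_def D'_def)
qed

section \<open>Decay and small-argument bounds\<close>

lemma c_nu_bdd_above: "bdd_above ((\<lambda>t::real. \<bar>t * cos t - sin t\<bar> / t) ` {0<..})"
proof (rule bdd_aboveI2)
  fix t :: real assume "t \<in> {0<..}"
  then have t: "t > 0" by simp
  have "\<bar>t * cos t - sin t\<bar> \<le> \<bar>t * cos t\<bar> + \<bar>sin t\<bar>"
    by linarith
  also have "\<dots> \<le> t * 1 + t"
    using t abs_sin_x_le_abs_x[of t] by (intro add_mono) (auto simp: abs_mult)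
  finally show "\<bar>t * cos t - sin t\<bar> / t \<le> 2"
    using t by (simp add: field_simps)
qed

lemma c_nu_upper: "t > 0 \<Longrightarrow> \<bar>t * cos t - sin t\<bar> / t \<le> c_nu"
  unfolding c_nu_def by (rule cSUP_upper[OF _ c_nu_bdd_above]) simp

text \<open>The quotient equals 1 at \<open>pi\<close>. This allows bounds of the form 1/t, and
  numerical constants, to be absorbed into \<open>c_nu\<close>.\<close>

lemma c_nu_ge_1: "1 \<le> c_nu"
  using c_nu_upper[of pi] by simp

lemma abs_cos_int_le:
  assumes "t > 0" shows "\<bar>cos_int t\<bar> \<le> 1 / t"
proof -
  have "t * \<bar>cos_int t\<bar> = \<bar>sin t\<bar>"
    using arg_cong[OF cos_int_eq[of t], of abs] assms by (simp add: abs_mult)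
  then show ?thesis
    using assms abs_sin_le_one[of t] by (simp add: field_simps del: abs_sin_le_one)
qed

text \<open>The meaning of \<open>c_nu\<close>: by the two closed forms, t times the absolute value
  of \<open>sin_int t\<close> is exactly the quotient whose supremum it is.\<close>

lemma abs_sin_int_le_c_nu:
  assumes "t > 0" shows "\<bar>sin_int t\<bar> \<le> c_nu / t"
proof -
  have "t * (t * sin_int t) = sin t - t * cos t"
    using cos_int_eq[of t] by (simp add: sin_int_eq algebra_simps)
  from arg_cong[OF this, of abs] have "t * \<bar>sin_int t\<bar> = \<bar>t * cos t - sin t\<bar> / t"
    using assms by (simp add: abs_minus_commute abs_mult eq_divide_eq mult.commute)
  also have "\<dots> \<le> c_nu"
    using assms by (rule c_nu_upper)
  finally show ?thesis
    using assms by (simp add: field_simps)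
qed

lemma abs_integral_sphere_le:
  fixes F G :: "real^3 \<Rightarrow> real"
  assumes "continuous_on UNIV F" "continuous_on UNIV G"
    and "\<And>\<omega>. norm \<omega> = 1 \<Longrightarrow> \<bar>F \<omega>\<bar> \<le> G \<omega>"
  shows "\<bar>\<integral>\<omega>. F \<omega> \<partial>sphere_measure\<bar> \<le> (\<integral>\<omega>. G \<omega> \<partial>sphere_measure)"
  using assms by (intro Bochner_Integration.integral_abs_bound_integral integrable_sphere_continuous) auto

lemma one_minus_cos_le: "1 - cos x \<le> x\<^sup>2 / 2" for x :: real
proof -
  have "(sin (x / 2))\<^sup>2 \<le> (x / 2)\<^sup>2"
    using abs_sin_x_le_abs_x by (rule abs_le_square_iff[THEN iffD1])
  then show ?thesis
    using cos_double_sin[of "x / 2"] by (simp add: power_divide)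
qed

text \<open>Estimating the sine by its argument leaves the second moment. This linear bound serves
  the nearby source, where decay is useless.\<close>

lemma abs_sin_int_le: "\<bar>sin_int t\<bar> \<le> \<bar>t\<bar> / 3"
proof -
  let ?a = "axis 1 1 :: real^3"
  have "\<bar>sin_int t\<bar> \<le> (\<integral>\<omega>. \<bar>t\<bar> * (\<omega> \<bullet> ?a)\<^sup>2 \<partial>sphere_measure)"
    unfolding integral_sphere_sin[OF axis_orthonormal(1)[of 1], of t, symmetric]
  proof (intro abs_integral_sphere_le continuous_intros)
    fix \<omega> :: "real^3"
    have "\<bar>\<omega> \<bullet> ?a\<bar> * \<bar>sin (t * (\<omega> \<bullet> ?a))\<bar> \<le> \<bar>\<omega> \<bullet> ?a\<bar> * \<bar>t * (\<omega> \<bullet> ?a)\<bar>"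
      by (intro mult_left_mono abs_sin_x_le_abs_x) simp
    then show "\<bar>(\<omega> \<bullet> ?a) * sin (t * (\<omega> \<bullet> ?a))\<bar> \<le> \<bar>t\<bar> * (\<omega> \<bullet> ?a)\<^sup>2"
      by (simp add: abs_mult power2_eq_square mult_ac)
  qed
  also have "\<dots> = \<bar>t\<bar> / 3"
    using integral_sphere_square[OF axis_orthonormal(1)[of 1]] by simp
  finally show ?thesis .
qed

lemma cos_int_near_1: "\<bar>1 - cos_int t\<bar> \<le> t\<^sup>2 / 6"
proof -
  let ?a = "axis 1 1 :: real^3"
  have int: "integrable sphere_measure (\<lambda>\<omega>. cos (t * (\<omega> \<bullet> ?a)))"
    by (intro integrable_sphere_continuous continuous_intros)
  have "1 - cos_int t = (\<integral>\<omega>. 1 - cos (t * (\<omega> \<bullet> ?a)) \<partial>sphere_measure)"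
    unfolding integral_sphere_cos[OF axis_orthonormal(1)[of 1], of t, symmetric] using int by simp
  also have "\<bar>\<dots>\<bar> \<le> (\<integral>\<omega>. t\<^sup>2 / 2 * (\<omega> \<bullet> ?a)\<^sup>2 \<partial>sphere_measure)"
  proof (intro abs_integral_sphere_le continuous_intros)
    fix \<omega> :: "real^3"
    show "\<bar>1 - cos (t * (\<omega> \<bullet> ?a))\<bar> \<le> t\<^sup>2 / 2 * (\<omega> \<bullet> ?a)\<^sup>2"
      using one_minus_cos_le[of "t * (\<omega> \<bullet> ?a)"] by (simp add: power_mult_distrib)
  qed
  also have "\<dots> = t\<^sup>2 / 6"
    using integral_sphere_square[OF axis_orthonormal(1)[of 1]] by simp
  finally show ?thesis .
qed

section \<open>Averages for an arbitrary argument \<open>y\<close> and unit direction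
  \<open>e\<close>\<close>

context
  fixes y e :: "real^3"
  assumes e: "norm e = 1"
begin

lemma integral_sphere_cos_vec: "(\<integral>\<omega>. cos (\<omega> \<bullet> y) \<partial>sphere_measure) = cos_int (norm y)"
proof (cases "y = 0")
  case True
  then show ?thesis by (simp add: cos_int_def)
next
  case False
  then show ?thesis
    using integral_sphere_cos[of "y /\<^sub>R norm y" "norm y"] by (simp add: field_simps)
qed

text \<open>Split \<open>e\<close> into a part along \<open>y\<close> and an orthogonal remainder
  \<open>w\<close>. Terms odd in \<open>w\<close> vanish by reflection, and the term quadratic in
  \<open>w\<close> is a transversal average. Eliminating \<open>cos2_int\<close> produces the
  coefficients \<open>c\<^sup>2\<close> and \<open>1 - 3 * c\<^sup>2\<close>: this is minus the
  second derivative of sinc(|y|) along \<open>e\<close>, multiplied by t.\<close>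

lemma
  assumes y: "y \<noteq> 0"
  defines "t \<equiv> norm y" and "c \<equiv> e \<bullet> (y /\<^sub>R norm y)"
  shows integral_sphere_sin_vec: "(\<integral>\<omega>. (\<omega> \<bullet> e) * sin (\<omega> \<bullet> y) \<partial>sphere_measure) = c * sin_int t"
    and integral_sphere_cos2_vec: "t * (\<integral>\<omega>. (\<omega> \<bullet> e)\<^sup>2 * cos (\<omega> \<bullet> y) \<partial>sphere_measure)
      = c\<^sup>2 * (t * cos_int t) + (1 - 3 * c\<^sup>2) * sin_int t"
proof -
  define a where "a = y /\<^sub>R t"
  define w where "w = e - c *\<^sub>R a"
  have a: "norm a = 1" "\<omega> \<bullet> y = t * (\<omega> \<bullet> a)" for \<omega>
    using y by (auto simp: a_def t_def)
  have e_eq: "e = c *\<^sub>R a + w" by (simp add: w_def)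
  have c: "e \<bullet> a = c" by (simp add: c_def a_def t_def)
  have aa: "a \<bullet> a = 1" using a(1) by (simp add: norm_eq_1)
  have aw: "a \<bullet> w = 0"
    using c by (simp add: w_def inner_diff_right aa inner_commute)
  have ww: "w \<bullet> w = 1 - c\<^sup>2"
    using c e aa by (simp add: w_def inner_diff_right inner_diff_left inner_commute norm_eq_1 power2_eq_square)
  have "(\<integral>\<omega>. (\<omega> \<bullet> w) * sin (t * (\<omega> \<bullet> a)) \<partial>sphere_measure) = 0"
    by (rule integral_sphere_reflect[OF aw]) (auto intro!: continuous_intros)
  moreover have "integrable sphere_measure (\<lambda>\<omega>. (\<omega> \<bullet> w) * sin (t * (\<omega> \<bullet> a)))"
    "integrable sphere_measure (\<lambda>\<omega>. (\<omega> \<bullet> a) * sin (t * (\<omega> \<bullet> a)))"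
    by (intro integrable_sphere_continuous continuous_intros)+
  moreover have "(\<omega> \<bullet> e) * sin (\<omega> \<bullet> y) = c * ((\<omega> \<bullet> a) * sin (t * (\<omega> \<bullet> a))) + (\<omega> \<bullet> w) * sin (t * (\<omega> \<bullet> a))" for \<omega>
    by (subst e_eq) (simp add: a(2) inner_add_right algebra_simps)
  ultimately show "(\<integral>\<omega>. (\<omega> \<bullet> e) * sin (\<omega> \<bullet> y) \<partial>sphere_measure) = c * sin_int t"
    using integral_sphere_sin[OF a(1), of t] by simp
  have mixed: "(\<integral>\<omega>. (\<omega> \<bullet> w) * ((\<omega> \<bullet> a) * cos (t * (\<omega> \<bullet> a))) \<partial>sphere_measure) = 0"
    by (rule integral_sphere_reflect[OF aw]) (auto intro!: continuous_intros)
  have orth: "t * (\<integral>\<omega>. (\<omega> \<bullet> w)\<^sup>2 * cos (t * (\<omega> \<bullet> a)) \<partial>sphere_measure) = (1 - c\<^sup>2) * sin_int t"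
  proof (cases "w = 0")
    case True
    then show ?thesis using ww by simp
  next
    case False
    define b where "b = w /\<^sub>R norm w"
    have b: "norm b = 1" "a \<bullet> b = 0" "\<omega> \<bullet> w = norm w * (\<omega> \<bullet> b)" for \<omega>
      using False aw by (auto simp: b_def)
    have "(norm w)\<^sup>2 = 1 - c\<^sup>2"
      using ww by (simp add: power2_norm_eq_inner)
    then have eq: "(\<omega> \<bullet> w)\<^sup>2 * cos (t * (\<omega> \<bullet> a)) = (1 - c\<^sup>2) * ((\<omega> \<bullet> b)\<^sup>2 * cos (t * (\<omega> \<bullet> a)))" for \<omega>
      by (simp add: b(3) power_mult_distrib)
    have "(\<integral>\<omega>. (\<omega> \<bullet> w)\<^sup>2 * cos (t * (\<omega> \<bullet> a)) \<partial>sphere_measure)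
        = (1 - c\<^sup>2) * (\<integral>\<omega>. (\<omega> \<bullet> b)\<^sup>2 * cos (t * (\<omega> \<bullet> a)) \<partial>sphere_measure)"
      by (simp only: eq integral_mult_right_zero)
    then show ?thesis
      using integral_sphere_cos2_orthogonal[OF a(1) b(1,2), of t] by (simp add: mult.left_commute)
  qed
  have int: "integrable sphere_measure (\<lambda>\<omega>. (\<omega> \<bullet> w) * ((\<omega> \<bullet> a) * cos (t * (\<omega> \<bullet> a))))"
    "integrable sphere_measure (\<lambda>\<omega>. (\<omega> \<bullet> a)\<^sup>2 * cos (t * (\<omega> \<bullet> a)))"
    "integrable sphere_measure (\<lambda>\<omega>. (\<omega> \<bullet> w)\<^sup>2 * cos (t * (\<omega> \<bullet> a)))"
    by (intro integrable_sphere_continuous continuous_intros)+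
  have "(\<omega> \<bullet> e)\<^sup>2 * cos (\<omega> \<bullet> y) = c\<^sup>2 * ((\<omega> \<bullet> a)\<^sup>2 * cos (t * (\<omega> \<bullet> a)))
      + 2 * c * ((\<omega> \<bullet> w) * ((\<omega> \<bullet> a) * cos (t * (\<omega> \<bullet> a)))) + (\<omega> \<bullet> w)\<^sup>2 * cos (t * (\<omega> \<bullet> a))" for \<omega>
    by (subst e_eq) (simp add: a(2) inner_add_right algebra_simps power2_eq_square)
  then have "(\<integral>\<omega>. (\<omega> \<bullet> e)\<^sup>2 * cos (\<omega> \<bullet> y) \<partial>sphere_measure)
      = c\<^sup>2 * cos2_int t + (\<integral>\<omega>. (\<omega> \<bullet> w)\<^sup>2 * cos (t * (\<omega> \<bullet> a)) \<partial>sphere_measure)"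
    by (simp add: int mixed integral_sphere_cos2[OF a(1)])
  then show "t * (\<integral>\<omega>. (\<omega> \<bullet> e)\<^sup>2 * cos (\<omega> \<bullet> y) \<partial>sphere_measure)
      = c\<^sup>2 * (t * cos_int t) + (1 - 3 * c\<^sup>2) * sin_int t"
    using orth cos_int_sin_int_relation[of t] by algebra
qed

lemma abs_inner_direction_le_1: "\<bar>e \<bullet> (y /\<^sub>R norm y)\<bar> \<le> 1"
  using Cauchy_Schwarz_ineq2[of e "y /\<^sub>R norm y"] e by (cases "y = 0") auto

lemma abs_integral_sphere_sin_le:
  shows "\<bar>\<integral>\<omega>. (\<omega> \<bullet> e) * sin (\<omega> \<bullet> y) \<partial>sphere_measure\<bar> \<le> norm y / 3"
    and "y \<noteq> 0 \<Longrightarrow> \<bar>\<integral>\<omega>. (\<omega> \<bullet> e) * sin (\<omega> \<bullet> y) \<partial>sphere_measure\<bar> \<le> c_nu / norm y"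
proof -
  have le: "\<bar>\<integral>\<omega>. (\<omega> \<bullet> e) * sin (\<omega> \<bullet> y) \<partial>sphere_measure\<bar> \<le> \<bar>sin_int (norm y)\<bar>" if "y \<noteq> 0"
    using mult_right_mono[OF abs_inner_direction_le_1, of "\<bar>sin_int (norm y)\<bar>"]
    by (simp add: integral_sphere_sin_vec that abs_mult)
  then show "\<bar>\<integral>\<omega>. (\<omega> \<bullet> e) * sin (\<omega> \<bullet> y) \<partial>sphere_measure\<bar> \<le> norm y / 3"
    using abs_sin_int_le[of "norm y"] by (cases "y = 0") auto
  show "\<bar>\<integral>\<omega>. (\<omega> \<bullet> e) * sin (\<omega> \<bullet> y) \<partial>sphere_measure\<bar> \<le> c_nu / norm y" if "y \<noteq> 0"
    using le abs_sin_int_le_c_nu[of "norm y"] that by fastforce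
qed

lemma abs_integral_sphere_cos2_le_third:
  "\<bar>\<integral>\<omega>. (\<omega> \<bullet> e)\<^sup>2 * cos (\<omega> \<bullet> y) \<partial>sphere_measure\<bar> \<le> 1 / 3"
  unfolding integral_sphere_square[OF e, symmetric]
  by (intro abs_integral_sphere_le continuous_intros) (auto simp: abs_mult intro: mult_left_le)

lemma abs_integral_sphere_cos2_le:
  assumes y: "y \<noteq> 0"
  shows "\<bar>\<integral>\<omega>. (\<omega> \<bullet> e)\<^sup>2 * cos (\<omega> \<bullet> y) \<partial>sphere_measure\<bar> \<le> 2 * c_nu / norm y"
proof -
  define t I c where "t = norm y" and "I = (\<integral>\<omega>. (\<omega> \<bullet> e)\<^sup>2 * cos (\<omega> \<bullet> y) \<partial>sphere_measure)"
    and "c = e \<bullet> (y /\<^sub>R norm y)"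
  have t: "t > 0" using y by (simp add: t_def)
  have "t * \<bar>I\<bar> \<le> 2 * c_nu"
  \<comment> \<open>Up to 6 the trivial bound 1/3 gives at most 2. Beyond 6, \<open>sin_int\<close>
    is at most c_nu / 6 and the closed form gives at most 1 + c_nu / 3. Both are below 2 c_nu
    because c_nu is at least 1.\<close>
  proof (cases "t \<le> 6")
    case True
    have "t * \<bar>I\<bar> \<le> 6 * (1 / 3)"
      using True t abs_integral_sphere_cos2_le_third unfolding I_def by (intro mult_mono) auto
    then show ?thesis using c_nu_ge_1 by linarith
  next
    case False
    have c: "c\<^sup>2 \<le> 1"
      using abs_inner_direction_le_1 by (simp add: c_def abs_square_le_1)
    have eq: "t * I = c\<^sup>2 * sin t + (1 - 3 * c\<^sup>2) * sin_int t"
      using integral_sphere_cos2_vec[OF y] by (simp add: t_def I_def c_def cos_int_eq)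
    have "\<bar>sin_int t\<bar> \<le> c_nu / 6"
      using abs_sin_int_le_c_nu[OF t] divide_left_mono[of 6 t c_nu] False c_nu_ge_1 by linarith
    moreover have "\<bar>1 - 3 * c\<^sup>2\<bar> \<le> 2"
      using c zero_le_power2[of c] by linarith
    ultimately have "\<bar>1 - 3 * c\<^sup>2\<bar> * \<bar>sin_int t\<bar> \<le> 2 * (c_nu / 6)"
      by (intro mult_mono) auto
    moreover have "c\<^sup>2 * \<bar>sin t\<bar> \<le> 1 * 1"
      using c by (intro mult_mono) auto
    moreover have "\<bar>t * I\<bar> \<le> \<bar>c\<^sup>2 * sin t\<bar> + \<bar>(1 - 3 * c\<^sup>2) * sin_int t\<bar>"
      unfolding eq by (rule abs_triangle_ineq)
    ultimately show ?thesis
      using c_nu_ge_1 t by (simp add: abs_mult)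
  qed
  then show ?thesis
    using t by (simp add: t_def I_def field_simps)
qed

lemma integral_sphere_cos2_near_third:
  "\<bar>1 / 3 - (\<integral>\<omega>. (\<omega> \<bullet> e)\<^sup>2 * cos (\<omega> \<bullet> y) \<partial>sphere_measure)\<bar> \<le> (norm y)\<^sup>2 / 10"
proof (cases "y = 0")
  case True
  then show ?thesis by (simp add: integral_sphere_square[OF e])
next
  case False
  define a where "a = y /\<^sub>R norm y"
  have a: "norm a = 1" "\<omega> \<bullet> y = norm y * (\<omega> \<bullet> a)" for \<omega>
    using False by (auto simp: a_def)
  have int: "integrable sphere_measure (\<lambda>\<omega>. (\<omega> \<bullet> e)\<^sup>2)" "integrable sphere_measure (\<lambda>\<omega>. (\<omega> \<bullet> e)\<^sup>2 * cos (\<omega> \<bullet> y))"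
    "integrable sphere_measure (\<lambda>\<omega>. (\<omega> \<bullet> e) ^ 4)" "integrable sphere_measure (\<lambda>\<omega>. (\<omega> \<bullet> a) ^ 4)"
    by (intro integrable_sphere_continuous continuous_intros)+
  have "1 / 3 - (\<integral>\<omega>. (\<omega> \<bullet> e)\<^sup>2 * cos (\<omega> \<bullet> y) \<partial>sphere_measure)
      = (\<integral>\<omega>. (\<omega> \<bullet> e)\<^sup>2 - (\<omega> \<bullet> e)\<^sup>2 * cos (\<omega> \<bullet> y) \<partial>sphere_measure)"
    using int by (simp add: integral_sphere_square[OF e])
  also have "\<bar>\<dots>\<bar> \<le> (\<integral>\<omega>. (norm y)\<^sup>2 / 4 * ((\<omega> \<bullet> e) ^ 4 + (\<omega> \<bullet> a) ^ 4) \<partial>sphere_measure)"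
  proof (intro abs_integral_sphere_le continuous_intros)
    fix \<omega> :: "real^3"
    have "(\<omega> \<bullet> e)\<^sup>2 * (1 - cos (\<omega> \<bullet> y)) \<le> (\<omega> \<bullet> e)\<^sup>2 * ((\<omega> \<bullet> y)\<^sup>2 / 2)"
      by (intro mult_left_mono one_minus_cos_le) simp
    also have "\<dots> = (norm y)\<^sup>2 / 4 * (2 * (\<omega> \<bullet> e)\<^sup>2 * (\<omega> \<bullet> a)\<^sup>2)"
      by (simp add: a(2) power_mult_distrib)
    \<comment> \<open>The arithmetic-geometric inequality replaces the mixed moment, which depends
      on the angle between \<open>e\<close> and \<open>y\<close>, by two fourth moments of 1/5 each;
      1/4 * 2/5 = 1/10.\<close>
    also have "\<dots> \<le> (norm y)\<^sup>2 / 4 * ((\<omega> \<bullet> e) ^ 4 + (\<omega> \<bullet> a) ^ 4)"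
      using sum_squares_bound[of "(\<omega> \<bullet> e)\<^sup>2" "(\<omega> \<bullet> a)\<^sup>2"] by (intro mult_left_mono) auto
    finally show "\<bar>(\<omega> \<bullet> e)\<^sup>2 - (\<omega> \<bullet> e)\<^sup>2 * cos (\<omega> \<bullet> y)\<bar> \<le> (norm y)\<^sup>2 / 4 * ((\<omega> \<bullet> e) ^ 4 + (\<omega> \<bullet> a) ^ 4)"
      using mult_nonneg_nonneg[of "(\<omega> \<bullet> e)\<^sup>2" "1 - cos (\<omega> \<bullet> y)"] by (simp add: algebra_simps)
  qed
  also have "\<dots> = (norm y)\<^sup>2 / 10"
    using int integral_sphere_fourth[OF e] integral_sphere_fourth[OF a(1)] by simp
  finally show ?thesis .
qed

end

section \<open>Projections onto finite-dimensional subspaces\<close>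

lemma cinner_add_right: "cinner f (g + h) = cinner f g + cinner f h"
  using cinner_commute[of f "g + h"] cinner_commute[of f g] cinner_commute[of f h]
  by (simp add: cinner_add_left)

lemma cinner_scale_right: "cinner f (l2_scale c g) = cnj c * cinner f g"
  using cinner_commute[of f "l2_scale c g"] cinner_commute[of f g] by (simp add: cinner_scale_left)

lemma cinner_zero_left [simp]: "cinner 0 f = 0"
  using cinner_scale_left[of 0 0 f] by simp

lemma cinner_zero_right [simp]: "cinner f 0 = 0"
  using cinner_commute[of f 0] by simp

lemma cinner_minus_left: "cinner (- f) g = - cinner f g"
  using cinner_add_left[of f "- f" g] by (simp add: eq_neg_iff_add_eq_0 add.commute)

lemma cinner_diff_left: "cinner (f - g) h = cinner f h - cinner g h"
  using cinner_add_left[of f "- g" h] by (simp add: cinner_minus_left)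

lemma cinner_sum_left: "cinner (\<Sum>k\<in>I. f k) g = (\<Sum>k\<in>I. cinner (f k) g)"
  by (induction I rule: infinite_finite_induct) (simp_all add: cinner_add_left)

lemma cinner_self_eq_0_iff: "cinner f f = 0 \<longleftrightarrow> f = 0"
  using cinner_self_eq_0[of f] by auto

text \<open>A Gram-Schmidt step: the new vector is made orthogonal to the old span and its component
  is added to the projection. Since \<open>orth_proj\<close> is a definite description, existence
  has to be supplied.\<close>

lemma orth_span_ex:
  assumes "finite B"
  shows "\<exists>p\<in>l2.span B. \<forall>v\<in>l2.span B. cinner (f - p) v = 0"
  using assms
proof (induction B arbitrary: f rule: finite_induct)
  case empty
  then show ?case by simp
next
  case (insert b B)
  obtain pb where pb: "pb \<in> l2.span B" "\<And>v. v \<in> l2.span B \<Longrightarrow> cinner (b - pb) v = 0"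
    using insert.IH by blast
  obtain pf where pf: "pf \<in> l2.span B" "\<And>v. v \<in> l2.span B \<Longrightarrow> cinner (f - pf) v = 0"
    using insert.IH by blast
  \<comment> \<open>If \<open>b\<close> already lies in the old span, then \<open>b' = 0\<close> and
    the quotient is 0; the identity required of \<open>c\<close> still holds.\<close>
  define b' c where "b' = b - pb" and "c = cinner (f - pf) b' / cinner b' b'"
  have mono: "v \<in> l2.span B \<Longrightarrow> v \<in> l2.span (insert b B)" for v
    using l2.span_mono[of B "insert b B"] by auto
  have b': "b' \<in> l2.span (insert b B)"
    unfolding b'_def by (intro l2.span_diff l2.span_base mono[OF pb(1)]) simp
  have c: "cinner (f - pf) b' - c * cinner b' b' = 0"
    by (cases "b' = 0") (simp_all add: c_def cinner_self_eq_0_iff)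
  show ?case
  proof (intro bexI ballI)
    show "pf + l2_scale c b' \<in> l2.span (insert b B)"
      by (intro l2.span_add l2.span_scale mono pf(1) b')
    fix v assume "v \<in> l2.span (insert b B)"
    then obtain k where k: "v - l2_scale k b \<in> l2.span B"
      using l2.span_breakdown_eq by blast
    define v' where "v' = (v - l2_scale k b) + l2_scale k pb"
    have v': "v' \<in> l2.span B"
      unfolding v'_def by (intro l2.span_add l2.span_scale k pb(1))
    have v: "v = v' + l2_scale k b'"
      by (simp add: v'_def b'_def l2.scale_right_diff_distrib)
    have "f - (pf + l2_scale c b') = (f - pf) - l2_scale c b'"
      by simp
    then have "cinner (f - (pf + l2_scale c b')) v = (cinner (f - pf) v' - c * cinner b' v')
        + cnj k * (cinner (f - pf) b' - c * cinner b' b')"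
      by (simp only: v cinner_diff_left cinner_add_right cinner_scale_left cinner_scale_right distrib_left
          mult.commute left_diff_distrib add_ac)
    also have "\<dots> = 0"
      using pf(2)[OF v'] pb(2)[OF v'] c by (simp add: b'_def)
    finally show "cinner (f - (pf + l2_scale c b')) v = 0" .
  qed
qed

text \<open>A finite spanning set instead of a basis: the span of the waves fits without a proof
  that they are independent.\<close>

locale fin_dim_subspace =
  fixes U :: "l2_sphere set"
  assumes fin_span: "\<exists>B. finite B \<and> U = l2.span B"
begin

abbreviation "P \<equiv> orth_proj U"

lemma subspace: "l2.subspace U"
  using fin_span by auto

lemma proj_unique:
  assumes "p \<in> U" "\<And>v. v \<in> U \<Longrightarrow> cinner (f - p) v = 0"
  shows "P f = p"
  unfolding orth_proj_def
proof (rule the_equality)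
  fix p' assume p': "p' \<in> U \<and> (\<forall>v\<in>U. cinner (f - p') v = 0)"
  then have mem: "p' - p \<in> U"
    using assms(1) subspace by (simp add: l2.subspace_diff)
  have "cinner (p' - p) (p' - p) = cinner (f - p) (p' - p) - cinner (f - p') (p' - p)"
    by (simp add: cinner_diff_left)
  also have "\<dots> = 0"
    using assms(2)[OF mem] p' mem by simp
  finally show "p' = p"
    by (simp add: cinner_self_eq_0_iff)
qed (use assms in auto)

lemma proj_mem: "P f \<in> U" and proj_orth: "v \<in> U \<Longrightarrow> cinner (f - P f) v = 0"
proof -
  obtain p where "p \<in> U" "\<And>v. v \<in> U \<Longrightarrow> cinner (f - p) v = 0"
    using fin_span orth_span_ex by blast
  then show "P f \<in> U" "v \<in> U \<Longrightarrow> cinner (f - P f) v = 0"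
    using proj_unique[of p f] by auto
qed

lemma cinner_proj_left: "v \<in> U \<Longrightarrow> cinner (P f) v = cinner f v"
  using proj_orth[of v f] by (simp add: cinner_diff_left)

lemma proj_of_mem: "f \<in> U \<Longrightarrow> P f = f"
  by (rule proj_unique) auto

lemma proj_add: "P (f + g) = P f + P g"
  by (rule proj_unique)
    (auto intro!: l2.subspace_add[OF subspace] proj_mem simp: cinner_diff_left cinner_add_left cinner_proj_left)

lemma proj_scale: "P (l2_scale c f) = l2_scale c (P f)"
  by (rule proj_unique)
    (auto intro!: l2.subspace_scale[OF subspace] proj_mem simp: cinner_diff_left cinner_scale_left cinner_proj_left)

lemma cinner_proj_swap: "cinner (P f) g = cinner f (P g)"
proof -
  have "cinner (P f) g = cnj (cinner g (P f))"
    by (rule cinner_commute)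
  also have "\<dots> = cnj (cinner (P g) (P f))"
    using cinner_proj_left[OF proj_mem] by simp
  also have "\<dots> = cinner (P f) (P g)"
    by (rule cinner_commute[symmetric])
  also have "\<dots> = cinner f (P g)"
    by (rule cinner_proj_left[OF proj_mem])
  finally show ?thesis .
qed

lemma inner_proj_swap: "inner (P f) g = inner f (P g)"
  by (simp add: inner_l2_sphere_def cinner_proj_swap)

lemma inner_proj_proj: "inner (P f) (P f) = inner (P f) f"
  using cinner_proj_left[OF proj_mem[of f], of f] cinner_commute[of f "P f"]
  by (simp add: inner_l2_sphere_def)

lemma norm_diff_proj: "(norm (f - P f))\<^sup>2 = (norm f)\<^sup>2 - inner (P f) f"
  unfolding power2_norm_eq_inner
  by (simp add: inner_diff_left inner_diff_right inner_proj_proj inner_commute[of f "P f"])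

lemma norm_proj_le: "norm (P f) \<le> norm f"
proof -
  have "(norm (P f))\<^sup>2 = inner (P f) f"
    by (simp add: power2_norm_eq_inner inner_proj_proj)
  also have "\<dots> \<le> norm (P f) * norm f"
    by (rule norm_cauchy_schwarz)
  finally show ?thesis
    by (cases "P f = 0") (simp_all add: power2_eq_square)
qed

lemma bounded_linear_proj: "bounded_linear P"
  by (rule bounded_linear_intro[where K = 1])
    (simp_all add: proj_add proj_scale scaleR_l2_sphere_def norm_proj_le)

end

text \<open>The dimension is the cardinality of a basis, which is 0 for an infinite one. Positive
  dimension therefore forces a finite basis.\<close>

lemma fin_dim_subspaceI_dim:
  assumes "l2.subspace U" "l2.dim U > 0"
  shows "fin_dim_subspace U"
proof
  obtain B where B: "B \<subseteq> U" "l2.independent B" "U \<subseteq> l2.span B" "card B = l2.dim U"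
    using l2.basis_exists by blast
  then have "finite B"
    using assms(2) card_ge_0_finite by force
  moreover have "l2.span B = U"
    using B assms(1) by (meson l2.span_minimal subset_antisym)
  ultimately show "\<exists>B. finite B \<and> U = l2.span B" by auto
qed

lemma fin_dim_subspace_wave_span: "finite X \<Longrightarrow> fin_dim_subspace (wave_span \<kappa> X)"
  by standard (auto simp: wave_span_def)

section \<open>Schur test and nearly orthonormal families\<close>

lemma schur_bound:
  fixes G :: "'a \<Rightarrow> 'a \<Rightarrow> real" and \<alpha> \<beta> :: "'a \<Rightarrow> real"
  assumes I: "finite I" and G: "\<And>j k. 0 \<le> G j k" "\<And>j k. G j k = G k j"
    and row: "\<And>j. j \<in> I \<Longrightarrow> (\<Sum>k\<in>I - {j}. G j k) \<le> \<mu>"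
  shows "(\<Sum>j\<in>I. \<Sum>k\<in>I - {j}. G j k * \<bar>\<alpha> k\<bar> * \<bar>\<beta> j\<bar>) \<le> \<mu> * L2_set \<alpha> I * L2_set \<beta> I"
proof (cases "I = {}")
  case False
  then have \<mu>: "\<mu> \<ge> 0"
    using row G(1) by (metis ex_in_conv order_trans sum_nonneg)
  define S where "S = (SIGMA j:I. I - {j})"
  have S: "finite S" using I by (auto simp: S_def)
  have "(\<Sum>j\<in>I. \<Sum>k\<in>I - {j}. G j k * \<bar>\<alpha> k\<bar> * \<bar>\<beta> j\<bar>) = (\<Sum>(j, k)\<in>S. G j k * \<bar>\<alpha> k\<bar> * \<bar>\<beta> j\<bar>)"
    unfolding S_def using I by (subst sum.Sigma) auto
  \<comment> \<open>Each weight is split into two square roots over the ordered pairs, so that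
    Cauchy-Schwarz leaves one sum of weights in each factor.\<close>
  also have "\<dots> = (\<Sum>p\<in>S. \<bar>sqrt (case p of (j, k) \<Rightarrow> G j k) * \<alpha> (snd p)\<bar> * \<bar>sqrt (case p of (j, k) \<Rightarrow> G j k) * \<beta> (fst p)\<bar>)"
    using G(1) by (intro sum.cong) (auto simp: abs_mult)
  also have "\<dots> \<le> L2_set (\<lambda>p. sqrt (case p of (j, k) \<Rightarrow> G j k) * \<alpha> (snd p)) S
      * L2_set (\<lambda>p. sqrt (case p of (j, k) \<Rightarrow> G j k) * \<beta> (fst p)) S"
    by (rule L2_set_mult_ineq)
  also have "\<dots> \<le> sqrt (\<mu> * (\<Sum>k\<in>I. (\<alpha> k)\<^sup>2)) * sqrt (\<mu> * (\<Sum>j\<in>I. (\<beta> j)\<^sup>2))"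
  proof (intro mult_mono)
    have "(\<Sum>p\<in>S. (sqrt (case p of (j, k) \<Rightarrow> G j k) * \<alpha> (snd p))\<^sup>2) = (\<Sum>(j, k)\<in>S. G j k * (\<alpha> k)\<^sup>2)"
      using G(1) by (intro sum.cong) (auto simp: power_mult_distrib)
    \<comment> \<open>Swapping the pair and using symmetry of \<open>G\<close> turns column sums
      into row sums, for which the bound is assumed.\<close>
    also have "\<dots> = (\<Sum>(k, j)\<in>S. G j k * (\<alpha> k)\<^sup>2)"
      by (rule sum.reindex_bij_witness[where i = prod.swap and j = prod.swap]) (auto simp: S_def)
    also have "\<dots> = (\<Sum>k\<in>I. (\<Sum>j\<in>I - {k}. G k j) * (\<alpha> k)\<^sup>2)"
      unfolding S_def using I G(2) by (subst sum.Sigma[symmetric]) (auto simp: sum_distrib_right intro!: sum.cong)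
    also have "\<dots> \<le> \<mu> * (\<Sum>k\<in>I. (\<alpha> k)\<^sup>2)"
      unfolding sum_distrib_left by (intro sum_mono mult_right_mono row) auto
    finally show "L2_set (\<lambda>p. sqrt (case p of (j, k) \<Rightarrow> G j k) * \<alpha> (snd p)) S \<le> sqrt (\<mu> * (\<Sum>k\<in>I. (\<alpha> k)\<^sup>2))"
      unfolding L2_set_def by simp
    have "(\<Sum>p\<in>S. (sqrt (case p of (j, k) \<Rightarrow> G j k) * \<beta> (fst p))\<^sup>2) = (\<Sum>(j, k)\<in>S. G j k * (\<beta> j)\<^sup>2)"
      using G(1) by (intro sum.cong) (auto simp: power_mult_distrib)
    also have "\<dots> = (\<Sum>j\<in>I. (\<Sum>k\<in>I - {j}. G j k) * (\<beta> j)\<^sup>2)"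
      unfolding S_def using I by (subst sum.Sigma[symmetric]) (auto simp: sum_distrib_right)
    also have "\<dots> \<le> \<mu> * (\<Sum>k\<in>I. (\<beta> k)\<^sup>2)"
      unfolding sum_distrib_left by (intro sum_mono mult_right_mono row) auto
    finally show "L2_set (\<lambda>p. sqrt (case p of (j, k) \<Rightarrow> G j k) * \<beta> (fst p)) S \<le> sqrt (\<mu> * (\<Sum>j\<in>I. (\<beta> j)\<^sup>2))"
      unfolding L2_set_def by simp
  qed (use \<mu> in \<open>auto simp: L2_set_nonneg sum_nonneg\<close>)
  also have "\<dots> = \<mu> * L2_set \<alpha> I * L2_set \<beta> I"
    using \<mu> by (simp add: L2_set_def real_sqrt_mult algebra_simps flip: power2_eq_square)
  finally show ?thesis .
qed simp

text \<open>Coefficients are attached to indices rather than to vectors, so \<open>\<phi>\<close>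
  may repeat values.\<close>

lemma span_image_sum:
  assumes "finite I" "p \<in> l2.span (\<phi> ` I)"
  shows "\<exists>a. p = (\<Sum>k\<in>I. l2_scale (a k) (\<phi> k))"
  using assms
proof (induction I arbitrary: p rule: finite_induct)
  case (insert i I)
  then obtain c a where "p - l2_scale c (\<phi> i) = (\<Sum>k\<in>I. l2_scale (a k) (\<phi> k))"
    by (force simp: l2.span_breakdown_eq)
  then have "p = l2_scale c (\<phi> i) + (\<Sum>k\<in>I. l2_scale (a k) (\<phi> k))"
    by (simp add: algebra_simps)
  also have "\<dots> = (\<Sum>k\<in>insert i I. l2_scale ((a(i := c)) k) (\<phi> k))"
    using insert.hyps by (auto intro!: sum.cong)
  finally show ?case by blast
qed simp

text \<open>Perturbation of the identity: the projection acts through the inverse Gram matrix, which is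
  within \<open>\<mu> / (1 - \<mu>)\<close> of the identity.  The coefficient vector of the projection plays the role of
  the inverse, so no matrix has to be inverted.\<close>

lemma proj_near_orthonormal:
  fixes \<phi> :: "'a \<Rightarrow> l2_sphere"
  assumes I: "finite I" and unit: "\<And>k. k \<in> I \<Longrightarrow> cinner (\<phi> k) (\<phi> k) = 1"
    and row: "\<And>j. j \<in> I \<Longrightarrow> (\<Sum>k\<in>I - {j}. norm (cinner (\<phi> k) (\<phi> j))) \<le> \<mu>" and \<mu>: "0 \<le> \<mu>" "\<mu> < 1"
  shows "norm (cinner (orth_proj (l2.span (\<phi> ` I)) f) g - (\<Sum>k\<in>I. cinner f (\<phi> k) * cnj (cinner g (\<phi> k))))
    \<le> \<mu> / (1 - \<mu>) * L2_set (\<lambda>k. norm (cinner f (\<phi> k))) I * L2_set (\<lambda>k. norm (cinner g (\<phi> k))) I"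
proof -
  interpret fin_dim_subspace "l2.span (\<phi> ` I)"
    by standard (use I in auto)
  obtain a where a: "P f = (\<Sum>k\<in>I. l2_scale (a k) (\<phi> k))"
    using span_image_sum[OF I proj_mem] by blast
  define A V W where "A = L2_set (\<lambda>k. norm (a k)) I" and "V = L2_set (\<lambda>k. norm (cinner f (\<phi> k))) I"
    and "W = L2_set (\<lambda>k. norm (cinner g (\<phi> k))) I"
  \<comment> \<open>The off-diagonal part of the Gram matrix applied to the coefficients
    \<open>a\<close>, tested against \<open>b\<close>. The Schur test makes it small.\<close>
  define R where "R b = (\<Sum>j\<in>I. (\<Sum>k\<in>I - {j}. a k * cinner (\<phi> k) (\<phi> j)) * cnj (b j))" for b :: "'a \<Rightarrow> complex"
  have sym: "norm (cinner (\<phi> j) (\<phi> k)) = norm (cinner (\<phi> k) (\<phi> j))" for j k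
    using cinner_commute[of "\<phi> j" "\<phi> k"] by (metis complex_mod_cnj)
  have R_le: "norm (R b) \<le> \<mu> * A * L2_set (\<lambda>k. norm (b k)) I" for b
  proof -
    have "norm (R b) \<le> (\<Sum>j\<in>I. \<Sum>k\<in>I - {j}. norm (cinner (\<phi> k) (\<phi> j)) * \<bar>norm (a k)\<bar> * \<bar>norm (b j)\<bar>)"
      unfolding R_def sum_distrib_right
      by (intro sum_norm_le order.trans[OF norm_sum] sum_mono) (simp add: norm_mult)
    also have "\<dots> \<le> \<mu> * A * L2_set (\<lambda>k. norm (b k)) I"
      unfolding A_def using I row sym by (intro schur_bound) auto
    finally show ?thesis .
  qed
  have v: "cinner f (\<phi> j) = a j + (\<Sum>k\<in>I - {j}. a k * cinner (\<phi> k) (\<phi> j))" if "j \<in> I" for j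
  proof -
    have "cinner f (\<phi> j) = cinner (P f) (\<phi> j)"
      using that by (intro cinner_proj_left[symmetric] l2.span_base) auto
    also have "\<dots> = (\<Sum>k\<in>I. a k * cinner (\<phi> k) (\<phi> j))"
      by (simp add: a cinner_sum_left cinner_scale_left)
    finally show ?thesis
      using I that unit by (simp add: sum.remove)
  qed
  have expand: "(\<Sum>k\<in>I. cinner f (\<phi> k) * cnj (b k)) = (\<Sum>k\<in>I. a k * cnj (b k)) + R b" for b
    unfolding R_def sum.distrib[symmetric] by (rule sum.cong) (simp_all add: v distrib_right)
  \<comment> \<open>Coercivity: the normal equations tested with the coefficients themselves. This
    bounds the coefficient vector by V / (1 - \<mu>), where \<open>V\<close> is the size of the
    data.\<close>
  have "A * A * (1 - \<mu>) \<le> V * A"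
  proof -
    have "A * A = norm (\<Sum>k\<in>I. a k * cnj (a k))"
    proof -
      have "(\<Sum>k\<in>I. a k * cnj (a k)) = of_real (\<Sum>k\<in>I. (norm (a k))\<^sup>2)"
        by (simp flip: complex_norm_square)
      then have "norm (\<Sum>k\<in>I. a k * cnj (a k)) = (\<Sum>k\<in>I. (norm (a k))\<^sup>2)"
        by (simp only: norm_of_real) (simp add: sum_nonneg)
      then show ?thesis
        by (simp add: A_def L2_set_def sum_nonneg)
    qed
    also have "(\<Sum>k\<in>I. a k * cnj (a k)) = (\<Sum>k\<in>I. cinner f (\<phi> k) * cnj (a k)) - R a"
      by (simp add: expand)
    also have "norm \<dots> \<le> norm (\<Sum>k\<in>I. cinner f (\<phi> k) * cnj (a k)) + norm (R a)"
      by (rule norm_triangle_ineq4)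
    also have "norm (\<Sum>k\<in>I. cinner f (\<phi> k) * cnj (a k)) \<le> V * A"
    proof -
      have "norm (\<Sum>k\<in>I. cinner f (\<phi> k) * cnj (a k)) \<le> (\<Sum>k\<in>I. \<bar>norm (cinner f (\<phi> k))\<bar> * \<bar>norm (a k)\<bar>)"
        by (rule order.trans[OF norm_sum]) (simp add: norm_mult)
      also have "\<dots> \<le> V * A"
        unfolding V_def A_def by (rule L2_set_mult_ineq)
      finally show ?thesis .
    qed
    also have "norm (R a) \<le> \<mu> * A * A"
      using R_le[of a] by (simp add: A_def)
    finally show ?thesis by (simp add: algebra_simps)
  qed
  moreover have nonneg: "A \<ge> 0" "V \<ge> 0" "W \<ge> 0"
    by (simp_all add: A_def V_def W_def L2_set_nonneg)
  ultimately have A_le: "A \<le> V / (1 - \<mu>)"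
    using \<mu> mult_le_cancel_left_pos[of A "A * (1 - \<mu>)" V]
    by (cases "A = 0") (auto simp: pos_le_divide_eq mult_ac)
  have "cinner (P f) g = (\<Sum>k\<in>I. a k * cnj (cinner g (\<phi> k)))"
    unfolding a cinner_sum_left cinner_scale_left by (simp flip: cinner_commute)
  then have "norm (cinner (P f) g - (\<Sum>k\<in>I. cinner f (\<phi> k) * cnj (cinner g (\<phi> k))))
      = norm (R (\<lambda>k. cinner g (\<phi> k)))"
    by (simp add: expand norm_minus_commute)
  also have "\<dots> \<le> \<mu> * A * W"
    using R_le by (simp add: W_def)
  also have "\<dots> \<le> \<mu> * (V / (1 - \<mu>)) * W"
    using A_le \<mu> nonneg by (intro mult_right_mono mult_left_mono) auto
  finally show ?thesis
    by (simp add: V_def W_def)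
qed

section \<open>Derivatives of plane waves\<close>

text \<open>All representatives below are continuous on the whole space, so the side conditions of
  the quotient operations reduce to continuity.\<close>

lemma square_integrable_continuous:
  assumes "continuous_on UNIV F"
  shows "square_integrable F"
  unfolding square_integrable_def
  by (intro conjI measurable_sphere_continuous integrable_sphere_continuous continuous_intros assms)

lemma cinner_abs_l2_sphere:
  assumes "continuous_on UNIV F" "continuous_on UNIV G"
  shows "cinner (abs_l2_sphere F) (abs_l2_sphere G) = (\<integral>\<omega>. F \<omega> * cnj (G \<omega>) \<partial>sphere_measure)"
  by (rule cinner.abs_eq) (simp_all add: square_integrable_continuous assms)

lemma abs_l2_sphere_add:
  assumes "continuous_on UNIV F" "continuous_on UNIV G"
  shows "abs_l2_sphere F + abs_l2_sphere G = abs_l2_sphere (\<lambda>\<omega>. F \<omega> + G \<omega>)"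
  by (rule plus_l2_sphere.abs_eq) (simp_all add: square_integrable_continuous assms)

lemma abs_l2_sphere_scale:
  assumes "continuous_on UNIV F"
  shows "l2_scale c (abs_l2_sphere F) = abs_l2_sphere (\<lambda>\<omega>. c * F \<omega>)"
  by (rule l2_scale.abs_eq) (simp add: square_integrable_continuous assms)

lemma abs_l2_sphere_diff:
  assumes "continuous_on UNIV F" "continuous_on UNIV G"
  shows "abs_l2_sphere F - abs_l2_sphere G = abs_l2_sphere (\<lambda>\<omega>. F \<omega> - G \<omega>)"
proof -
  have "continuous_on UNIV (\<lambda>\<omega>. - 1 * G \<omega>)"
    using assms(2) by (intro continuous_intros)
  from abs_l2_sphere_add[OF assms(1) this] show ?thesis
    unfolding minus_l2_sphere_def uminus_l2_sphere_def abs_l2_sphere_scale[OF assms(2)] by simp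
qed

lemma abs_l2_sphere_diff2:
  assumes "continuous_on UNIV F" "continuous_on UNIV G" "continuous_on UNIV H"
  shows "abs_l2_sphere F - abs_l2_sphere G - abs_l2_sphere H = abs_l2_sphere (\<lambda>\<omega>. F \<omega> - G \<omega> - H \<omega>)"
  using assms by (simp add: abs_l2_sphere_diff continuous_intros)

lemma norm_abs_l2_sphere_square:
  assumes "continuous_on UNIV F"
  shows "(norm (abs_l2_sphere F))\<^sup>2 = (\<integral>\<omega>. (norm (F \<omega>))\<^sup>2 \<partial>sphere_measure)"
proof -
  have "cinner (abs_l2_sphere F) (abs_l2_sphere F) = of_real (\<integral>\<omega>. (norm (F \<omega>))\<^sup>2 \<partial>sphere_measure)"
    unfolding cinner_abs_l2_sphere[OF assms assms]
    by (simp add: complex_norm_square[symmetric] integral_complex_of_real del: of_real_power)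
  then show ?thesis
    by (simp add: power2_norm_eq_inner inner_l2_sphere_def)
qed

text \<open>The total mass is 1, so a uniform bound on the sphere is a bound of the L2 norm.\<close>

lemma norm_abs_l2_sphere_le:
  assumes F: "continuous_on UNIV F" and le: "\<And>\<omega>. norm \<omega> = 1 \<Longrightarrow> norm (F \<omega>) \<le> C"
  shows "norm (abs_l2_sphere F) \<le> C"
proof (rule power2_le_imp_le)
  have "(norm (abs_l2_sphere F))\<^sup>2 \<le> (\<integral>\<omega>. C\<^sup>2 \<partial>(sphere_measure :: (real^3) measure))"
    unfolding norm_abs_l2_sphere_square[OF F] using le
    by (intro integral_mono integrable_sphere_continuous continuous_intros F power_mono) auto
  then show "(norm (abs_l2_sphere F))\<^sup>2 \<le> C\<^sup>2"
    by simp
  show "0 \<le> C"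
    using le[of "axis 1 1"] norm_ge_zero[of "F (axis 1 1)"] by (metis axis_orthonormal(1) order_trans)
qed

definition wave :: "real \<Rightarrow> real^3 \<Rightarrow> real^3 \<Rightarrow> complex" where
  "wave \<kappa> z \<omega> = exp (\<i> * of_real (\<kappa> * (\<omega> \<bullet> z)))"

text \<open>The directional derivative along \<open>u\<close> at \<open>z\<close>. The direction
  comes first so that \<open>d_wave \<kappa> u\<close> is a map of the base point that can be
  differentiated again.\<close>

definition d_wave :: "real \<Rightarrow> real^3 \<Rightarrow> real^3 \<Rightarrow> l2_sphere" where
  "d_wave \<kappa> u z = abs_l2_sphere (\<lambda>\<omega>. \<i> * of_real (\<kappa> * (\<omega> \<bullet> u)) * wave \<kappa> z \<omega>)"

definition dd_wave :: "real \<Rightarrow> real^3 \<Rightarrow> real^3 \<Rightarrow> real^3 \<Rightarrow> l2_sphere" where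
  "dd_wave \<kappa> u v z = abs_l2_sphere (\<lambda>\<omega>. - of_real (\<kappa>\<^sup>2 * (\<omega> \<bullet> u) * (\<omega> \<bullet> v)) * wave \<kappa> z \<omega>)"

lemma plane_wave_eq: "plane_wave \<kappa> z = abs_l2_sphere (wave \<kappa> z)"
  by (simp add: plane_wave_def wave_def[abs_def])

lemma continuous_wave [continuous_intros]: "continuous_on UNIV (wave \<kappa> z)"
  unfolding wave_def[abs_def] by (intro continuous_intros)

lemma norm_wave [simp]: "norm (wave \<kappa> z \<omega>) = 1"
  unfolding wave_def by (rule norm_exp_i_times)

lemma wave_add: "wave \<kappa> (z + h) \<omega> = wave \<kappa> h \<omega> * wave \<kappa> z \<omega>"
  unfolding wave_def exp_add[symmetric] by (simp add: inner_add_right distrib_left add.commute)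

lemma wave_cnj: "wave \<kappa> z \<omega> * cnj (wave \<kappa> x \<omega>) = wave \<kappa> (z - x) \<omega>"
proof -
  have "\<i> * of_real (\<kappa> * (\<omega> \<bullet> z)) + cnj (\<i> * of_real (\<kappa> * (\<omega> \<bullet> x)))
      = \<i> * of_real (\<kappa> * (\<omega> \<bullet> (z - x)))"
    by (simp add: complex_eq_iff inner_diff_right right_diff_distrib)
  then show ?thesis
    unfolding wave_def exp_cnj exp_add[symmetric] by (rule arg_cong)
qed

text \<open>Real and imaginary part each contribute at most half of the square; for the sine this
  holds since its Taylor polynomial has no quadratic term.\<close>

lemma norm_exp_i_taylor: "norm (exp (\<i> * of_real a) - 1 - \<i> * of_real a) \<le> a\<^sup>2" for a :: real
proof -
  have eq: "(\<Sum>m<2. sin_coeff m * a ^ m) = a"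
    by (simp add: numeral_2_eq_2 sin_coeff_def)
  have "\<bar>sin a - a\<bar> \<le> a\<^sup>2 / 2"
    using Maclaurin_sin_bound[of a 2] unfolding eq by simp
  moreover have "\<bar>cos a - 1\<bar> \<le> a\<^sup>2 / 2"
    using one_minus_cos_le[of a] by simp
  moreover have "exp (\<i> * of_real a) - 1 - \<i> * of_real a = Complex (cos a - 1) (sin a - a)"
    by (simp add: complex_eq_iff Re_exp Im_exp)
  ultimately show ?thesis
    using cmod_le[of "Complex (cos a - 1) (sin a - a)"] by simp
qed

lemma norm_wave_taylor:
  assumes "norm \<omega> = 1"
  shows "norm (wave \<kappa> h \<omega> - 1 - \<i> * of_real (\<kappa> * (\<omega> \<bullet> h))) \<le> \<kappa>\<^sup>2 * (norm h)\<^sup>2"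
proof -
  have "\<bar>\<omega> \<bullet> h\<bar> \<le> norm h"
    using Cauchy_Schwarz_ineq2[of \<omega> h] assms by simp
  then have "(\<kappa> * (\<omega> \<bullet> h))\<^sup>2 \<le> \<kappa>\<^sup>2 * (norm h)\<^sup>2"
    using power_mono[of "\<bar>\<omega> \<bullet> h\<bar>" "norm h" 2] by (simp add: power_mult_distrib mult_left_mono)
  then show ?thesis
    using norm_exp_i_taylor[of "\<kappa> * (\<omega> \<bullet> h)"] by (simp add: wave_def)
qed

text \<open>Carries a Taylor remainder that is uniform on the sphere over to a Frechet derivative of
  a map into L2.\<close>

lemma has_derivative_quadratic_error:
  fixes f :: "'a::real_normed_vector \<Rightarrow> 'b::real_normed_vector"
  assumes "bounded_linear L" and le: "\<And>h. norm (f (z + h) - f z - L h) \<le> C * (norm h)\<^sup>2"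
  shows "(f has_derivative L) (at z)"
  unfolding has_derivative_at
proof
  have "norm (norm (f (z + h) - f z - L h) / norm h) \<le> C * norm h" for h
    using le[of h] by (cases "h = 0") (auto simp: field_simps power2_eq_square)
  then have "\<forall>\<^sub>F h in at 0. norm (norm (f (z + h) - f z - L h) / norm h) \<le> C * norm h"
    by (intro always_eventually allI)
  moreover have "((\<lambda>h::'a. C * norm h) \<longlongrightarrow> 0) (at 0)"
    by (intro tendsto_mult_right_zero tendsto_norm_zero tendsto_ident_at)
  ultimately show "(\<lambda>h. norm (f (z + h) - f z - L h) / norm h) \<midarrow>0\<rightarrow> 0"
    by (rule Lim_null_comparison)
qed fact

lemma norm_d_wave_le: "norm (d_wave \<kappa> u z) \<le> \<bar>\<kappa>\<bar> * norm u"
  unfolding d_wave_def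
proof (rule norm_abs_l2_sphere_le)
  show "norm (\<i> * of_real (\<kappa> * (\<omega> \<bullet> u)) * wave \<kappa> z \<omega>) \<le> \<bar>\<kappa>\<bar> * norm u" if "norm \<omega> = 1" for \<omega>
    using Cauchy_Schwarz_ineq2[of \<omega> u] that by (simp add: norm_mult abs_mult mult_left_mono)
qed (intro continuous_intros)

lemma norm_dd_wave_le: "norm (dd_wave \<kappa> u v z) \<le> \<kappa>\<^sup>2 * norm u * norm v"
  unfolding dd_wave_def
proof (rule norm_abs_l2_sphere_le)
  fix \<omega> :: "real^3" assume \<omega>: "norm \<omega> = 1"
  have "\<kappa>\<^sup>2 * \<bar>\<omega> \<bullet> u\<bar> * \<bar>\<omega> \<bullet> v\<bar> \<le> \<kappa>\<^sup>2 * norm u * norm v"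
    using Cauchy_Schwarz_ineq2[of \<omega>] \<omega> by (intro mult_mono) (auto simp: mult_left_mono)
  then show "norm (- of_real (\<kappa>\<^sup>2 * (\<omega> \<bullet> u) * (\<omega> \<bullet> v)) * wave \<kappa> z \<omega>) \<le> \<kappa>\<^sup>2 * norm u * norm v"
    by (simp add: norm_mult abs_mult del: of_real_mult)
qed (intro continuous_intros)

lemma bounded_linear_d_wave: "bounded_linear (\<lambda>u. d_wave \<kappa> u z)"
proof (rule bounded_linear_intro[where K = "\<bar>\<kappa>\<bar>"])
  show "d_wave \<kappa> (u + v) z = d_wave \<kappa> u z + d_wave \<kappa> v z" for u v
    unfolding d_wave_def
    by (subst abs_l2_sphere_add) (auto intro!: continuous_intros arg_cong[where f = abs_l2_sphere] simp: inner_add_right algebra_simps)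
  show "d_wave \<kappa> (r *\<^sub>R u) z = r *\<^sub>R d_wave \<kappa> u z" for r u
    unfolding d_wave_def scaleR_l2_sphere_def
    by (subst abs_l2_sphere_scale) (auto intro!: continuous_intros arg_cong[where f = abs_l2_sphere] simp: algebra_simps)
qed (use norm_d_wave_le in \<open>simp add: mult.commute\<close>)

lemma dd_wave_commute: "dd_wave \<kappa> u v z = dd_wave \<kappa> v u z"
  by (simp add: dd_wave_def mult_ac)

lemma bounded_linear_dd_wave: "bounded_linear (\<lambda>u. dd_wave \<kappa> u v z)"
proof (rule bounded_linear_intro[where K = "\<kappa>\<^sup>2 * norm v"])
  show "dd_wave \<kappa> (u + u') v z = dd_wave \<kappa> u v z + dd_wave \<kappa> u' v z" for u u'
    unfolding dd_wave_def
    by (subst abs_l2_sphere_add) (auto intro!: continuous_intros arg_cong[where f = abs_l2_sphere] simp: inner_add_right algebra_simps)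
  show "dd_wave \<kappa> (r *\<^sub>R u) v z = r *\<^sub>R dd_wave \<kappa> u v z" for r u
    unfolding dd_wave_def scaleR_l2_sphere_def
    by (subst abs_l2_sphere_scale) (auto intro!: continuous_intros arg_cong[where f = abs_l2_sphere] simp: algebra_simps)
qed (use norm_dd_wave_le in \<open>simp add: mult_ac\<close>)

lemma has_derivative_plane_wave:
  "(plane_wave \<kappa> has_derivative (\<lambda>u. d_wave \<kappa> u z)) (at z)"
proof (rule has_derivative_quadratic_error[OF bounded_linear_d_wave])
  fix h
  let ?E = "\<lambda>\<omega>. (wave \<kappa> h \<omega> - 1 - \<i> * of_real (\<kappa> * (\<omega> \<bullet> h))) * wave \<kappa> z \<omega>"
  have "plane_wave \<kappa> (z + h) - plane_wave \<kappa> z - d_wave \<kappa> h z = abs_l2_sphere ?E"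
    unfolding plane_wave_eq d_wave_def
    by (subst abs_l2_sphere_diff2) (auto intro!: continuous_intros arg_cong[where f = abs_l2_sphere] simp: wave_add algebra_simps)
  also have "norm \<dots> \<le> \<kappa>\<^sup>2 * (norm h)\<^sup>2"
    by (rule norm_abs_l2_sphere_le) (auto intro!: continuous_intros simp: norm_mult norm_wave_taylor simp del: of_real_mult)
  finally show "norm (plane_wave \<kappa> (z + h) - plane_wave \<kappa> z - d_wave \<kappa> h z) \<le> \<kappa>\<^sup>2 * (norm h)\<^sup>2" .
qed

lemma has_derivative_d_wave:
  "(d_wave \<kappa> v has_derivative (\<lambda>u. dd_wave \<kappa> u v z)) (at z)"
proof (rule has_derivative_quadratic_error[OF bounded_linear_dd_wave])
  fix h
  let ?E = "\<lambda>\<omega>. \<i> * of_real (\<kappa> * (\<omega> \<bullet> v)) * ((wave \<kappa> h \<omega> - 1 - \<i> * of_real (\<kappa> * (\<omega> \<bullet> h))) * wave \<kappa> z \<omega>)"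
  have "d_wave \<kappa> v (z + h) - d_wave \<kappa> v z - dd_wave \<kappa> h v z = abs_l2_sphere ?E"
    unfolding d_wave_def dd_wave_def
    by (subst abs_l2_sphere_diff2)
      (auto intro!: continuous_intros arg_cong[where f = abs_l2_sphere] simp: wave_add algebra_simps power2_eq_square)
  also have "norm \<dots> \<le> \<bar>\<kappa>\<bar> * norm v * (\<kappa>\<^sup>2 * (norm h)\<^sup>2)"
  proof (rule norm_abs_l2_sphere_le)
    fix \<omega> :: "real^3" assume \<omega>: "norm \<omega> = 1"
    have "\<bar>\<kappa>\<bar> * \<bar>\<omega> \<bullet> v\<bar> * norm (wave \<kappa> h \<omega> - 1 - \<i> * of_real (\<kappa> * (\<omega> \<bullet> h)))
        \<le> \<bar>\<kappa>\<bar> * norm v * (\<kappa>\<^sup>2 * (norm h)\<^sup>2)"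
      using Cauchy_Schwarz_ineq2[of \<omega> v] \<omega> by (intro mult_mono norm_wave_taylor) (auto simp: mult_left_mono)
    then show "norm (?E \<omega>) \<le> \<bar>\<kappa>\<bar> * norm v * (\<kappa>\<^sup>2 * (norm h)\<^sup>2)"
      by (simp add: norm_mult abs_mult)
  qed (intro continuous_intros)
  finally show "norm (d_wave \<kappa> v (z + h) - d_wave \<kappa> v z - dd_wave \<kappa> h v z)
      \<le> \<bar>\<kappa>\<bar> * norm v * \<kappa>\<^sup>2 * (norm h)\<^sup>2" by (simp add: mult_ac)
qed

lemma norm_plane_wave [simp]: "norm (plane_wave \<kappa> z) = 1"
proof -
  have "(norm (plane_wave \<kappa> z))\<^sup>2 = 1"
    unfolding plane_wave_eq by (subst norm_abs_l2_sphere_square[OF continuous_wave]) simp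
  then show ?thesis
    by (simp add: power2_eq_1_iff) (metis norm_ge_zero not_one_le_zero neg_0_le_iff_le)
qed

text \<open>The exact value, sharper than the uniform bound, supplies the factor 2/3 of \<epsilon>
  and the sqrt 3 in the gradient estimate.\<close>

lemma norm_d_wave_square: "(norm (d_wave \<kappa> u z))\<^sup>2 = \<kappa>\<^sup>2 * (norm u)\<^sup>2 / 3"
proof -
  have sq: "(\<integral>\<omega>. (\<omega> \<bullet> u)\<^sup>2 \<partial>sphere_measure) = (norm u)\<^sup>2 / 3"
  proof (cases "u = 0")
    case False
    have "(\<omega> \<bullet> u)\<^sup>2 = (norm u)\<^sup>2 * (\<omega> \<bullet> (u /\<^sub>R norm u))\<^sup>2" for \<omega>
      using False by (simp add: power_mult_distrib power_divide field_simps)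
    then show ?thesis
      using integral_sphere_square[of "u /\<^sub>R norm u"] False by simp
  qed simp
  have "(norm (d_wave \<kappa> u z))\<^sup>2 = (\<integral>\<omega>. \<kappa>\<^sup>2 * (\<omega> \<bullet> u)\<^sup>2 \<partial>sphere_measure)"
    unfolding d_wave_def
    by (subst norm_abs_l2_sphere_square) (auto intro!: continuous_intros simp: norm_mult power_mult_distrib)
  then show ?thesis by (simp add: sq)
qed

text \<open>The origin of 2 / sqrt 5 in front of \<epsilon>.\<close>

lemma norm_dd_wave_square:
  assumes "norm e = 1"
  shows "(norm (dd_wave \<kappa> e e z))\<^sup>2 = \<kappa> ^ 4 / 5"
proof -
  have "(norm (dd_wave \<kappa> e e z))\<^sup>2 = (\<integral>\<omega>. \<kappa> ^ 4 * (\<omega> \<bullet> e) ^ 4 \<partial>sphere_measure)"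
    unfolding dd_wave_def
    by (subst norm_abs_l2_sphere_square) (auto intro!: continuous_intros simp: norm_mult power_mult_distrib power2_eq_square power4_eq_xxxx mult_ac)
  then show ?thesis by (simp add: integral_sphere_fourth[OF assms])
qed

section \<open>Pairings of waves and their derivatives with plane waves\<close>

lemma complex_integral_eqI:
  fixes F :: "real^3 \<Rightarrow> complex"
  assumes "continuous_on UNIV F" "\<And>\<omega>. Re (F \<omega>) = R \<omega>" "\<And>\<omega>. Im (F (- \<omega>)) = - Im (F \<omega>)"
  shows "(\<integral>\<omega>. F \<omega> \<partial>sphere_measure) = of_real (\<integral>\<omega>. R \<omega> \<partial>sphere_measure)"
proof (rule complex_eqI)
  have int: "integrable sphere_measure F"
    by (rule integrable_sphere_continuous[OF assms(1)])
  show "Re (\<integral>\<omega>. F \<omega> \<partial>sphere_measure) = Re (of_real (\<integral>\<omega>. R \<omega> \<partial>sphere_measure))"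
    using integral_Re[OF int] by (simp add: assms(2))
  \<comment> \<open>The antipodal map makes these pairings real, also for first derivatives, where
    the factor i is matched by an odd linear form.\<close>
  have "(\<integral>\<omega>. Im (F \<omega>) \<partial>sphere_measure) = 0"
    using assms(1,3) by (intro integral_sphere_odd continuous_intros)
  then show "Im (\<integral>\<omega>. F \<omega> \<partial>sphere_measure) = Im (of_real (\<integral>\<omega>. R \<omega> \<partial>sphere_measure))"
    using integral_Im[OF int] by simp
qed

lemma wave_Re_Im: "Re (wave \<kappa> z \<omega>) = cos (\<omega> \<bullet> (\<kappa> *\<^sub>R z))" "Im (wave \<kappa> z \<omega>) = sin (\<omega> \<bullet> (\<kappa> *\<^sub>R z))"
  by (simp_all add: wave_def Re_exp Im_exp)

lemma cinner_plane_wave: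
  "cinner (plane_wave \<kappa> z) (plane_wave \<kappa> x)
    = of_real (\<integral>\<omega>. cos (\<omega> \<bullet> (\<kappa> *\<^sub>R (z - x))) \<partial>sphere_measure)"
  unfolding plane_wave_eq cinner_abs_l2_sphere[OF continuous_wave continuous_wave] wave_cnj
  by (rule complex_integral_eqI) (auto intro!: continuous_intros simp: wave_Re_Im simp del: inner_scaleR_right)

lemma cinner_d_wave:
  "cinner (d_wave \<kappa> u z) (plane_wave \<kappa> x)
    = of_real (- \<kappa> * (\<integral>\<omega>. (\<omega> \<bullet> u) * sin (\<omega> \<bullet> (\<kappa> *\<^sub>R (z - x))) \<partial>sphere_measure))"
proof -
  have "cinner (d_wave \<kappa> u z) (plane_wave \<kappa> x)
      = (\<integral>\<omega>. \<i> * of_real (\<kappa> * (\<omega> \<bullet> u)) * wave \<kappa> (z - x) \<omega> \<partial>sphere_measure)"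
    unfolding plane_wave_eq d_wave_def
    by (subst cinner_abs_l2_sphere) (auto intro!: continuous_intros simp: mult.assoc wave_cnj)
  also have "\<dots> = of_real (\<integral>\<omega>. - \<kappa> * ((\<omega> \<bullet> u) * sin (\<omega> \<bullet> (\<kappa> *\<^sub>R (z - x)))) \<partial>sphere_measure)"
    by (rule complex_integral_eqI) (auto intro!: continuous_intros simp: wave_Re_Im simp del: inner_scaleR_right)
  finally show ?thesis by simp
qed

lemma cinner_dd_wave:
  "cinner (dd_wave \<kappa> u u z) (plane_wave \<kappa> x)
    = of_real (- \<kappa>\<^sup>2 * (\<integral>\<omega>. (\<omega> \<bullet> u)\<^sup>2 * cos (\<omega> \<bullet> (\<kappa> *\<^sub>R (z - x))) \<partial>sphere_measure))"
proof -
  have "cinner (dd_wave \<kappa> u u z) (plane_wave \<kappa> x)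
      = (\<integral>\<omega>. - of_real (\<kappa>\<^sup>2 * (\<omega> \<bullet> u) * (\<omega> \<bullet> u)) * wave \<kappa> (z - x) \<omega> \<partial>sphere_measure)"
    unfolding plane_wave_eq dd_wave_def
    by (subst cinner_abs_l2_sphere) (auto intro!: continuous_intros simp: mult.assoc wave_cnj)
  also have "\<dots> = of_real (\<integral>\<omega>. - \<kappa>\<^sup>2 * ((\<omega> \<bullet> u)\<^sup>2 * cos (\<omega> \<bullet> (\<kappa> *\<^sub>R (z - x)))) \<partial>sphere_measure)"
    by (rule complex_integral_eqI)
      (auto intro!: continuous_intros simp: wave_Re_Im power2_eq_square mult_ac simp del: inner_scaleR_right)
  finally show ?thesis by simp
qed

section \<open>Gradient and Hessian of \<open>q_tilde\<close>\<close>

context fin_dim_subspace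
begin

lemma inner_proj_commute: "inner (P f) g = inner (P g) f"
  using inner_proj_swap[of f g] by (simp add: inner_commute)

text \<open>The second derivative of 1 - <P \<phi>, \<phi>> for the plane wave \<phi>, kept as a
  bilinear form. Self-adjointness of the projection merges the two symmetric halves into the factor
  2.\<close>

definition hess :: "real \<Rightarrow> real^3 \<Rightarrow> real^3 \<Rightarrow> real^3 \<Rightarrow> real" where
  "hess \<kappa> z u v = - 2 * (inner (P (d_wave \<kappa> u z)) (d_wave \<kappa> v z) + inner (P (plane_wave \<kappa> z)) (dd_wave \<kappa> u v z))"

lemma q_tilde_eq: "q_tilde \<kappa> U z = 1 - inner (P (plane_wave \<kappa> z)) (plane_wave \<kappa> z)"
  by (simp add: q_tilde_def norm_diff_proj)

lemma has_derivative_q_tilde: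
  "(q_tilde \<kappa> U has_derivative (\<lambda>u. - 2 * inner (P (plane_wave \<kappa> z)) (d_wave \<kappa> u z))) (at z)"
proof -
  have "((\<lambda>z. 1 - inner (P (plane_wave \<kappa> z)) (plane_wave \<kappa> z)) has_derivative
      (\<lambda>u. - 2 * inner (P (plane_wave \<kappa> z)) (d_wave \<kappa> u z))) (at z)"
    by (auto intro!: derivative_eq_intros has_derivative_plane_wave
        bounded_linear.has_derivative[OF bounded_linear_proj]
        simp: inner_proj_commute[of "d_wave _ _ _"])
  then show ?thesis by (simp add: q_tilde_eq[abs_def])
qed

lemma inner_gradient:
  "u \<bullet> gradient (q_tilde \<kappa> U) z = - 2 * inner (P (plane_wave \<kappa> z)) (d_wave \<kappa> u z)"
proof -
  define L where "L u = - 2 * inner (P (plane_wave \<kappa> z)) (d_wave \<kappa> u z)" for u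
  have L: "(q_tilde \<kappa> U has_derivative L) (at z)"
    using has_derivative_q_tilde unfolding L_def[abs_def] .
  \<comment> \<open>The adjoint at 1 is the Riesz representative of the derivative, hence the vector
    described by \<open>gradient\<close>.\<close>
  have adj: "u \<bullet> adjoint L 1 = L u" for u
    using adjoint_works[OF has_derivative_linear[OF L], of u 1] by simp
  then have "L = (\<lambda>h. h \<bullet> adjoint L 1)"
    by auto
  then have G: "GDERIV (q_tilde \<kappa> U) z :> adjoint L 1"
    using L by (simp add: gderiv_def)
  have "gradient (q_tilde \<kappa> U) z = adjoint L 1"
    unfolding gradient_def
  proof (rule the_equality[where P = "\<lambda>D. GDERIV (q_tilde \<kappa> U) z :> D", OF G])
    fix D assume "GDERIV (q_tilde \<kappa> U) z :> D"
    then have "(\<lambda>h. h \<bullet> D) = (\<lambda>h. h \<bullet> adjoint L 1)"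
      using G has_derivative_unique unfolding gderiv_def by blast
    then show "D = adjoint L 1"
      by (metis vector_eq_ldot)
  qed
  then show ?thesis
    by (simp add: adj L_def)
qed

lemma has_derivative_gradient:
  "((\<lambda>z. v \<bullet> gradient (q_tilde \<kappa> U) z) has_derivative (\<lambda>u. hess \<kappa> z u v)) (at z)"
  unfolding inner_gradient hess_def
  by (auto intro!: derivative_eq_intros has_derivative_plane_wave has_derivative_d_wave
      bounded_linear.has_derivative[OF bounded_linear_proj])

lemma hess_commute: "hess \<kappa> z u v = hess \<kappa> z v u"
  by (simp add: hess_def inner_proj_commute[of "d_wave \<kappa> u z"] dd_wave_commute[of \<kappa> u])

lemma hess_linear: "linear (\<lambda>u. hess \<kappa> z u v)"
  using has_derivative_linear[OF has_derivative_gradient] .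

end

section \<open>Gradient descent on a ball\<close>

text \<open>Polarisation on unit vectors: 4 B(a, b) is the difference of the values at a + b and a -
  b, whose squared norms add up to 4 by the parallelogram law. The rest is scaling.\<close>

lemma bilinear_bound_of_quadratic:
  fixes B :: "'a::real_inner \<Rightarrow> 'a \<Rightarrow> real"
  assumes lin: "\<And>v. linear (\<lambda>u. B u v)" and sym: "\<And>u v. B u v = B v u"
    and quad: "\<And>w. \<bar>B w w\<bar> \<le> r * (norm w)\<^sup>2"
  shows "\<bar>B u v\<bar> \<le> r * norm u * norm v"
proof (cases "u = 0 \<or> v = 0")
  case True
  then have "B u v = 0"
    using linear_0[OF lin[of v]] linear_0[OF lin[of u]] sym[of u v] by auto
  then show ?thesis using True by auto
next
  case False
  have unit: "\<bar>B a b\<bar> \<le> r" if "norm a = 1" "norm b = 1" for a b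
  proof -
    have add: "B (a + c) d = B a d + B c d" "B (a - c) d = B a d - B c d" for a c d
      by (rule linear_add[OF lin] linear_diff[OF lin])+
    have "B (a + b) (a + b) - B (a - b) (a - b) = 4 * B a b"
      using sym[of a "a + b"] sym[of b "a + b"] sym[of a "a - b"] sym[of b "a - b"] sym[of a b]
      by (simp add: add)
    moreover have "r * (norm (a + b))\<^sup>2 + r * (norm (a - b))\<^sup>2 = 4 * r"
      using that by (simp add: power2_norm_eq_inner inner_add_left inner_add_right inner_diff_left
          inner_diff_right norm_eq_1 inner_commute algebra_simps)
    ultimately show ?thesis
      using quad[of "a + b"] quad[of "a - b"] by linarith
  qed
  have "u = norm u *\<^sub>R sgn u" "v = norm v *\<^sub>R sgn v"
    using False by (simp_all add: sgn_div_norm)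
  then have "B u v = norm u * (norm v * B (sgn u) (sgn v))"
    by (metis linear_scale[OF lin] sym real_scaleR_def)
  then have "\<bar>B u v\<bar> = norm u * norm v * \<bar>B (sgn u) (sgn v)\<bar>"
    by (simp add: abs_mult)
  also have "\<dots> \<le> norm u * norm v * r"
    using False by (intro mult_left_mono unit) (auto simp: norm_sgn)
  finally show ?thesis by (simp add: mult_ac)
qed

text \<open>The gradient is differentiated only after pairing with a fixed vector, so
  \<open>H\<close> is a plain function of two vectors whose linearity comes from being a
  derivative.\<close>

locale ball_descent =
  fixes f :: "'a::euclidean_space \<Rightarrow> real" and g :: "'a \<Rightarrow> 'a" and H :: "'a \<Rightarrow> 'a \<Rightarrow> 'a \<Rightarrow> real"
    and c :: 'a and \<rho> m M h :: real
  assumes f_deriv: "\<And>z. (f has_derivative (\<lambda>u. u \<bullet> g z)) (at z)"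
    and g_deriv: "\<And>z v. ((\<lambda>z. v \<bullet> g z) has_derivative (\<lambda>u. H z u v)) (at z)"
    and H_sym: "\<And>z u v. H z u v = H z v u"
    and H_lower: "\<And>z w. z \<in> cball c \<rho> \<Longrightarrow> m * (norm w)\<^sup>2 \<le> H z w w"
    and H_upper: "\<And>z w. z \<in> cball c \<rho> \<Longrightarrow> H z w w \<le> M * (norm w)\<^sup>2"
    and \<rho>: "\<rho> > 0" and m: "m > 0" and h: "0 < h" "h \<le> 2 / (m + M)"
    and g_center: "norm (g c) < m * \<rho>"
begin

definition "T z = z - h *\<^sub>R g z"
definition "r = 1 - h * m"

lemma H_add: "H z (u + u') v = H z u v + H z u' v"
  and H_scale: "H z (s *\<^sub>R u) v = s * H z u v"
  using linear_add[OF has_derivative_linear[OF g_deriv]] linear_scale[OF has_derivative_linear[OF g_deriv]]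
  by simp_all

lemma m_le_M: "m \<le> M"
proof -
  obtain e :: 'a where "norm e = 1"
    by (metis nonempty_Basis ex_in_conv norm_Basis)
  then show ?thesis
    using H_lower[of c e] H_upper[of c e] \<rho> by simp
qed

lemma step: "h * (m + M) \<le> 2"
  using h m m_le_M by (simp add: field_simps)

lemma r: "0 \<le> r" "r < 1"
proof -
  have "h * m \<le> h * M"
    using m_le_M h by (simp add: mult_left_mono)
  then show "0 \<le> r"
    using step by (simp add: r_def distrib_left)
  show "r < 1"
    using h m by (simp add: r_def)
qed

text \<open>The spectrum of I - h H lies between 1 - h M and 1 - h m = r. The step size condition h
  (m + M) \<le> 2 is exactly 1 - h M \<ge> - r, so the lower end cannot dominate in absolute
  value.\<close>

lemma step_quadratic_bound:
  assumes "z \<in> cball c \<rho>"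
  shows "\<bar>u \<bullet> v - h * H z u v\<bar> \<le> r * norm u * norm v"
proof (rule bilinear_bound_of_quadratic[where B = "\<lambda>u v. u \<bullet> v - h * H z u v"])
  show "linear (\<lambda>u. u \<bullet> v - h * H z u v)" for v
    by (rule linearI) (simp_all add: inner_add_left H_add H_scale algebra_simps)
  show "u \<bullet> v - h * H z u v = v \<bullet> u - h * H z v u" for u v
    using H_sym[of z u v] by (simp add: inner_commute)
  fix w
  have "h * (m * (norm w)\<^sup>2) \<le> h * H z w w" "h * H z w w \<le> h * (M * (norm w)\<^sup>2)"
    using assms h H_lower H_upper by (auto intro!: mult_left_mono)
  moreover have "(h * (m + M)) * (norm w)\<^sup>2 \<le> 2 * (norm w)\<^sup>2"
    using step by (intro mult_right_mono) auto
  ultimately show "\<bar>w \<bullet> w - h * H z w w\<bar> \<le> r * (norm w)\<^sup>2"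
    by (simp add: r_def power2_norm_eq_inner abs_le_iff algebra_simps)
qed

lemma line_mem:
  assumes "y \<in> cball c \<rho>" "z \<in> cball c \<rho>" "0 \<le> t" "t \<le> 1"
  shows "y + t *\<^sub>R (z - y) \<in> cball c \<rho>"
proof -
  have "y + t *\<^sub>R (z - y) = (1 - t) *\<^sub>R y + t *\<^sub>R z"
    by (simp add: algebra_simps)
  then show ?thesis
    using convexD_alt[OF convex_cball assms(1,2)] assms(3,4) by simp
qed

lemma line_deriv: "((\<lambda>t. y + t *\<^sub>R w) has_derivative (\<lambda>t. t *\<^sub>R w)) (at t)"
  by (auto intro!: derivative_eq_intros)

lemma line_deriv_f: "((\<lambda>t. f (y + t *\<^sub>R w)) has_real_derivative (w \<bullet> g (y + t *\<^sub>R w))) (at t)"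
proof -
  have "((\<lambda>t. f (y + t *\<^sub>R w)) has_derivative (\<lambda>s. (s *\<^sub>R w) \<bullet> g (y + t *\<^sub>R w))) (at t)"
    by (rule has_derivative_compose[OF line_deriv f_deriv])
  then show ?thesis
    unfolding has_field_derivative_def by (rule has_derivative_eq_rhs) (simp add: fun_eq_iff)
qed

lemma line_deriv_g: "((\<lambda>t. v \<bullet> g (y + t *\<^sub>R w)) has_real_derivative H (y + t *\<^sub>R w) w v) (at t)"
proof -
  have "((\<lambda>t. v \<bullet> g (y + t *\<^sub>R w)) has_derivative (\<lambda>s. H (y + t *\<^sub>R w) (s *\<^sub>R w) v)) (at t)"
    by (rule has_derivative_compose[OF line_deriv g_deriv])
  then show ?thesis
    unfolding has_field_derivative_def by (rule has_derivative_eq_rhs) (simp add: fun_eq_iff H_scale)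
qed

lemma lipschitz: "r-lipschitz_on (cball c \<rho>) T"
proof (rule lipschitz_onI)
  fix z y assume zy: "z \<in> cball c \<rho>" "y \<in> cball c \<rho>"
  \<comment> \<open>The scalar mean value theorem suffices once the difference of the images is
    paired with itself: one intermediate point then bounds its squared norm.\<close>
  define u w where "u = T z - T y" and "w = z - y"
  have "((\<lambda>t. u \<bullet> w * t - h * (u \<bullet> g (y + t *\<^sub>R w))) has_real_derivative
      w \<bullet> u - h * H (y + t *\<^sub>R w) w u) (at t)" for t
    by (auto intro!: derivative_eq_intros line_deriv_g simp: inner_commute)
  then obtain t where t: "0 < t" "t < 1"
    "(u \<bullet> w * 1 - h * (u \<bullet> g (y + 1 *\<^sub>R w))) - (u \<bullet> w * 0 - h * (u \<bullet> g (y + 0 *\<^sub>R w)))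
      = (1 - 0) * (w \<bullet> u - h * H (y + t *\<^sub>R w) w u)"
    using MVT2[of 0 1 "\<lambda>t. u \<bullet> w * t - h * (u \<bullet> g (y + t *\<^sub>R w))"
        "\<lambda>t. w \<bullet> u - h * H (y + t *\<^sub>R w) w u"] by auto
  have "u \<bullet> u = u \<bullet> w - h * (u \<bullet> g z) + h * (u \<bullet> g y)"
    by (subst (2) u_def) (simp add: T_def w_def inner_diff_right)
  also have "\<dots> = w \<bullet> u - h * H (y + t *\<^sub>R w) w u"
    using t(3) by (simp add: w_def)
  also have "\<dots> \<le> r * norm w * norm u"
    using step_quadratic_bound[of "y + t *\<^sub>R w" w u] line_mem[OF zy(2,1), of t] t by (simp add: w_def abs_le_iff)
  finally have "norm u * norm u \<le> r * norm w * norm u"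
    by (simp add: power2_norm_eq_inner[symmetric] power2_eq_square)
  then have "norm u \<le> r * norm w"
    using r by (cases "u = 0") auto
  then show "dist (T z) (T y) \<le> r * dist z y"
    by (simp add: u_def w_def dist_norm)
qed (rule r)

text \<open>Contraction brings \<open>z\<close> within r \<rho> of the image of the centre, and the
  centre moves by less than h m \<rho>. These add up to \<rho>, strictly.\<close>

lemma T_ball:
  assumes "z \<in> cball c \<rho>" shows "T z \<in> ball c \<rho>"
proof -
  have "dist c (T z) \<le> dist (T z) (T c) + dist (T c) c"
    by (metis dist_commute dist_triangle)
  also have "dist (T z) (T c) \<le> r * dist z c"
    using lipschitz_onD[OF lipschitz] assms \<rho> by simp
  also have "\<dots> \<le> r * \<rho>"
    using assms r by (simp add: dist_commute mult_left_mono)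
  also have "dist (T c) c < h * (m * \<rho>)"
    using g_center h by (simp add: T_def dist_norm)
  finally show ?thesis
    by (simp add: r_def algebra_simps)
qed

lemma fixed_point: "\<exists>!z\<in>cball c \<rho>. T z = z"
proof (rule Banach_fix[OF _ _ r])
  show "T ` cball c \<rho> \<subseteq> cball c \<rho>"
    using T_ball less_imp_le by fastforce
  show "cball c \<rho> \<noteq> {}"
    using \<rho> by simp
qed (auto simp: complete_eq_closed intro: lipschitz_onD[OF lipschitz])

lemma T_fixed_iff: "T z = z \<longleftrightarrow> g z = 0"
  using h by (simp add: T_def)

text \<open>Taylor expansion along the segment from a critical point: the linear term vanishes and
  the remainder is the Hessian at a point of the ball.\<close>

lemma second_order:
  assumes "y \<in> cball c \<rho>" "z \<in> cball c \<rho>" and crit: "g y = 0"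
  shows "m / 2 * (norm (z - y))\<^sup>2 \<le> f z - f y" "f z - f y \<le> M / 2 * (norm (z - y))\<^sup>2"
proof -
  define w where "w = z - y"
  define diff where "diff n t = (if n = 0 then f (y + t *\<^sub>R w) else if n = 1 then w \<bullet> g (y + t *\<^sub>R w)
      else H (y + t *\<^sub>R w) w w)" for n :: nat and t :: real
  have "\<exists>t>0. t < 1 \<and> f (y + 1 *\<^sub>R w) = (\<Sum>k<2. diff k 0 / fact k * 1 ^ k) + diff 2 t / fact 2 * 1 ^ 2"
  proof (rule Maclaurin)
    show "diff 0 = (\<lambda>t. f (y + t *\<^sub>R w))"
      by (simp add: diff_def fun_eq_iff)
    show "\<forall>k t. k < 2 \<and> 0 \<le> t \<and> t \<le> 1 \<longrightarrow> (diff k has_real_derivative diff (Suc k) t) (at t)"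
      using line_deriv_f[of y w] line_deriv_g[of w y w] by (auto simp: less_2_cases_iff diff_def[abs_def])
  qed auto
  then obtain t where t: "0 < t" "t < 1" "f z = f y + H (y + t *\<^sub>R w) w w / 2"
    by (auto simp: numeral_2_eq_2 diff_def w_def crit)
  have "y + t *\<^sub>R w \<in> cball c \<rho>"
    using line_mem[OF assms(1,2), of t] t by (simp add: w_def)
  from H_lower[OF this, of w] H_upper[OF this, of w] t(3)
  show "m / 2 * (norm (z - y))\<^sup>2 \<le> f z - f y" "f z - f y \<le> M / 2 * (norm (z - y))\<^sup>2"
    by (simp_all add: w_def)
qed

text \<open>Reduces uniqueness of the local minimizer to uniqueness of the fixed point.\<close>

lemma local_minimizer_crit: "local_minimizer f y \<Longrightarrow> g y = 0"
proof -
  assume "local_minimizer f y"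
  then have "\<forall>\<^sub>F z in at y. f y \<le> f z"
    unfolding local_minimizer_def by (simp add: eventually_nhds_conv_at)
  from has_derivative_local_min[OF f_deriv this] have "g y \<bullet> g y = 0"
    by (auto simp: fun_eq_iff)
  then show ?thesis by simp
qed

theorem descent:
  "\<exists>xt\<in>ball c \<rho>. local_minimizer f xt \<and> (\<forall>y\<in>ball c \<rho>. local_minimizer f y \<longrightarrow> y = xt) \<and>
    (\<forall>z. z 0 \<in> cball c \<rho> \<and> (\<forall>n. z (Suc n) = T (z n)) \<longrightarrow>
       (\<forall>n\<ge>1. z n \<in> ball c \<rho>) \<and> z \<longlonglongrightarrow> xt \<and>
       (\<forall>n. norm (z n - xt) \<le> r ^ n * norm (z 0 - xt) \<and> 0 \<le> f (z n) - f xt \<and>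
            f (z n) - f xt \<le> M / 2 * r ^ (2 * n) * (norm (z 0 - xt))\<^sup>2))"
proof -
  obtain xt where xt: "xt \<in> cball c \<rho>" "T xt = xt" and
    uniq: "\<And>y. y \<in> cball c \<rho> \<Longrightarrow> T y = y \<Longrightarrow> y = xt"
    using fixed_point by metis
  \<comment> \<open>Banach's theorem needs the complete closed ball; being its own image, the fixed
    point lies in the open one.\<close>
  have xt_ball: "xt \<in> ball c \<rho>"
    using T_ball[OF xt(1)] xt(2) by simp
  have crit: "g xt = 0"
    using xt(2) T_fixed_iff by simp
  have min: "f xt \<le> f y" if "y \<in> cball c \<rho>" for y
  proof -
    have "0 \<le> m / 2 * (norm (y - xt))\<^sup>2" using m by simp
    then show ?thesis using second_order(1)[OF xt(1) that crit] by linarith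
  qed
  show ?thesis
  proof (intro bexI[OF _ xt_ball] conjI ballI impI allI)
    have "\<forall>\<^sub>F y in nhds xt. y \<in> ball c \<rho>"
      using xt_ball by (intro eventually_nhds_in_open) auto
    then show "local_minimizer f xt"
      unfolding local_minimizer_def by eventually_elim (rule min, simp)
    show "y = xt" if "y \<in> ball c \<rho>" "local_minimizer f y" for y
      using that local_minimizer_crit T_fixed_iff by (intro uniq) auto
    fix z assume z: "z 0 \<in> cball c \<rho> \<and> (\<forall>n. z (Suc n) = T (z n))"
    have mem: "z n \<in> cball c \<rho>" for n
    proof (induction n)
      case (Suc n)
      then show ?case using T_ball[OF Suc] z by simp
    qed (use z in auto)
    show "z n \<in> ball c \<rho>" if "1 \<le> n" for n
      using T_ball[OF mem[of "n - 1"]] z that by (metis Suc_diff_1 less_eq_Suc_le One_nat_def)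
    have rate: "norm (z n - xt) \<le> r ^ n * norm (z 0 - xt)" for n
    proof (induction n)
      case (Suc n)
      have "norm (z (Suc n) - xt) \<le> r * norm (z n - xt)"
        using lipschitz_onD[OF lipschitz mem xt(1), of n] z xt(2) by (simp add: dist_norm)
      also have "\<dots> \<le> r * (r ^ n * norm (z 0 - xt))"
        using Suc r by (intro mult_left_mono)
      finally show ?case by simp
    qed simp
    then show "norm (z n - xt) \<le> r ^ n * norm (z 0 - xt)" for n .
    have "(\<lambda>n. r ^ n * norm (z 0 - xt)) \<longlonglongrightarrow> 0"
      using r by (intro tendsto_mult_left_zero LIMSEQ_realpow_zero)
    moreover have "\<forall>\<^sub>F n in sequentially. norm (z n - xt) \<le> r ^ n * norm (z 0 - xt)"
      using rate by (intro always_eventually allI)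
    ultimately have "(\<lambda>n. z n - xt) \<longlonglongrightarrow> 0"
      by (rule Lim_null_comparison[rotated])
    then show "z \<longlonglongrightarrow> xt"
      by (rule LIM_zero_cancel)
    show "0 \<le> f (z n) - f xt" for n
      using min[OF mem] by simp
    show "f (z n) - f xt \<le> M / 2 * r ^ (2 * n) * (norm (z 0 - xt))\<^sup>2" for n
    proof -
      have "f (z n) - f xt \<le> M / 2 * (norm (z n - xt))\<^sup>2"
        by (rule second_order(2)[OF xt(1) mem crit])
      also have "\<dots> \<le> M / 2 * (r ^ n * norm (z 0 - xt))\<^sup>2"
        using m m_le_M rate by (intro mult_left_mono power_mono) auto
      finally show ?thesis
        by (simp add: power_mult_distrib power_mult[symmetric] mult.commute[of n])
    qed
  qed
qed

end

section \<open>The Hessian near the sources\<close>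

text \<open>The data of the sources alone, so that the exact span can be analysed before any
  perturbed subspace enters.\<close>

locale source_points =
  fixes \<kappa> \<rho> \<delta> \<gamma> \<mu> \<nu> :: real and s :: nat and x :: "nat \<Rightarrow> real^3"
  assumes \<kappa>: "\<kappa> > 0" and s: "s \<ge> 2" and inj: "inj_on x {1..s}"
    and \<delta>_def: "\<delta> = min_separation (x ` {1..s})"
    and \<rho>: "\<rho> > 0" "\<rho> \<le> \<delta> / 2"
    and \<gamma>_def: "\<gamma> = \<rho> * \<kappa>"
    and \<mu>_def: "\<mu> = mu_X s \<kappa> \<delta>" and \<mu>_less_1: "\<mu> < 1"
    and \<nu>_def: "\<nu> = nu_X s \<mu>"
begin

abbreviation "UX \<equiv> wave_span \<kappa> (x ` {1..s})"

sublocale UX: fin_dim_subspace UX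
  by (rule fin_dim_subspace_wave_span) simp

lemma \<delta>_le_dist:
  assumes "i \<in> {1..s}" "j \<in> {1..s}" "i \<noteq> j"
  shows "\<delta> \<le> dist (x i) (x j)"
proof -
  have "finite {dist a b |a b. a \<in> x ` {1..s} \<and> b \<in> x ` {1..s} \<and> a \<noteq> b}"
    by (rule finite_subset[where B = "(\<lambda>(a, b). dist a b) ` (x ` {1..s} \<times> x ` {1..s})"]) auto
  moreover have "x i \<noteq> x j"
    using assms inj by (auto dest: inj_onD)
  then have "dist (x i) (x j) \<in> {dist a b |a b. a \<in> x ` {1..s} \<and> b \<in> x ` {1..s} \<and> a \<noteq> b}"
    using assms by blast
  ultimately show ?thesis
    unfolding \<delta>_def min_separation_def by (rule Min_le)
qed

lemma \<delta>_pos: "\<delta> > 0"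
  using \<rho> by linarith

text \<open>Brings the constants into the shape of the packing sums. With R the cube root of s,
  \<open>\<mu>\<^sup>2 / s\<close> is 81/4 times R over the square of \<kappa> \<delta>, and 64/27 *
  81/4 = 48.\<close>

lemma mu_nu_cube_root:
  defines "R \<equiv> root 3 (real s)"
  shows "R > 0" "R ^ 3 = real s" "\<mu> = 9 / 2 * R\<^sup>2 / (\<kappa> * \<delta>)" "\<nu> = 48 * c_nu\<^sup>2 * R / (\<kappa> * \<delta>)\<^sup>2"
proof -
  show R: "R > 0" "R ^ 3 = real s"
    using s by (simp_all add: R_def)
  have "real s powr (2 / 3) = (R ^ 3) powr (2 / 3)"
    by (simp add: R)
  also have "\<dots> = R powr (3 * (2 / 3))"
    using R(1) powr_powr[of R 3 "2 / 3"] powr_realpow[of R 3] by simp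
  also have "\<dots> = R\<^sup>2"
    using R(1) powr_realpow[of R 2] by simp
  finally show \<mu>: "\<mu> = 9 / 2 * R\<^sup>2 / (\<kappa> * \<delta>)"
    by (simp add: \<mu>_def mu_X_def)
  have "\<mu>\<^sup>2 / real s = 81 / 4 * R / (\<kappa> * \<delta>)\<^sup>2"
    unfolding \<mu> R(2)[symmetric] using R(1) \<kappa> \<delta>_pos
    by (simp add: field_simps power2_eq_square power3_eq_cube)
  then show "\<nu> = 48 * c_nu\<^sup>2 * R / (\<kappa> * \<delta>)\<^sup>2"
    by (simp add: \<nu>_def nu_X_def)
qed

lemma \<mu>_pos: "\<mu> > 0" and \<nu>_nonneg: "\<nu> \<ge> 0" and \<gamma>_pos: "\<gamma> > 0"
  using mu_nu_cube_root \<kappa> \<delta>_pos \<rho> by (simp_all add: \<gamma>_def)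

text \<open>Packing sums run over sets of points, Gram sums over indices. Injectivity translates
  between them, and the cardinality is rounded up to \<open>s\<close>.\<close>

lemma sum_other_points:
  assumes "j \<in> {1..s}"
  shows "(\<Sum>y\<in>x ` ({1..s} - {j}). f y) = (\<Sum>k\<in>{1..s} - {j}. f (x k))"
    and "root 3 (real (card (x ` ({1..s} - {j})))) \<le> root 3 (real s)"
proof -
  have inj': "inj_on x ({1..s} - {j})"
    by (rule inj_on_subset[OF inj]) auto
  then show "(\<Sum>y\<in>x ` ({1..s} - {j}). f y) = (\<Sum>k\<in>{1..s} - {j}. f (x k))"
    by (simp add: sum.reindex)
  show "root 3 (real (card (x ` ({1..s} - {j})))) \<le> root 3 (real s)"
    using card_image_le[of "{1..s} - {j}" x] card_mono[of "{1..s}" "{1..s} - {j}"] by simp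
qed

lemma gram_row_sum:
  assumes j: "j \<in> {1..s}"
  shows "(\<Sum>k\<in>{1..s} - {j}. norm (cinner (plane_wave \<kappa> (x k)) (plane_wave \<kappa> (x j)))) \<le> \<mu>"
proof -
  have "norm (cinner (plane_wave \<kappa> (x k)) (plane_wave \<kappa> (x j))) \<le> 1 / \<kappa> * (1 / dist (x j) (x k))"
    if k: "k \<in> {1..s} - {j}" for k
  proof -
    have "dist (x k) (x j) > 0"
      using \<delta>_le_dist[of k j] \<delta>_pos j k by auto
    then have "\<bar>cos_int (\<kappa> * dist (x k) (x j))\<bar> \<le> 1 / (\<kappa> * dist (x k) (x j))"
      using \<kappa> by (intro abs_cos_int_le) simp
    moreover have "norm (\<kappa> *\<^sub>R (x k - x j)) = \<kappa> * dist (x k) (x j)"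
      using \<kappa> by (simp add: dist_norm)
    ultimately show ?thesis
      unfolding cinner_plane_wave integral_sphere_cos_vec[OF axis_orthonormal(1)[of 1]]
      by (simp add: dist_commute)
  qed
  then have "(\<Sum>k\<in>{1..s} - {j}. norm (cinner (plane_wave \<kappa> (x k)) (plane_wave \<kappa> (x j))))
      \<le> 1 / \<kappa> * (\<Sum>k\<in>{1..s} - {j}. 1 / dist (x j) (x k))"
    unfolding sum_distrib_left by (rule sum_mono)
  also have "(\<Sum>k\<in>{1..s} - {j}. 1 / dist (x j) (x k)) = (\<Sum>y\<in>x ` ({1..s} - {j}). 1 / dist (x j) y)"
    by (rule sum_other_points(1)[OF j, symmetric])
  also have "\<dots> \<le> 9 / 2 * (root 3 (real (card (x ` ({1..s} - {j})))))\<^sup>2 / \<delta>"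
  proof (rule sum_inverse_dist_le)
    show "\<delta> \<le> dist a b" if "a \<in> x ` ({1..s} - {j})" "b \<in> x ` ({1..s} - {j})" "a \<noteq> b" for a b
      using that by (elim imageE) (metis DiffD1 \<delta>_le_dist)
    show "\<delta> \<le> dist (x j) a" if "a \<in> x ` ({1..s} - {j})" for a
      using that \<delta>_le_dist[OF j] by (elim imageE) (metis DiffD1 DiffD2 singletonI)
  qed (simp_all add: \<delta>_pos)
  also have "\<dots> \<le> 9 / 2 * (root 3 (real s))\<^sup>2 / \<delta>"
    using \<delta>_pos sum_other_points(2)[OF j] by (intro divide_right_mono mult_left_mono power_mono) auto
  finally show ?thesis
    using \<kappa> by (simp add: mu_nu_cube_root(3) field_simps)
qed

lemma other_points_far:
  assumes "j \<in> {1..s}" "k \<in> {1..s} - {j}" "dist (x j) z \<le> \<rho>"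
  shows "\<delta> / 2 \<le> dist z (x k)"
  using \<delta>_le_dist[of j k] dist_triangle[of "x j" "x k" z] assms \<rho> by auto

text \<open>The origin of \<nu>: the decay rate \<open>c_nu\<close> divided by \<kappa> times
  distance, squared and summed with the packing constant 48.\<close>

lemma tail_sum:
  assumes j: "j \<in> {1..s}" and z: "dist (x j) z \<le> \<rho>"
  shows "(\<Sum>k\<in>{1..s} - {j}. (c_nu / (\<kappa> * dist z (x k)))\<^sup>2) \<le> \<nu>"
proof -
  have "(\<Sum>k\<in>{1..s} - {j}. (c_nu / (\<kappa> * dist z (x k)))\<^sup>2)
      = c_nu\<^sup>2 / \<kappa>\<^sup>2 * (\<Sum>k\<in>{1..s} - {j}. 1 / (dist z (x k))\<^sup>2)"
    unfolding sum_distrib_left by (simp add: power_divide power_mult_distrib)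
  also have "\<dots> \<le> c_nu\<^sup>2 / \<kappa>\<^sup>2 * (48 * root 3 (real s) / \<delta>\<^sup>2)"
  proof (rule mult_left_mono)
    have "(\<Sum>k\<in>{1..s} - {j}. 1 / (dist z (x k))\<^sup>2) = (\<Sum>y\<in>x ` ({1..s} - {j}). 1 / (dist z y)\<^sup>2)"
      by (rule sum_other_points(1)[OF j, symmetric])
    also have "\<dots> \<le> 48 * root 3 (real (card (x ` ({1..s} - {j})))) / \<delta>\<^sup>2"
    proof (rule sum_inverse_dist_square_le)
      show "\<delta> \<le> dist a b" if "a \<in> x ` ({1..s} - {j})" "b \<in> x ` ({1..s} - {j})" "a \<noteq> b" for a b
        using that by (elim imageE) (metis DiffD1 \<delta>_le_dist)
      show "\<delta> / 2 \<le> dist z a" if "a \<in> x ` ({1..s} - {j})" for a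
        using that other_points_far[OF j _ z] by (elim imageE) simp
    qed (simp_all add: \<delta>_pos)
    also have "\<dots> \<le> 48 * root 3 (real s) / \<delta>\<^sup>2"
      using sum_other_points(2)[OF j] by (intro divide_right_mono mult_left_mono) auto
    finally show "(\<Sum>k\<in>{1..s} - {j}. 1 / (dist z (x k))\<^sup>2) \<le> 48 * root 3 (real s) / \<delta>\<^sup>2" .
  qed simp
  also have "\<dots> = \<nu>"
    by (simp add: mu_nu_cube_root(4) power_mult_distrib)
  finally show ?thesis .
qed

text \<open>Both projected pairings in the Hessian are replaced by plain sums over the sources, at
  the price of the Gram error \<mu> / (1 - \<mu>) times \<open>C1\<close>. In these sums the index
  \<open>j\<close> gives the main term up to order \<open>\<gamma>\<^sup>2\<close>, and the others
  are controlled by \<nu>.\<close>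

lemma hess_near:
  assumes j: "j \<in> {1..s}" and z: "z \<in> cball (x j) \<rho>" and e: "norm e = 1"
  shows "\<bar>UX.hess \<kappa> z e e - 2 / 3 * \<kappa>\<^sup>2\<bar> \<le> C2 \<gamma> \<mu> \<nu> * \<kappa>\<^sup>2"
proof -
  let ?I = "{1..s}"
  have z': "dist (x j) z \<le> \<rho>" using z by simp
  define \<phi> d dd where "\<phi> = plane_wave \<kappa> z" and "d = d_wave \<kappa> e z" and "dd = dd_wave \<kappa> e e z"
  define y where "y k = \<kappa> *\<^sub>R (z - x k)" for k
  define v v' v'' where "v k = cos_int (norm (y k))"
    and "v' k = - \<kappa> * (\<integral>\<omega>. (\<omega> \<bullet> e) * sin (\<omega> \<bullet> y k) \<partial>sphere_measure)"
    and "v'' k = - \<kappa>\<^sup>2 * (\<integral>\<omega>. (\<omega> \<bullet> e)\<^sup>2 * cos (\<omega> \<bullet> y k) \<partial>sphere_measure)" for k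
  \<comment> \<open>A common majorant for foreign sources: the wave and its first and second
    derivatives pair to at most 1, \<kappa> and \<open>2 * \<kappa>\<^sup>2\<close> times \<tau>, so
    that one square sum controls all three.\<close>
  define \<tau> where "\<tau> k = c_nu / (\<kappa> * dist z (x k))" for k
  have cin: "cinner \<phi> (plane_wave \<kappa> (x k)) = of_real (v k)"
    "cinner d (plane_wave \<kappa> (x k)) = of_real (v' k)"
    "cinner dd (plane_wave \<kappa> (x k)) = of_real (v'' k)" for k
    by (simp_all add: \<phi>_def d_def dd_def v_def v'_def v''_def y_def cinner_plane_wave
        integral_sphere_cos_vec[OF e] cinner_d_wave cinner_dd_wave del: inner_scaleR_right)

  have ny: "norm (y k) = \<kappa> * dist z (x k)" for k
    using \<kappa> by (simp add: y_def dist_norm)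
  have far: "y k \<noteq> 0" if "k \<in> ?I - {j}" for k
    using other_points_far[OF j that z'] \<delta>_pos \<kappa> by (auto simp: y_def)
  have others: "\<bar>v k\<bar> \<le> \<tau> k" "\<bar>v' k\<bar> \<le> \<kappa> * \<tau> k" "\<bar>v'' k\<bar> \<le> 2 * \<kappa>\<^sup>2 * \<tau> k" "\<tau> k \<ge> 0" if "k \<in> ?I - {j}" for k
  proof -
    have pos: "norm (y k) > 0" using far[OF that] by simp
    have "\<bar>v k\<bar> \<le> 1 / norm (y k)"
      unfolding v_def by (rule abs_cos_int_le[OF pos])
    also have "\<dots> \<le> \<tau> k"
      unfolding \<tau>_def ny[symmetric] using c_nu_ge_1 pos by (simp add: divide_right_mono)
    finally show "\<bar>v k\<bar> \<le> \<tau> k" .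
    show "\<bar>v' k\<bar> \<le> \<kappa> * \<tau> k"
      unfolding v'_def \<tau>_def ny[symmetric] using abs_integral_sphere_sin_le(2)[OF e far[OF that]] \<kappa>
      by (simp add: abs_mult mult_left_mono flip: times_divide_eq_right)
    show "\<bar>v'' k\<bar> \<le> 2 * \<kappa>\<^sup>2 * \<tau> k"
      unfolding v''_def \<tau>_def ny[symmetric] using mult_left_mono[OF abs_integral_sphere_cos2_le[OF e far[OF that]], of "\<kappa>\<^sup>2"]
      by (simp add: abs_mult mult_ac)
    show "\<tau> k \<ge> 0"
      unfolding \<tau>_def using c_nu_ge_1 \<kappa> by simp
  qed
  have \<tau>: "(\<Sum>k\<in>?I - {j}. (\<tau> k)\<^sup>2) \<le> \<nu>"
    unfolding \<tau>_def by (rule tail_sum[OF j z'])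

  define t where "t = norm (y j)"
  have t: "0 \<le> t" "t \<le> \<gamma>"
    using z' \<kappa> by (simp_all add: t_def ny \<gamma>_def dist_commute mult.commute)
  then have t2: "t\<^sup>2 \<le> \<gamma>\<^sup>2" by (simp add: power_mono)
  define J where "J = (\<integral>\<omega>. (\<omega> \<bullet> e)\<^sup>2 * cos (\<omega> \<bullet> y j) \<partial>sphere_measure)"
  have J: "\<bar>J\<bar> \<le> 1 / 3" "\<bar>1 / 3 - J\<bar> \<le> t\<^sup>2 / 10"
    unfolding J_def t_def by (rule abs_integral_sphere_cos2_le_third[OF e], rule integral_sphere_cos2_near_third[OF e])
  have v'j: "(v' j)\<^sup>2 \<le> \<kappa>\<^sup>2 * (\<gamma>\<^sup>2 / 9)"
  proof -
    have "\<bar>v' j\<bar> \<le> \<kappa> * (\<gamma> / 3)"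
      using abs_integral_sphere_sin_le(1)[OF e, of "y j"] \<kappa> t
      by (simp add: v'_def abs_mult t_def[symmetric] mult_left_mono flip: times_divide_eq_right)
    from power_mono[OF this, of 2] show ?thesis
      by (simp add: power_mult_distrib power_divide)
  qed
  have vj: "\<bar>v j\<bar> \<le> 1"
  proof -
    have "\<bar>\<integral>\<omega>. cos (\<omega> \<bullet> y j) \<partial>sphere_measure\<bar> \<le> (\<integral>\<omega>. 1 \<partial>(sphere_measure :: (real^3) measure))"
      by (intro abs_integral_sphere_le continuous_intros) simp
    then show ?thesis
      by (simp add: v_def integral_sphere_cos_vec[OF e])
  qed
  have v''j: "\<bar>v'' j\<bar> \<le> \<kappa>\<^sup>2 * (1 / 3 + \<gamma>\<^sup>2 / 10)"
  proof -
    have "\<bar>J\<bar> \<le> 1 / 3 + \<gamma>\<^sup>2 / 10"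
      using J(1) zero_le_power2[of \<gamma>] by linarith
    then show ?thesis
      unfolding v''_def J_def[symmetric] abs_mult by (intro mult_mono) auto
  qed
  \<comment> \<open>The constant is 1/10 from \<open>J\<close> near 1/3 plus 1/18 from
    \<open>v j\<close> near 1, and 1/10 + 1/18 = 7/45.\<close>
  have own: "\<bar>v j * v'' j + \<kappa>\<^sup>2 / 3\<bar> \<le> \<kappa>\<^sup>2 * (7 / 45 * \<gamma>\<^sup>2)"
  proof -
    have "\<bar>J * (1 - v j)\<bar> \<le> 1 / 3 * (t\<^sup>2 / 6)"
      unfolding abs_mult v_def t_def[symmetric] by (intro mult_mono J cos_int_near_1) auto
    then have "\<bar>1 / 3 - J\<bar> + \<bar>J * (1 - v j)\<bar> \<le> 7 / 45 * \<gamma>\<^sup>2"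
      using J(2) t2 by linarith
    then have "\<bar>(1 / 3 - J) + J * (1 - v j)\<bar> \<le> 7 / 45 * \<gamma>\<^sup>2"
      using abs_triangle_ineq order_trans by blast
    from mult_left_mono[OF this, of "\<kappa>\<^sup>2"] have "\<bar>\<kappa>\<^sup>2 * ((1 / 3 - J) + J * (1 - v j))\<bar> \<le> \<kappa>\<^sup>2 * (7 / 45 * \<gamma>\<^sup>2)"
      by (simp add: abs_mult)
    moreover have "v'' j = - \<kappa>\<^sup>2 * J"
      by (simp add: v''_def J_def)
    then have "v j * v'' j + \<kappa>\<^sup>2 / 3 = \<kappa>\<^sup>2 * ((1 / 3 - J) + J * (1 - v j))"
      by (simp add: algebra_simps)
    ultimately show ?thesis by simp
  qed

  have split: "(\<Sum>k\<in>?I. f k) = f j + (\<Sum>k\<in>?I - {j}. f k)" for f :: "nat \<Rightarrow> real"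
    using j by (simp add: sum.remove)
  have sum_v: "(\<Sum>k\<in>?I. (v k)\<^sup>2) \<le> 1 + \<nu>"
  proof -
    have "(\<Sum>k\<in>?I - {j}. (v k)\<^sup>2) \<le> (\<Sum>k\<in>?I - {j}. (\<tau> k)\<^sup>2)"
      using others by (intro sum_mono abs_le_square_iff[THEN iffD1]) auto
    moreover have "(v j)\<^sup>2 \<le> 1"
      using vj by (simp add: abs_square_le_1)
    ultimately show ?thesis
      unfolding split using \<tau> by linarith
  qed
  have sum_v': "(\<Sum>k\<in>?I. (v' k)\<^sup>2) \<le> \<kappa>\<^sup>2 * (\<gamma>\<^sup>2 / 9 + \<nu>)"
  proof -
    have "(\<Sum>k\<in>?I - {j}. (v' k)\<^sup>2) \<le> (\<Sum>k\<in>?I - {j}. (\<kappa> * \<tau> k)\<^sup>2)"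
      using others \<kappa> by (intro sum_mono abs_le_square_iff[THEN iffD1]) auto
    also have "\<dots> \<le> \<kappa>\<^sup>2 * \<nu>"
      unfolding power_mult_distrib sum_distrib_left[symmetric] using \<tau> by (intro mult_left_mono) auto
    finally show ?thesis
      unfolding split distrib_left using v'j by linarith
  qed
  have sum_v'': "(\<Sum>k\<in>?I. (v'' k)\<^sup>2) \<le> \<kappa> ^ 4 * ((1 / 3 + \<gamma>\<^sup>2 / 10)\<^sup>2 + 4 * \<nu>)"
  proof -
    have "(\<Sum>k\<in>?I - {j}. (v'' k)\<^sup>2) \<le> (\<Sum>k\<in>?I - {j}. (2 * \<kappa>\<^sup>2 * \<tau> k)\<^sup>2)"
      using others by (intro sum_mono abs_le_square_iff[THEN iffD1]) auto
    also have "\<dots> \<le> (2 * \<kappa>\<^sup>2)\<^sup>2 * \<nu>"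
      unfolding power_mult_distrib[of "2 * \<kappa>\<^sup>2"] sum_distrib_left[symmetric] using \<tau> by (intro mult_left_mono) auto
    finally have "(\<Sum>k\<in>?I - {j}. (v'' k)\<^sup>2) \<le> \<kappa> ^ 4 * (4 * \<nu>)"
      by (simp add: power_mult_distrib)
    moreover have "(v'' j)\<^sup>2 \<le> \<kappa> ^ 4 * (1 / 3 + \<gamma>\<^sup>2 / 10)\<^sup>2"
      using power_mono[OF v''j, of 2] by (simp add: power_mult_distrib)
    ultimately show ?thesis
      unfolding split distrib_left by linarith
  qed
  have cross: "\<bar>\<Sum>k\<in>?I - {j}. v k * v'' k\<bar> \<le> 2 * \<kappa>\<^sup>2 * \<nu>"
  proof -
    have "\<bar>\<Sum>k\<in>?I - {j}. v k * v'' k\<bar> \<le> (\<Sum>k\<in>?I - {j}. \<tau> k * (2 * \<kappa>\<^sup>2 * \<tau> k))"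
      using others by (intro order.trans[OF sum_abs] sum_mono) (auto simp: abs_mult intro!: mult_mono)
    also have "\<dots> = 2 * \<kappa>\<^sup>2 * (\<Sum>k\<in>?I - {j}. (\<tau> k)\<^sup>2)"
      by (simp add: sum_distrib_left power2_eq_square mult_ac)
    also have "\<dots> \<le> 2 * \<kappa>\<^sup>2 * \<nu>"
      using \<tau> by (intro mult_left_mono) auto
    finally show ?thesis .
  qed

  define \<theta> where "\<theta> = \<mu> / (1 - \<mu>)"
  have \<theta>: "\<theta> \<ge> 0"
    using \<mu>_pos \<mu>_less_1 by (simp add: \<theta>_def)
  have UX_eq: "UX = l2.span ((\<lambda>k. plane_wave \<kappa> (x k)) ` ?I)"
    by (simp add: wave_span_def image_image)
  have unit: "cinner (plane_wave \<kappa> (x k)) (plane_wave \<kappa> (x k)) = 1" for k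
    by (simp add: cinner_plane_wave)
  note near = proj_near_orthonormal[where \<phi> = "\<lambda>k. plane_wave \<kappa> (x k)" and I = ?I and \<mu> = \<mu>,
      OF finite_atLeastAtMost unit gram_row_sum less_imp_le[OF \<mu>_pos] \<mu>_less_1, folded UX_eq \<theta>_def]
  have re: "\<bar>inner (UX.P f) g - (\<Sum>k\<in>?I. a k * b k)\<bar> \<le> \<theta> * L2_set a ?I * L2_set b ?I"
    if "\<And>k. cinner f (plane_wave \<kappa> (x k)) = of_real (a k)" "\<And>k. cinner g (plane_wave \<kappa> (x k)) = of_real (b k)"
    for f g a b
  proof -
    have "inner (UX.P f) g - (\<Sum>k\<in>?I. a k * b k) = Re (cinner (UX.P f) g - (\<Sum>k\<in>?I. of_real (a k) * cnj (of_real (b k))))"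
      by (simp add: inner_l2_sphere_def)
    also have "\<bar>\<dots>\<bar> \<le> norm (cinner (UX.P f) g - (\<Sum>k\<in>?I. of_real (a k) * cnj (of_real (b k))))"
      by (rule abs_Re_le_cmod)
    also have "\<dots> \<le> \<theta> * L2_set a ?I * L2_set b ?I"
      using near[of f g] by (simp add: that L2_set_def)
    finally show ?thesis .
  qed
  have A: "\<bar>inner (UX.P d) d - (\<Sum>k\<in>?I. (v' k)\<^sup>2)\<bar> \<le> \<theta> * (\<kappa>\<^sup>2 * (\<gamma>\<^sup>2 / 9 + \<nu>))"
  proof -
    have "L2_set v' ?I * L2_set v' ?I \<le> \<kappa>\<^sup>2 * (\<gamma>\<^sup>2 / 9 + \<nu>)"
      using sum_v' by (simp add: L2_set_def sum_nonneg)
    with mult_left_mono[OF this \<theta>] re[OF cin(2) cin(2)] show ?thesis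
      by (simp add: power2_eq_square mult.assoc)
  qed
  have B: "\<bar>inner (UX.P \<phi>) dd - (\<Sum>k\<in>?I. v k * v'' k)\<bar>
      \<le> \<theta> * (\<kappa>\<^sup>2 * (sqrt (1 + \<nu>) * sqrt ((1 / 3 + \<gamma>\<^sup>2 / 10)\<^sup>2 + 4 * \<nu>)))"
  proof -
    have "L2_set v ?I * L2_set v'' ?I \<le> sqrt (1 + \<nu>) * sqrt (\<kappa> ^ 4 * ((1 / 3 + \<gamma>\<^sup>2 / 10)\<^sup>2 + 4 * \<nu>))"
      unfolding L2_set_def using sum_v sum_v'' \<nu>_nonneg by (intro mult_mono real_sqrt_le_mono) (auto simp: sum_nonneg)
    also have "sqrt (\<kappa> ^ 4 * ((1 / 3 + \<gamma>\<^sup>2 / 10)\<^sup>2 + 4 * \<nu>)) = \<kappa>\<^sup>2 * sqrt ((1 / 3 + \<gamma>\<^sup>2 / 10)\<^sup>2 + 4 * \<nu>)"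
      using real_sqrt_abs[of "\<kappa>\<^sup>2"] by (simp add: real_sqrt_mult)
    finally have "L2_set v ?I * L2_set v'' ?I \<le> \<kappa>\<^sup>2 * (sqrt (1 + \<nu>) * sqrt ((1 / 3 + \<gamma>\<^sup>2 / 10)\<^sup>2 + 4 * \<nu>))"
      by (simp add: mult.left_commute)
    with mult_left_mono[OF this \<theta>] re[OF cin(1) cin(3)] show ?thesis
      by (simp add: mult.assoc)
  qed
  have "0 \<le> (\<Sum>k\<in>?I. (v' k)\<^sup>2)"
    by (rule sum_nonneg) simp
  \<comment> \<open>Here 1/9 + 7/45 = 4/15 and \<nu> + 2 \<nu> = 3 \<nu>; the factor -2 of the
    Hessian doubles them to the 8/15 and 6 of \<open>C2\<close>.\<close>
  then have "\<bar>inner (UX.P d) d + inner (UX.P \<phi>) dd + \<kappa>\<^sup>2 / 3\<bar>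
      \<le> \<theta> * (\<kappa>\<^sup>2 * (\<gamma>\<^sup>2 / 9 + \<nu>)) + \<theta> * (\<kappa>\<^sup>2 * (sqrt (1 + \<nu>) * sqrt ((1 / 3 + \<gamma>\<^sup>2 / 10)\<^sup>2 + 4 * \<nu>)))
        + \<kappa>\<^sup>2 * (\<gamma>\<^sup>2 / 9 + \<nu>) + \<kappa>\<^sup>2 * (7 / 45 * \<gamma>\<^sup>2) + 2 * \<kappa>\<^sup>2 * \<nu>"
    using A B sum_v' own cross split[of "\<lambda>k. v k * v'' k"]
    by linarith
  also have "\<dots> = C2 \<gamma> \<mu> \<nu> * \<kappa>\<^sup>2 / 2"
  proof -
    have C2: "C2 \<gamma> \<mu> \<nu> = 8 / 15 * \<gamma>\<^sup>2 + 6 * \<nu> + 2 * \<theta> * C1 \<gamma> \<nu>"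
      by (simp add: C2_def \<theta>_def)
    show ?thesis
      unfolding C2 C1_def by (simp add: algebra_simps)
  qed
  finally show ?thesis
    unfolding UX.hess_def d_def[symmetric] dd_def[symmetric] \<phi>_def[symmetric] distrib_left by linarith
qed

end

section \<open>From the span of the waves to the perturbed subspace\<close>

lemma (in fin_dim_subspace) hess_scaleR: "hess \<kappa> z (r *\<^sub>R u) (r *\<^sub>R u) = r\<^sup>2 * hess \<kappa> z u u"
proof -
  have "hess \<kappa> z (r *\<^sub>R u) v = r * hess \<kappa> z u v" for u v
    using linear_scale[OF hess_linear] by simp
  then show ?thesis
    using hess_commute[of \<kappa> z u "r *\<^sub>R u"] by (simp add: power2_eq_square)
qed

locale perturbed_subspace = source_points +
  fixes U :: "l2_sphere set" and \<epsilon> :: real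
  assumes U: "l2.subspace U" "l2.dim U = s"
    and \<epsilon>_def: "\<epsilon> = onorm (\<lambda>f. orth_proj U f - orth_proj (wave_span \<kappa> (x ` {1..s})) f)"
begin

sublocale fin_dim_subspace U
  using U s by (intro fin_dim_subspaceI_dim) auto

lemma inner_proj_diff_le: "\<bar>inner (P f) g - inner (UX.P f) g\<bar> \<le> \<epsilon> * norm f * norm g"
proof -
  have "bounded_linear (\<lambda>f. P f - UX.P f)"
    by (intro bounded_linear_sub bounded_linear_proj UX.bounded_linear_proj)
  then have "norm (P f - UX.P f) \<le> \<epsilon> * norm f"
    unfolding \<epsilon>_def by (rule onorm)
  then have "norm (P f - UX.P f) * norm g \<le> \<epsilon> * norm f * norm g"
    by (intro mult_right_mono) auto
  then show ?thesis
    using Cauchy_Schwarz_ineq2[of "P f - UX.P f" g] by (simp add: inner_diff_left)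
qed

lemma \<epsilon>_nonneg: "0 \<le> \<epsilon>"
  using inner_proj_diff_le[of "plane_wave \<kappa> 0" "plane_wave \<kappa> 0"] by simp

text \<open>Bounds how far the eigenvalues of the Hessian, in units of the squared wave number, can
  lie from 2/3 on the balls.\<close>

definition "spread = C2 \<gamma> \<mu> \<nu> + (2 / sqrt 5 + 2 / 3) * \<epsilon>"

lemma hess_unit:
  assumes "j \<in> {1..s}" "z \<in> cball (x j) \<rho>" "norm e = 1"
  shows "\<bar>hess \<kappa> z e e - 2 / 3 * \<kappa>\<^sup>2\<bar> \<le> spread * \<kappa>\<^sup>2"
proof -
  let ?d = "d_wave \<kappa> e z" and ?\<phi> = "plane_wave \<kappa> z" and ?dd = "dd_wave \<kappa> e e z"
  have d: "\<bar>inner (P ?d) ?d - inner (UX.P ?d) ?d\<bar> \<le> \<epsilon> * (\<kappa>\<^sup>2 / 3)"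
    using inner_proj_diff_le[of ?d ?d] norm_d_wave_square[of \<kappa> e z] assms(3)
    by (simp add: mult.assoc flip: power2_eq_square)
  have "norm ?dd = \<kappa>\<^sup>2 / sqrt 5"
    using arg_cong[OF norm_dd_wave_square[OF assms(3), of \<kappa> z], of sqrt] real_sqrt_abs[of "\<kappa>\<^sup>2"]
    by (simp add: real_sqrt_divide)
  then have dd: "\<bar>inner (P ?\<phi>) ?dd - inner (UX.P ?\<phi>) ?dd\<bar> \<le> \<epsilon> * (\<kappa>\<^sup>2 / sqrt 5)"
    using inner_proj_diff_le[of ?\<phi> ?dd] by simp
  have "\<bar>hess \<kappa> z e e - UX.hess \<kappa> z e e\<bar> \<le> 2 * (\<epsilon> * (\<kappa>\<^sup>2 / 3)) + 2 * (\<epsilon> * (\<kappa>\<^sup>2 / sqrt 5))"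
    unfolding hess_def UX.hess_def distrib_left using d dd by linarith
  moreover have "2 * (\<epsilon> * (\<kappa>\<^sup>2 / 3)) + 2 * (\<epsilon> * (\<kappa>\<^sup>2 / sqrt 5)) + C2 \<gamma> \<mu> \<nu> * \<kappa>\<^sup>2 = spread * \<kappa>\<^sup>2"
    by (simp add: spread_def algebra_simps)
  ultimately show ?thesis
    using hess_near[OF assms] by linarith
qed

lemma hess_bounds:
  assumes "j \<in> {1..s}" "z \<in> cball (x j) \<rho>"
  shows "(2 / 3 - spread) * \<kappa>\<^sup>2 * (norm w)\<^sup>2 \<le> hess \<kappa> z w w"
    and "hess \<kappa> z w w \<le> (2 / 3 + spread) * \<kappa>\<^sup>2 * (norm w)\<^sup>2"
proof -
  obtain e where e: "norm e = 1" "w = norm w *\<^sub>R e"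
  proof (cases "w = 0")
    case True
    then show ?thesis using that[of "axis 1 1"] by simp
  next
    case False
    then show ?thesis using that[of "w /\<^sub>R norm w"] by simp
  qed
  have "hess \<kappa> z w w = (norm w)\<^sup>2 * hess \<kappa> z e e"
    by (subst e(2), subst e(2), subst hess_scaleR) simp
  moreover have "(2 / 3 - spread) * \<kappa>\<^sup>2 \<le> hess \<kappa> z e e" "hess \<kappa> z e e \<le> (2 / 3 + spread) * \<kappa>\<^sup>2"
    using hess_unit[OF assms e(1)] by (auto simp: abs_le_iff algebra_simps)
  ultimately show "(2 / 3 - spread) * \<kappa>\<^sup>2 * (norm w)\<^sup>2 \<le> hess \<kappa> z w w"
    "hess \<kappa> z w w \<le> (2 / 3 + spread) * \<kappa>\<^sup>2 * (norm w)\<^sup>2"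
    by (simp_all add: mult.commute[of _ "(norm w)\<^sup>2"] mult_left_mono)
qed

text \<open>For the exact span the gradient vanishes at a source: the wave there is its own
  projection, and it is orthogonal, in the real inner product, to its derivatives. Only the
  difference of the projectors remains.\<close>

lemma gradient_center:
  assumes "j \<in> {1..s}"
  shows "norm (gradient (q_tilde \<kappa> U) (x j)) \<le> 2 * \<epsilon> * \<kappa> / sqrt 3"
proof -
  let ?\<phi> = "plane_wave \<kappa> (x j)"
  \<comment> \<open>Testing with the gradient itself makes the pairing its squared norm.\<close>
  define u where "u = gradient (q_tilde \<kappa> U) (x j)"
  have mem: "?\<phi> \<in> UX"
    unfolding wave_span_def using assms by (intro l2.span_base) auto
  have "inner (UX.P ?\<phi>) (d_wave \<kappa> u (x j)) = inner (d_wave \<kappa> u (x j)) ?\<phi>"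
    unfolding UX.proj_of_mem[OF mem] by (rule inner_commute)
  also have "\<dots> = 0"
    by (simp add: inner_l2_sphere_def cinner_d_wave)
  finally have "\<bar>inner (P ?\<phi>) (d_wave \<kappa> u (x j))\<bar> \<le> \<epsilon> * norm (d_wave \<kappa> u (x j))"
    using inner_proj_diff_le[of ?\<phi> "d_wave \<kappa> u (x j)"] by simp
  also have "norm (d_wave \<kappa> u (x j)) = \<kappa> * norm u / sqrt 3"
    using arg_cong[OF norm_d_wave_square[of \<kappa> u "x j"], of sqrt] \<kappa> by (simp add: real_sqrt_divide real_sqrt_mult)
  finally have "u \<bullet> u \<le> 2 * (\<epsilon> * (\<kappa> * norm u / sqrt 3))"
    using inner_gradient[of u \<kappa> "x j"] by (simp add: u_def)
  then have "norm u * norm u \<le> (2 * \<epsilon> * \<kappa> / sqrt 3) * norm u"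
    by (simp add: power2_norm_eq_inner[symmetric] power2_eq_square)
  moreover have "0 \<le> 2 * \<epsilon> * \<kappa> / sqrt 3"
    using \<epsilon>_nonneg \<kappa> by simp
  ultimately show ?thesis
    unfolding u_def[symmetric] by (cases "u = 0") (auto dest: mult_right_le_imp_le simp del: times_divide_eq_left)
qed

end

theorem theorem5p11:
  fixes \<kappa> \<rho> \<delta> \<gamma> \<mu> \<nu> \<epsilon> C0m C0p m M h r :: real
    and s :: nat
    and x :: "nat \<Rightarrow> real^3"
    and U :: "l2_sphere set"
    and T :: "real^3 \<Rightarrow> real^3"
  assumes "\<kappa> > 0" and "s \<ge> 2" and "inj_on x {1..s}"
    and "\<delta> = min_separation (x ` {1..s})"
    and "\<rho> > 0"
    and "(\<Union>j\<in>{1..s}. cball (x j) \<rho>) \<subseteq> ball 0 1"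
    and "\<rho> \<le> \<delta> / 2"
    and "\<gamma> = \<rho> * \<kappa>"
    and "\<mu> = mu_X s \<kappa> \<delta>" and "\<mu> < 1"
    and "\<nu> = nu_X s \<mu>"
    and "l2.subspace U" and "l2.dim U = s"
    and "\<epsilon> = onorm (\<lambda>f. orth_proj U f - orth_proj (wave_span \<kappa> (x ` {1..s})) f)"
    and "A_gamma \<gamma> \<mu> \<nu> > 0"
    and "C2 \<gamma> \<mu> \<nu> < 2 / 3"
    and "\<epsilon> < min
          (sqrt 3 / 2 * \<gamma> * (2 / 3 - C2 \<gamma> \<mu> \<nu>) / (1 + sqrt 3 / 2 * \<gamma> * (2 / sqrt 5 + 2 / 3)))
          (sin (1 / 2 * arcsin (sqrt (A_gamma \<gamma> \<mu> \<nu>))))"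
    and "C0m = 2 / 3 - (C2 \<gamma> \<mu> \<nu> + (2 / sqrt 5 + 2 / 3) * \<epsilon>)"
    and "C0p = 2 / 3 + (C2 \<gamma> \<mu> \<nu> + (2 / sqrt 5 + 2 / 3) * \<epsilon>)"
    and "m = C0m * \<kappa>\<^sup>2" and "M = C0p * \<kappa>\<^sup>2"
    and "0 < h" and "h \<le> 2 / ((C0m + C0p) * \<kappa>\<^sup>2)"
    and "T = (\<lambda>z. z - h *\<^sub>R gradient (q_tilde \<kappa> U) z)"
    and "r = 1 - h * m"
  shows "0 \<le> r \<and> r < 1 \<and>
    (\<forall>j\<in>{1..s}.
       T ` cball (x j) \<rho> \<subseteq> ball (x j) \<rho> \<and>
       r-lipschitz_on (cball (x j) \<rho>) T \<and>
       (\<exists>xt\<in>ball (x j) \<rho>.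
          local_minimizer (q_tilde \<kappa> U) xt \<and>
          (\<forall>y\<in>ball (x j) \<rho>. local_minimizer (q_tilde \<kappa> U) y \<longrightarrow> y = xt) \<and>
          (\<forall>z :: nat \<Rightarrow> real^3.
             z 0 \<in> cball (x j) \<rho> \<and> (\<forall>n. z (Suc n) = T (z n)) \<longrightarrow>
             (\<forall>n\<ge>1. z n \<in> ball (x j) \<rho>) \<and>
             z \<longlonglongrightarrow> xt \<and>
             (\<forall>n. norm (z n - xt) \<le> r ^ n * norm (z 0 - xt) \<and>
                  0 \<le> q_tilde \<kappa> U (z n) - q_tilde \<kappa> U xt \<and>
                  q_tilde \<kappa> U (z n) - q_tilde \<kappa> U xt
                    \<le> M / 2 * r ^ (2 * n) * (norm (z 0 - xt))\<^sup>2))))"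
proof -
  interpret perturbed_subspace \<kappa> \<rho> \<delta> \<gamma> \<mu> \<nu> s x U \<epsilon>
    by unfold_locales (fact assms)+
  have C0: "C0m = 2 / 3 - spread" "C0p = 2 / 3 + spread"
    by (simp_all add: assms(18,19) spread_def)
  \<comment> \<open>Clearing the denominator 1 + a b moves a b \<epsilon> to the other side and
    leaves \<epsilon> < a C0m. Multiplied by 2 \<kappa> / sqrt 3 this is the gradient condition at
    the centre, and since \<epsilon> is nonnegative it also yields C0m > 0.\<close>
  define a b where "a = sqrt 3 / 2 * \<gamma>" and "b = 2 / sqrt 5 + (2 / 3 :: real)"
  have ab: "a > 0" "b > 0"
    using \<gamma>_pos by (simp_all add: a_def b_def add_pos_pos)
  have "\<epsilon> < a * (2 / 3 - C2 \<gamma> \<mu> \<nu>) / (1 + a * b)"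
    using assms(17) by (simp add: a_def b_def)
  then have "\<epsilon> * (1 + a * b) < a * (2 / 3 - C2 \<gamma> \<mu> \<nu>)"
    using ab by (simp add: pos_less_divide_eq add_pos_pos)
  then have \<epsilon>_less: "\<epsilon> < a * C0m"
    by (simp add: assms(18) b_def algebra_simps)
  with \<epsilon>_nonneg have "0 < a * C0m"
    by linarith
  then have C0m: "C0m > 0"
    using ab(1) by (rule zero_less_mult_pos)
  then have m: "m > 0"
    using \<kappa> by (simp add: assms(20))
  have "\<epsilon> * (2 * \<kappa> / sqrt 3) < a * C0m * (2 * \<kappa> / sqrt 3)"
    using \<epsilon>_less \<kappa> by (intro mult_strict_right_mono) auto
  also have "\<dots> = m * \<rho>"
    by (simp add: a_def assms(20) \<gamma>_def power2_eq_square)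
  finally have g_center: "norm (gradient (q_tilde \<kappa> U) (x j)) < m * \<rho>" if "j \<in> {1..s}" for j
    using gradient_center[OF that] by (simp add: mult_ac)
  have descent: "ball_descent (q_tilde \<kappa> U) (gradient (q_tilde \<kappa> U)) (hess \<kappa>) (x j) \<rho> m M h"
    if j: "j \<in> {1..s}" for j
  proof
    show "(q_tilde \<kappa> U has_derivative (\<lambda>u. u \<bullet> gradient (q_tilde \<kappa> U) z)) (at z)" for z
      using has_derivative_q_tilde[of \<kappa> z] by (simp add: inner_gradient)
    show "m * (norm w)\<^sup>2 \<le> hess \<kappa> z w w" "hess \<kappa> z w w \<le> M * (norm w)\<^sup>2" if "z \<in> cball (x j) \<rho>" for z w
      using hess_bounds[OF j that, of w] by (simp_all add: assms(20,21) C0)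
    show "h \<le> 2 / (m + M)"
      using assms(23) by (simp add: assms(20,21) distrib_right)
  qed (fact has_derivative_gradient hess_commute \<rho> m assms g_center[OF j])+
  have T: "ball_descent.T (gradient (q_tilde \<kappa> U)) h = T"
    and r: "ball_descent.r m h = r"
    if "j \<in> {1..s}" for j
    using ball_descent.T_def[OF descent[OF that]] ball_descent.r_def[OF descent[OF that]]
    by (simp_all add: fun_eq_iff assms(24,25))
  \<comment> \<open>The bounds on \<open>r\<close> do not mention a source, but they are drawn from
    an instance at one.\<close>
  have "1 \<in> {1..s}"
    using s by simp
  from ball_descent.r[OF descent[OF this]] r[OF this] have "0 \<le> r \<and> r < 1"
    by simp
  moreover have "T ` cball (x j) \<rho> \<subseteq> ball (x j) \<rho>" if "j \<in> {1..s}" for j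
    using ball_descent.T_ball[OF descent[OF that]] T[OF that] by auto
  ultimately show ?thesis
    using ball_descent.lipschitz[OF descent] ball_descent.descent[OF descent] by (simp only: T r) blast
qed

end
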